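(* For every $0<s<1$ there exists a constant $C_*=C_*(s)$ such that the following two statements hold. (1) Let $W(\mathbf{x})=|\mathbf{x}|^{-s}\Omega(\theta)+|\mathbf{x}|^2$ on $\mathbb{R}^2$, where $\Omega:S^1\to\mathbb{R}$ is smooth, strictly positive, $\Omega(\theta+\pi)=\Omega(\theta)$, $\Omega(\frac{\pi}{2})=1$ and $$\Omega(\theta)\ge 1+C_*\big|\theta-\tfrac{\pi}{2}\big|^2,\quad\forall\theta\in[0,\pi].$$ Then $\rho_{\mathrm{1D}}$ is the unique minimizer (up to translation) of the energy $E$ associated to $W$. (2) Let $\omega:S^1\to\mathbb{R}$ be smooth, nonnegative, not identically zero, with $\omega(\theta+\pi)=\omega(\theta)$ and $\omega(\frac{\pi}{2})=0$, and suppose that for some constant $c_\omega>0$ $$\omega(\theta)\ge c_\omega\big|\theta-\tfrac{\pi}{2}\big|^2,\quad\forall\theta\in[0,\pi].$$ For $\alpha\ge0$ let $E_\alpha$ be the energy associated to $W_\alpha(\mathbf{x})=|\mathbf{x}|^{-s}(1+\alpha\omega(\theta))+|\mathbf{x}|^2$. Then there exists a unique $\alpha_*$ with $0<\alpha_*\le C_*/c_\omega$ (depending on $s$ and $\omega$) such that for any $\alpha>\alpha_*$, $\rho_{\mathrm{1D}}$ is the unique minimizer of $E_\alpha$ (up to translation), and for any $0\le\alpha<\alpha_*$, $\rho_{\mathrm{1D}}$ is not a minimizer of $E_\alpha$.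
   Context: $S^1=[-\pi,\pi)$ is the set of angles (mod $2\pi$); $\theta$ is the angle of $\mathbf{x}\in\mathbb{R}^2\setminus\{0\}$, i.e. $\mathbf{x}/|\mathbf{x}|=(\cos\theta,\sin\theta)$. For an interaction potential $W$, its associated energy is $E[\rho]=\frac12\int_{\mathbb{R}^2}\int_{\mathbb{R}^2}W(\mathbf{x}-\mathbf{y})\rho(\mathbf{y})\,\mathrm{d}\mathbf{y}\,\rho(\mathbf{x})\,\mathrm{d}\mathbf{x}$ for probability measures $\rho$ on $\mathbb{R}^2$; minimizers are global minimizers among probability measures. $\rho_{\mathrm{1D}}(\mathbf{x})=\rho_1(x_2)\delta(x_1)$, where $\rho_1(x)=C_1(R_1^2-|x|^2)_+^{(1+s)/2}$, $R_1=\Big(\frac{2\cos\frac{s\pi}{2}}{s(s+1)\pi}\beta\big(\frac12,\frac{3+s}{2}\big)\Big)^{-\frac{1}{s+2}}$, $C_1=\frac{2\cos\frac{s\pi}{2}}{s(s+1)\pi}$ ($\beta$ is the Beta function); $\rho_1$ is the unique energy minimizer for the one-dimensional interaction potential $|x|^{-s}+|x|^2$. *)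

theory Defs
  imports "HOL-Probability.Probability"
begin

text \<open>The plane is \<^typ>\<open>real \<times> real\<close>, whose norm is the Euclidean one.\<close>

definition angle :: "real \<times> real \<Rightarrow> real" where
  "angle x = (THE \<theta>. - pi \<le> \<theta> \<and> \<theta> < pi \<and> x /\<^sub>R norm x = (cos \<theta>, sin \<theta>))"

text \<open>
  A function on the circle of angles mod \<open>2\<pi>\<close> is represented by its periodic lift to the real line.
  All angular functions below are in fact \<open>\<pi>\<close>-periodic, so \<open>2\<pi>\<close>-periodicity is never stated separately,
  and smoothness on the circle is smoothness of the lift on the whole line.
\<close>

definition smooth :: "(real \<Rightarrow> real) \<Rightarrow> bool" where
  "smooth f \<longleftrightarrow> (\<forall>n x. (deriv ^^ n) f differentiable (at x))"

text \<open>
  The potential \<open>|x|\<^sup>-\<^sup>s \<Omega>(\<theta>) + |x|\<^sup>2\<close>. It is used for strictly positive \<open>\<Omega>\<close> and \<open>s > 0\<close> only, so it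
  takes nonnegative values and its value at the origin is infinite. That value matters for measures
  with atoms, and has to be set explicitly because \<open>0 powr (- s) = 0\<close> in HOL.
\<close>

definition potential :: "real \<Rightarrow> (real \<Rightarrow> real) \<Rightarrow> real \<times> real \<Rightarrow> ennreal" where
  "potential s \<Omega> x =
     (if x = 0 then \<infinity> else ennreal (norm x powr (- s) * \<Omega> (angle x) + (norm x)\<^sup>2))"

definition borel_prob :: "(real \<times> real) measure \<Rightarrow> bool" where
  "borel_prob \<rho> \<longleftrightarrow> prob_space \<rho> \<and> sets \<rho> = sets borel"

definition energy :: "(real \<times> real \<Rightarrow> ennreal) \<Rightarrow> (real \<times> real) measure \<Rightarrow> ennreal" where
  "energy W \<rho> = (1 / 2) * (\<integral>\<^sup>+ x. (\<integral>\<^sup>+ y. W (x - y) \<partial>\<rho>) \<partial>\<rho>)"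

definition minimizer :: "(real \<times> real \<Rightarrow> ennreal) \<Rightarrow> (real \<times> real) measure \<Rightarrow> bool" where
  "minimizer W \<rho> \<longleftrightarrow> borel_prob \<rho> \<and> (\<forall>\<mu>. borel_prob \<mu> \<longrightarrow> energy W \<rho> \<le> energy W \<mu>)"

definition unique_minimizer_upto_translation ::
  "(real \<times> real \<Rightarrow> ennreal) \<Rightarrow> (real \<times> real) measure \<Rightarrow> bool" where
  "unique_minimizer_upto_translation W \<rho> \<longleftrightarrow>
     minimizer W \<rho> \<and> (\<forall>\<mu>. minimizer W \<mu> \<longrightarrow> (\<exists>a. \<mu> = distr \<rho> borel (\<lambda>x. x + a)))"

definition C1 :: "real \<Rightarrow> real" where
  "C1 s = 2 * cos (s * pi / 2) / (s * (s + 1) * pi)"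

definition R1 :: "real \<Rightarrow> real" where
  "R1 s = (2 * cos (s * pi / 2) / (s * (s + 1) * pi) * Beta (1 / 2) ((3 + s) / 2))
            powr (- (1 / (s + 2)))"

definition rho1 :: "real \<Rightarrow> real \<Rightarrow> real" where
  "rho1 s x = C1 s * max 0 ((R1 s)\<^sup>2 - \<bar>x\<bar>\<^sup>2) powr ((1 + s) / 2)"

text \<open>The measure \<open>\<rho>\<^sub>1(x\<^sub>2) \<delta>(x\<^sub>1)\<close>: the density \<open>\<rho>\<^sub>1\<close> placed on the vertical axis.\<close>

definition rho1D :: "real \<Rightarrow> (real \<times> real) measure" where
  "rho1D s = distr (density lborel (\<lambda>t. ennreal (rho1 s t))) borel (\<lambda>t. (0, t))"

end

theory Submission
  imports Defs
begin

text \<open>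
  The proof reduces everything to the line, by projecting the plane onto it.

  On the line, the interaction is \<open>|t|\<^sup>-\<^sup>s + t\<^sup>2\<close>. The measure \<open>\<rho>\<^sub>1\<close> satisfies the Euler-Lagrange conditions
  (\<open>euler_lagrange_equality\<close>, \<open>euler_lagrange_inequality\<close>): its density is a mixture of the equilibrium densities
  \<open>(r\<^sup>2 - y\<^sup>2) powr ((s - 1) / 2)\<close> of smaller intervals, whose potentials are constant inside the interval
  (\<open>nn_integral_riesz_arcsine_unit\<close>). The kernel \<open>|t|\<^sup>-\<^sup>s\<close> is strictly positive definite, because \<open>|t - u|\<^sup>-\<^sup>s\<close> is the
  weight of the set of intervals that contain both \<open>t\<close> and \<open>u\<close>, for a suitable measure on intervals
  (\<open>riesz_layer_cake\<close>). Together these facts make \<open>\<rho>\<^sub>1\<close> the unique minimizer up to translation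
  (\<open>line_energy_minimal\<close>).

  In the plane, consider the projections \<open>x \<mapsto> x\<^sub>2 + m x\<^sub>1\<close> with \<open>m\<close> uniform on \<open>[-1, 1]\<close>. Each projected measure has
  at least the one-dimensional energy of \<open>\<rho>\<^sub>1\<close>. Averaging over \<open>m\<close>, the quadratic part becomes
  \<open>x\<^sub>2\<^sup>2 + x\<^sub>1\<^sup>2 / 3 \<le> |x|\<^sup>2\<close>, while the averaged Riesz kernel is homogeneous, agrees with \<open>|x|\<^sup>-\<^sup>s\<close> on the vertical axis,
  and is at most \<open>|x|\<^sup>-\<^sup>s (1 + C (x\<^sub>1 / |x|)\<^sup>2)\<close> (\<open>projected_riesz_le\<close>): the singularity \<open>|t|\<^sup>-\<^sup>s\<close> is integrable and the first
  order term cancels by symmetry. For a potential above that bound that equals \<open>|t|\<^sup>-\<^sup>s + t\<^sup>2\<close> on the vertical axis, no measure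
  therefore has less energy than \<open>\<rho>\<^sub>1\<^sub>D\<close>, and the remaining \<open>2/3\<close> of \<open>x\<^sub>1\<^sup>2\<close> forces a minimizer onto a vertical line, where uniqueness on the line
  applies (\<open>unique_minimizer_of_projection_bound\<close>).

  For the family \<open>1 + \<alpha> \<omega>\<close>, minimality of \<open>\<rho>\<^sub>1\<^sub>D\<close> at one \<open>\<alpha>\<close> gives minimality and uniqueness at every larger one
  (\<open>minimizer_rho1D_mono\<close>), so the critical strength is the infimum of the \<open>\<alpha>\<close> with minimality. It is at most
  \<open>C / c\<close> by the first part. It is positive because for small \<open>\<alpha>\<close> the equal mixture of \<open>\<rho>\<^sub>1\<close> on the vertical and on
  the horizontal axis has smaller energy (\<open>not_minimizer_weak_anisotropy\<close>).
\<close>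

section \<open>Beta integrals and the Riesz potential of an arcsine-type density\<close>

lemma nn_integral_Beta:
  fixes a b :: real
  assumes "0 < a" "0 < b"
  shows "(\<integral>\<^sup>+t. ennreal (t powr (a - 1) * (1 - t) powr (b - 1)) * indicator {0..1} t \<partial>lborel)
    = ennreal (Beta a b)"
  using nn_integral_has_integral_lebesgue'[OF _ has_integral_Beta_real[OF assms]] by simp

lemma Gamma_reflection_real:
  fixes a :: real
  shows "Gamma a * Gamma (1 - a) = pi / sin (pi * a)"
proof -
  have "complex_of_real (Gamma a * Gamma (1 - a)) = of_real (pi / sin (pi * a))"
    using Gamma_reflection_complex[of "of_real a"]
    by (simp add: sin_of_real flip: Gamma_complex_of_real of_real_mult)
       (simp flip: Gamma_complex_of_real)
  then show ?thesis
    using of_real_eq_iff by blast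
qed

lemma Beta_reflection:
  "Beta ((1 - s) / 2) ((1 + s) / 2) = pi / cos (s * pi / 2)"
proof -
  have 1: "(1 + s) / 2 = 1 - (1 - s) / 2"
    by (simp add: field_simps)
  have 2: "pi * ((1 - s) / 2) = pi / 2 - s * pi / 2"
    by (simp add: field_simps)
  have 3: "sin (pi * ((1 - s) / 2)) = cos (s * pi / 2)"
    unfolding 2 by (simp add: sin_diff)
  show ?thesis
    using Gamma_reflection_real[of "(1 - s) / 2"] unfolding 1 Beta_def 3 by simp
qed

lemma nn_integral_reflect:
  fixes f :: "real \<Rightarrow> ennreal"
  assumes [measurable]: "f \<in> borel_measurable borel"
  shows "(\<integral>\<^sup>+x. f x \<partial>lborel) = (\<integral>\<^sup>+x. f (- x) \<partial>lborel)"
  using nn_integral_real_affine[of f "-1" 0] by simp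

lemma nn_integral_Icc_split:
  fixes f :: "real \<Rightarrow> ennreal"
  assumes [measurable]: "f \<in> borel_measurable borel" and "a \<le> b" "b \<le> c"
  shows "(\<integral>\<^sup>+x. f x * indicator {a..c} x \<partial>lborel)
    = (\<integral>\<^sup>+x. f x * indicator {a..b} x \<partial>lborel) + (\<integral>\<^sup>+x. f x * indicator {b..c} x \<partial>lborel)"
proof -
  have "AE x in lborel. x \<noteq> b"
    by (rule AE_lborel_singleton)
  then have "AE x in lborel. f x * indicator {a..c} x = f x * indicator {a..b} x + f x * indicator {b..c} x"
    by eventually_elim (use assms(2,3) in \<open>auto simp: indicator_def\<close>)
  then have "(\<integral>\<^sup>+x. f x * indicator {a..c} x \<partial>lborel)
    = (\<integral>\<^sup>+x. f x * indicator {a..b} x + f x * indicator {b..c} x \<partial>lborel)"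
    by (rule nn_integral_cong_AE)
  then show ?thesis
    by (simp add: nn_integral_add)
qed

lemma nn_integral_symmetric_interval:
  fixes f :: "real \<Rightarrow> ennreal"
  assumes [measurable]: "f \<in> borel_measurable borel"
  shows "(\<integral>\<^sup>+x. f x * indicator {-1..1} x \<partial>lborel)
    = (\<integral>\<^sup>+x. (f x + f (- x)) * indicator {0..1} x \<partial>lborel)"
proof -
  have "(\<integral>\<^sup>+x. f x * indicator {-1..0} x \<partial>lborel) = (\<integral>\<^sup>+x. f (- x) * indicator {0..1} x \<partial>lborel)"
    by (subst nn_integral_reflect) (auto intro!: nn_integral_cong simp: indicator_def)
  then show ?thesis
    by (subst nn_integral_Icc_split[of f "-1" 0 1]) (auto simp: distrib_right nn_integral_add add.commute)
qed

text \<open>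
  For an observation point at an end of the interval, the substitution \<open>y = x (1 - 2 w)\<close> factors the
  integrand into powers of \<open>w\<close> and \<open>1 - w\<close>. It is applied below with \<open>p = (s - 1) / 2\<close>, where the
  power of \<open>2 x\<close> disappears, and with \<open>p = (1 + s) / 2\<close>.
\<close>

lemma nn_integral_riesz_endpoint:
  fixes x s p :: real
  assumes "0 < x" "- 1 < p" "- 1 < p - s"
  shows "(\<integral>\<^sup>+y. ennreal (\<bar>x - y\<bar> powr (- s) * (x\<^sup>2 - y\<^sup>2) powr p) * indicator {-x..x} y \<partial>lborel)
    = ennreal ((2 * x) powr (2 * p - s + 1) * Beta (p - s + 1) (p + 1))"
proof -
  have pt: "ennreal (\<bar>x - (x + (- 2 * x) * w)\<bar> powr (- s) * (x\<^sup>2 - (x + (- 2 * x) * w)\<^sup>2) powr p)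
        * indicator {-x..x} (x + (- 2 * x) * w)
      = ennreal ((2 * x) powr (2 * p - s)) *
        (ennreal (w powr ((p - s + 1) - 1) * (1 - w) powr ((p + 1) - 1)) * indicator {0..1} w)" for w
  proof (cases "w \<in> {0..1}")
    case True
    have 1: "x\<^sup>2 - (x + (- 2 * x) * w)\<^sup>2 = (2 * x) * (2 * x) * (w * (1 - w))"
      by (simp add: power2_eq_square algebra_simps)
    have 2: "\<bar>x - (x + (- 2 * x) * w)\<bar> = 2 * x * w"
      using True assms by (simp add: abs_mult)
    have mem: "x + (- 2 * x) * w \<in> {-x..x}"
      using True assms by (auto simp: algebra_simps mult_left_le)
    have "(2 * x * w) powr (- s) * ((2 * x) * (2 * x) * (w * (1 - w))) powr p
      = (2 * x) powr (- s) * w powr (- s) * ((2 * x) powr p * (2 * x) powr p * (w powr p * (1 - w) powr p))"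
      by (simp only: powr_mult)
    also have "\<dots> = ((2 * x) powr (- s) * (2 * x) powr p * (2 * x) powr p) * (w powr (- s) * w powr p) * (1 - w) powr p"
      by (simp add: mult_ac)
    also have "\<dots> = (2 * x) powr (2 * p - s) * (w powr (p - s) * (1 - w) powr p)"
      by (simp flip: powr_add)
    finally show ?thesis
      unfolding 1 2 using mem True by (simp add: ennreal_mult')
  next
    case False
    have "x + (- 2 * x) * w \<le> x \<longleftrightarrow> 0 \<le> w" "- x \<le> x + (- 2 * x) * w \<longleftrightarrow> w \<le> 1"
      using assms by (auto simp: zero_le_mult_iff)
    with False have "x + (- 2 * x) * w \<notin> {-x..x}"
      by auto
    then show ?thesis
      using False by simp
  qed
  have "(\<integral>\<^sup>+y. ennreal (\<bar>x - y\<bar> powr (- s) * (x\<^sup>2 - y\<^sup>2) powr p) * indicator {-x..x} y \<partial>lborel)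
    = ennreal \<bar>- 2 * x\<bar> * (ennreal ((2 * x) powr (2 * p - s)) * ennreal (Beta (p - s + 1) (p + 1)))"
    apply (subst nn_integral_real_affine[where c = "- 2 * x" and t = x])
    subgoal by measurable
    subgoal using assms by simp
    subgoal
      apply (subst pt)
      apply (subst nn_integral_cmult)
      subgoal by measurable
      apply (subst nn_integral_Beta)
      using assms by auto
    done
  also have "\<dots> = ennreal ((2 * x) * (2 * x) powr (2 * p - s) * Beta (p - s + 1) (p + 1))"
    using assms by (simp only: ennreal_mult' abs_mult abs_of_pos powr_ge_zero mult_nonneg_nonneg less_imp_le mult.assoc)
      (simp flip: ennreal_mult' ennreal_numeral add: mult.assoc)
  also have "(2 * x) * (2 * x) powr (2 * p - s) = (2 * x) powr (2 * p - s + 1)"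
    using assms by (simp add: powr_add)
  finally show ?thesis .
qed

text \<open>
  The density \<open>(1 - y\<^sup>2) powr ((s - 1) / 2)\<close> is the equilibrium density of the interval for the kernel
  \<open>|x|\<^sup>-\<^sup>s\<close>: its potential does not depend on the interior point \<open>x\<close>. The Moebius map \<open>u \<mapsto> (x + u) / (1 + x u)\<close>
  preserves \<open>[-1, 1]\<close> and carries the singularity from \<open>x\<close> to \<open>0\<close>. After folding \<open>[-1, 1]\<close> onto \<open>[0, 1]\<close>,
  the only remaining trace of \<open>x\<close> is a factor \<open>1 / (1 - x\<^sup>2 u\<^sup>2)\<close>, which the second substitution absorbs; what is
  left is a Beta integral, evaluated by the reflection formula.
\<close>

lemma nn_integral_riesz_arcsine_unit:
  fixes x s :: real
  assumes s: "0 < s" "s < 1" and x: "\<bar>x\<bar> < 1"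
  shows "(\<integral>\<^sup>+y. ennreal (\<bar>x - y\<bar> powr (- s) * (1 - y\<^sup>2) powr ((s - 1) / 2)) * indicator {-1..1} y \<partial>lborel)
    = ennreal (pi / cos (s * pi / 2))"
proof -
  define f where "f y = \<bar>x - y\<bar> powr (- s) * (1 - y\<^sup>2) powr ((s - 1) / 2)" for y
  define g where "g u = (x + u) / (1 + x * u)" for u
  define g' where "g' u = (1 - x\<^sup>2) / (1 + x * u)\<^sup>2" for u
  define h where "h u = (1 - x\<^sup>2) powr ((1 - s) / 2) * \<bar>u\<bar> powr (- s) * (1 - u\<^sup>2) powr ((s - 1) / 2)" for u
  define w where "w u = u\<^sup>2 * (1 - x\<^sup>2) / (1 - x\<^sup>2 * u\<^sup>2)" for u
  define w' where "w' u = 2 * u * (1 - x\<^sup>2) / (1 - x\<^sup>2 * u\<^sup>2)\<^sup>2" for u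
  \<comment> \<open>The Beta integrand, with parameters \<open>(1 - s) / 2\<close> and \<open>(1 + s) / 2\<close>; \<open>w\<close> is the map that turns \<open>h\<close>, folded onto
    \<open>[0, 1]\<close>, into it.\<close>
  define \<phi> where "\<phi> t = t powr ((1 - s) / 2 - 1) * (1 - t) powr ((1 + s) / 2 - 1)" for t :: real
  have meas [measurable]: "f \<in> borel_measurable borel" "h \<in> borel_measurable borel"
      "\<phi> \<in> borel_measurable borel"
    unfolding f_def h_def \<phi>_def by measurable
  have x2: "x\<^sup>2 < 1"
    using x by (simp add: abs_square_less_1)
  have pos: "0 < 1 + x * u" if "u \<in> {-1..1}" for u
  proof -
    have "\<bar>x * u\<bar> \<le> \<bar>x\<bar>"
      unfolding abs_mult using that by (intro mult_left_le) auto
    then show ?thesis using x by linarith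
  qed
  have pos2: "0 < 1 - x\<^sup>2 * u\<^sup>2" if "u \<in> {-1..1}" for u
  proof -
    have "1 - x\<^sup>2 * u\<^sup>2 = (1 + x * u) * (1 + x * (- u))"
      by (simp add: algebra_simps power2_eq_square)
    also have "0 < \<dots>"
      using that by (intro mult_pos_pos pos) auto
    finally show ?thesis .
  qed
  have g_ends: "g (- 1) = - 1" "g 1 = 1"
    using pos[of "- 1"] pos[of 1] unfolding g_def by (auto simp: divide_eq_eq)
  have "(\<integral>\<^sup>+y. ennreal (f y) * indicator {-1..1} y \<partial>lborel)
      = (\<integral>\<^sup>+y. ennreal (f y * indicator {g (- 1)..g 1} y) \<partial>lborel)"
    unfolding g_ends by (intro nn_integral_cong) (auto simp: indicator_def)
  also have "\<dots> = (\<integral>\<^sup>+u. ennreal (f (g u) * g' u * indicator {-1..1} u) \<partial>lborel)"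
  proof (rule nn_integral_substitution)
    show "set_borel_measurable borel {g (- 1)..g 1} f"
      unfolding set_borel_measurable_def by measurable
    show "(g has_real_derivative g' u) (at u)" if "u \<in> {-1..1}" for u
    proof -
      have "((\<lambda>u. (x + u) / (1 + x * u)) has_real_derivative
          (1 * (1 + x * u) - (x + u) * x) / ((1 + x * u) * (1 + x * u))) (at u)"
        using pos[OF that] by (auto intro!: derivative_eq_intros)
      moreover have "1 * (1 + x * u) - (x + u) * x = 1 - x\<^sup>2"
        by (simp add: algebra_simps power2_eq_square)
      ultimately show ?thesis
        unfolding g_def[abs_def] g'_def power2_eq_square[of "1 + x * u"] by (simp only:)
    qed
    show "continuous_on {-1..1} g'"
      unfolding g'_def using pos by (intro continuous_intros) (force simp: less_le)
    show "0 \<le> g' u" for u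
      unfolding g'_def using x2 by simp
  qed simp
  also have "\<dots> = (\<integral>\<^sup>+u. ennreal (h u / (1 + x * u)) * indicator {-1..1} u \<partial>lborel)"
  proof (rule nn_integral_cong)
    fix u
    show "ennreal (f (g u) * g' u * indicator {-1..1} u) = ennreal (h u / (1 + x * u)) * indicator {-1..1} u"
    proof (cases "u \<in> {-1..1}")
      case True
      define d where "d = 1 + x * u"
      have d: "0 < d" unfolding d_def using pos[OF True] .
      have e1: "x - g u = - u * (1 - x\<^sup>2) / d"
        using d unfolding g_def d_def by (simp add: field_simps power2_eq_square)
      have e1': "\<bar>x - g u\<bar> = \<bar>u\<bar> * (1 - x\<^sup>2) / d"
        unfolding e1 using d x2 by (simp add: abs_mult)
      have e2: "1 - (g u)\<^sup>2 = (1 - x\<^sup>2) * (1 - u\<^sup>2) / (d * d)"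
      proof -
        have "(1 - x\<^sup>2) * (1 - u\<^sup>2) = d * d - (x + u)\<^sup>2"
          unfolding d_def by (simp add: algebra_simps power2_eq_square)
        then show ?thesis
          unfolding g_def d_def[symmetric] using d by (simp add: power_divide diff_divide_distrib power2_eq_square)
      qed
      have u2: "0 \<le> 1 - u\<^sup>2" using True abs_square_le_1[of u] by auto
      have "f (g u) * g' u = (\<bar>u\<bar> * (1 - x\<^sup>2) / d) powr (- s) * ((1 - x\<^sup>2) * (1 - u\<^sup>2) / (d * d)) powr ((s - 1) / 2)
            * ((1 - x\<^sup>2) / d\<^sup>2)"
        unfolding f_def e1' e2 g'_def d_def[symmetric] ..
      also have "\<dots> = (\<bar>u\<bar> powr (- s) * (1 - x\<^sup>2) powr (- s) * d powr s)
          * ((1 - x\<^sup>2) powr ((s - 1) / 2) * (1 - u\<^sup>2) powr ((s - 1) / 2) * d powr (1 - s))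
          * ((1 - x\<^sup>2) powr 1 * d powr (- 2))"
      proof -
        have a: "(\<bar>u\<bar> * (1 - x\<^sup>2) / d) powr (- s) = \<bar>u\<bar> powr (- s) * (1 - x\<^sup>2) powr (- s) * d powr s"
          by (simp only: powr_mult powr_divide, simp only: powr_minus[of d] divide_inverse inverse_inverse_eq)
        have b: "(d * d) powr ((s - 1) / 2) = d powr (s - 1)"
          unfolding powr_mult powr_add[symmetric] by (rule arg_cong2[where f = "(powr)"]) (auto simp: field_simps)
        have b': "inverse (d powr (s - 1)) = d powr (1 - s)"
          unfolding powr_minus[symmetric] by simp
        have c: "((1 - x\<^sup>2) * (1 - u\<^sup>2) / (d * d)) powr ((s - 1) / 2)
            = (1 - x\<^sup>2) powr ((s - 1) / 2) * (1 - u\<^sup>2) powr ((s - 1) / 2) * d powr (1 - s)"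
          by (simp only: powr_divide powr_mult[of "1 - x\<^sup>2"] b, simp only: divide_inverse b')
        have e: "(1 - x\<^sup>2) / d\<^sup>2 = (1 - x\<^sup>2) powr 1 * d powr (- 2)"
          using d x2 by (simp add: powr_minus_divide)
        show ?thesis unfolding a c e ..
      qed
      also have "\<dots> = ((1 - x\<^sup>2) powr (- s) * (1 - x\<^sup>2) powr ((s - 1) / 2) * (1 - x\<^sup>2) powr 1) * \<bar>u\<bar> powr (- s)
          * (1 - u\<^sup>2) powr ((s - 1) / 2) * (d powr s * d powr (1 - s) * d powr (- 2))"
        by (simp only: mult_ac)
      also have "\<dots> = (1 - x\<^sup>2) powr ((1 - s) / 2) * \<bar>u\<bar> powr (- s) * (1 - u\<^sup>2) powr ((s - 1) / 2) * d powr (- 1)"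
      proof -
        have q1: "- s + (s - 1) / 2 + 1 = (1 - s) / 2" by (simp add: field_simps)
        have q2: "s + (1 - s) + - 2 = - 1" by simp
        show ?thesis unfolding powr_add[symmetric] q1 q2 ..
      qed
      also have "\<dots> = h u / (1 + x * u)"
        unfolding h_def d_def[symmetric] divide_inverse[of _ d] using d by (simp only: powr_neg_one inverse_eq_divide)
      finally show ?thesis using True by simp
    qed simp
  qed
  also have "\<dots> = (\<integral>\<^sup>+u. (ennreal (h u / (1 + x * u)) + ennreal (h (- u) / (1 + x * (- u)))) * indicator {0..1} u \<partial>lborel)"
    by (rule nn_integral_symmetric_interval) measurable
  also have "\<dots> = (\<integral>\<^sup>+u. ennreal (\<phi> (w u) * w' u * indicator {0..1} u) \<partial>lborel)"
  proof (rule nn_integral_cong)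
    fix u
    show "(ennreal (h u / (1 + x * u)) + ennreal (h (- u) / (1 + x * (- u)))) * indicator {0..1} u
        = ennreal (\<phi> (w u) * w' u * indicator {0..1} u)"
    proof (cases "u \<in> {0..1}")
      case True
      then have mem: "u \<in> {-1..1}" "- u \<in> {-1..1}" by auto
      define d where "d = 1 - x\<^sup>2 * u\<^sup>2"
      have d: "0 < d" unfolding d_def using pos2[OF mem(1)] .
      have u2: "0 \<le> 1 - u\<^sup>2" using mem abs_square_le_1[of u] by auto
      have ps: "0 < 1 + x * u" "0 < 1 - x * u"
        using pos[OF mem(1)] pos[OF mem(2)] by simp_all
      have fact: "d = (1 + x * u) * (1 - x * u)"
        unfolding d_def by (simp add: algebra_simps power2_eq_square)
      have h0: "0 \<le> h u" "h (- u) = h u" unfolding h_def by auto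
      have "ennreal (h u / (1 + x * u)) + ennreal (h (- u) / (1 + x * (- u))) = ennreal (h u / (1 + x * u) + h u / (1 - x * u))"
        using h0 ps by (simp flip: ennreal_plus)
      also have "h u / (1 + x * u) + h u / (1 - x * u) = 2 * h u / d"
        unfolding fact using ps by (simp add: field_simps)
      also have "2 * h u / d = \<phi> (w u) * w' u"
      proof (cases "u = 0")
        case True
        then show ?thesis by (simp add: h_def w_def w'_def)
      next
        case False
        then have u: "0 < u" using True by simp
        have e1: "w u = u * u * (1 - x\<^sup>2) / d" unfolding w_def d_def by (simp add: power2_eq_square)
        have e2: "1 - w u = (1 - u\<^sup>2) / d"
          unfolding w_def d_def[symmetric] using d by (simp add: field_simps) (simp add: d_def algebra_simps)
        have e3: "w' u = 2 * u powr 1 * (1 - x\<^sup>2) powr 1 * d powr (- 2)"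
          unfolding w'_def d_def[symmetric] using d u x2 by (simp add: powr_minus divide_inverse)
        have a1: "(u * u * (1 - x\<^sup>2) / d) powr ((1 - s) / 2 - 1)
            = u powr (- 1 - s) * (1 - x\<^sup>2) powr ((1 - s) / 2 - 1) * d powr ((1 + s) / 2)"
        proof -
          have "(u * u * (1 - x\<^sup>2) / d) powr ((1 - s) / 2 - 1)
            = (u powr ((1 - s) / 2 - 1) * u powr ((1 - s) / 2 - 1)) * (1 - x\<^sup>2) powr ((1 - s) / 2 - 1) * inverse (d powr ((1 - s) / 2 - 1))"
            by (simp only: powr_mult powr_divide, simp only: divide_inverse)
          also have "inverse (d powr ((1 - s) / 2 - 1)) = d powr ((1 + s) / 2)"
            unfolding powr_minus[symmetric] by (rule arg_cong2[where f = "(powr)"]) (auto simp: field_simps)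
          also have "u powr ((1 - s) / 2 - 1) * u powr ((1 - s) / 2 - 1) = u powr (- 1 - s)"
            unfolding powr_add[symmetric] by (rule arg_cong2[where f = "(powr)"]) (auto simp: field_simps)
          finally show ?thesis .
        qed
        have a2: "((1 - u\<^sup>2) / d) powr ((1 + s) / 2 - 1) = (1 - u\<^sup>2) powr ((s - 1) / 2) * d powr ((1 - s) / 2)"
        proof -
          have "((1 - u\<^sup>2) / d) powr ((1 + s) / 2 - 1) = (1 - u\<^sup>2) powr ((1 + s) / 2 - 1) * inverse (d powr ((1 + s) / 2 - 1))"
            by (simp only: powr_divide, simp only: divide_inverse)
          also have "inverse (d powr ((1 + s) / 2 - 1)) = d powr ((1 - s) / 2)"
            unfolding powr_minus[symmetric] by (rule arg_cong2[where f = "(powr)"]) (auto simp: field_simps)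
          also have "(1 - u\<^sup>2) powr ((1 + s) / 2 - 1) = (1 - u\<^sup>2) powr ((s - 1) / 2)"
            by (rule arg_cong2[where f = "(powr)"]) (auto simp: field_simps)
          finally show ?thesis .
        qed
        have "\<phi> (w u) * w' u = 2 * ((1 - x\<^sup>2) powr ((1 - s) / 2 - 1) * (1 - x\<^sup>2) powr 1)
            * (u powr (- 1 - s) * u powr 1) * (1 - u\<^sup>2) powr ((s - 1) / 2)
            * (d powr ((1 + s) / 2) * d powr ((1 - s) / 2) * d powr (- 2))"
          unfolding \<phi>_def e2 e3 unfolding e1 a1 a2 by (simp only: mult_ac)
        also have "\<dots> = 2 * (1 - x\<^sup>2) powr ((1 - s) / 2) * u powr (- s) * (1 - u\<^sup>2) powr ((s - 1) / 2) * d powr (- 1)"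
        proof -
          have q: "(1 + s) / 2 + (1 - s) / 2 + - 2 = - 1" by (simp add: field_simps)
          show ?thesis unfolding powr_add[symmetric] q by simp
        qed
        also have "\<dots> = 2 * h u / d"
          unfolding h_def divide_inverse[of _ d] using d u by (simp only: powr_neg_one inverse_eq_divide mult_ac abs_of_pos)
        finally show ?thesis ..
      qed
      finally show ?thesis using True by simp
    qed simp
  qed
  also have "\<dots> = (\<integral>\<^sup>+t. ennreal (\<phi> t * indicator {w 0..w 1} t) \<partial>lborel)"
  proof (rule nn_integral_substitution[symmetric])
    show "set_borel_measurable borel {w 0..w 1} \<phi>"
      unfolding set_borel_measurable_def by measurable
    show "(w has_real_derivative w' u) (at u)" if "u \<in> {0..1}" for u
    proof -
      have d: "1 - x\<^sup>2 * u\<^sup>2 \<noteq> 0" using pos2[of u] that by auto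
      have "((\<lambda>u. u\<^sup>2 * (1 - x\<^sup>2) / (1 - x\<^sup>2 * u\<^sup>2)) has_real_derivative
          ((2 * u * (1 - x\<^sup>2)) * (1 - x\<^sup>2 * u\<^sup>2) - u\<^sup>2 * (1 - x\<^sup>2) * (- (x\<^sup>2 * (2 * u))))
          / ((1 - x\<^sup>2 * u\<^sup>2) * (1 - x\<^sup>2 * u\<^sup>2))) (at u)"
        using d by (auto intro!: derivative_eq_intros)
      moreover have "(2 * u * (1 - x\<^sup>2)) * (1 - x\<^sup>2 * u\<^sup>2) - u\<^sup>2 * (1 - x\<^sup>2) * (- (x\<^sup>2 * (2 * u)))
          = 2 * u * (1 - x\<^sup>2)"
        by (simp add: algebra_simps power2_eq_square)
      ultimately show ?thesis
        unfolding w_def[abs_def] w'_def power2_eq_square[of "1 - x\<^sup>2 * u\<^sup>2"] by (simp only:)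
    qed
    have "1 - x\<^sup>2 * u\<^sup>2 \<noteq> 0" if "u \<in> {0..1}" for u
      using pos2[of u] that by force
    then show "continuous_on {0..1} w'"
      unfolding w'_def by (intro continuous_intros) auto
    show "0 \<le> w' u" if "u \<in> {0..1}" for u
      unfolding w'_def using x2 that by simp
  qed simp
  also have "\<dots> = (\<integral>\<^sup>+t. ennreal (\<phi> t) * indicator {0..1} t \<partial>lborel)"
    using x2 by (intro nn_integral_cong) (auto simp: w_def indicator_def)
  also have "\<dots> = ennreal (Beta ((1 - s) / 2) ((1 + s) / 2))"
    unfolding \<phi>_def using s by (intro nn_integral_Beta) auto
  finally show ?thesis
    unfolding f_def Beta_reflection .
qed

section \<open>The Riesz potential of a semicircle-type density\<close>

text \<open>
  The names refer to the limit \<open>s = 0\<close>, where the two densities are those of the arcsine and of the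
  semicircle law.
\<close>

definition arcsine_potential :: "real \<Rightarrow> real \<Rightarrow> real \<Rightarrow> ennreal" where
  "arcsine_potential s r x =
     (\<integral>\<^sup>+y. ennreal (\<bar>x - y\<bar> powr (- s) * (r\<^sup>2 - y\<^sup>2) powr ((s - 1) / 2)) * indicator {-r..r} y \<partial>lborel)"

definition semicircle_potential :: "real \<Rightarrow> real \<Rightarrow> real \<Rightarrow> ennreal" where
  "semicircle_potential s r x =
     (\<integral>\<^sup>+y. ennreal (\<bar>x - y\<bar> powr (- s) * (r\<^sup>2 - y\<^sup>2) powr ((1 + s) / 2)) * indicator {-r..r} y \<partial>lborel)"

lemma arcsine_potential_inside:
  assumes s: "0 < s" "s < 1" and x: "\<bar>x\<bar> < r"
  shows "arcsine_potential s r x = ennreal (pi / cos (s * pi / 2))"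
proof -
  have r: "0 < r" using x by linarith
  have pt: "ennreal (\<bar>x - (0 + r * w)\<bar> powr (- s) * (r\<^sup>2 - (0 + r * w)\<^sup>2) powr ((s - 1) / 2)) * indicator {-r..r} (0 + r * w)
     = ennreal (1 / r) * (ennreal (\<bar>x / r - w\<bar> powr (- s) * (1 - w\<^sup>2) powr ((s - 1) / 2)) * indicator {-1..1} w)" for w
  proof -
    have 1: "\<bar>x - (0 + r * w)\<bar> = r * \<bar>x / r - w\<bar>"
      using r by (simp add: abs_mult_pos' right_diff_distrib)
    have 2: "r\<^sup>2 - (0 + r * w)\<^sup>2 = r * r * (1 - w\<^sup>2)"
      by (simp add: power2_eq_square algebra_simps)
    have ind: "indicator {-r..r} (0 + r * w) = (indicator {-1..1} w :: ennreal)"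
    proof -
      have "r * w \<le> r \<longleftrightarrow> w \<le> 1" "- r \<le> r * w \<longleftrightarrow> - 1 \<le> w"
        using r mult_le_cancel_left_pos[of r w 1] mult_le_cancel_left_pos[of r "- 1" w] by simp_all
      then show ?thesis by (simp add: indicator_def)
    qed
    have "(r * \<bar>x / r - w\<bar>) powr (- s) * (r * r * (1 - w\<^sup>2)) powr ((s - 1) / 2)
      = (r powr (- s) * (r powr ((s - 1) / 2) * r powr ((s - 1) / 2))) * (\<bar>x / r - w\<bar> powr (- s) * (1 - w\<^sup>2) powr ((s - 1) / 2))"
      by (simp only: powr_mult mult_ac)
    also have "r powr (- s) * (r powr ((s - 1) / 2) * r powr ((s - 1) / 2)) = r powr (- 1)"
      unfolding powr_add[symmetric] by (rule arg_cong2[where f = "(powr)"]) (auto simp: field_simps)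
    also have "r powr (- 1) = 1 / r" using r by simp
    finally show ?thesis
      unfolding 1 2 ind using r by (simp only: ennreal_mult' zero_le_divide_1_iff less_imp_le mult.assoc)
  qed
  have "arcsine_potential s r x = ennreal \<bar>r\<bar> * (ennreal (1 / r) * ennreal (pi / cos (s * pi / 2)))"
    unfolding arcsine_potential_def
    apply (subst nn_integral_real_affine[where c = r and t = 0])
    subgoal by measurable
    subgoal using r by simp
    subgoal
      apply (subst pt)
      apply (subst nn_integral_cmult)
      subgoal by measurable
      apply (subst nn_integral_riesz_arcsine_unit)
      using s x r by auto
    done
  also have "\<dots> = ennreal (\<bar>r\<bar> * (1 / r)) * ennreal (pi / cos (s * pi / 2))"
    using r by (subst ennreal_mult') (auto simp: mult.assoc)
  finally show ?thesis using r by simp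
qed

lemma arcsine_potential_minus: "arcsine_potential s r (- x) = arcsine_potential s r x"
proof -
  have 1: "\<bar>- x - - y\<bar> = \<bar>x - y\<bar>" for y by simp
  have 2: "indicator {-r..r} (- y) = (indicator {-r..r} y :: ennreal)" for y
    by (auto simp: indicator_def)
  show ?thesis
    unfolding arcsine_potential_def
    by (subst nn_integral_reflect, measurable) (simp only: 1 2 power2_minus)
qed

lemma semicircle_potential_minus: "semicircle_potential s r (- x) = semicircle_potential s r x"
proof -
  have 1: "\<bar>- x - - y\<bar> = \<bar>x - y\<bar>" for y by simp
  have 2: "indicator {-r..r} (- y) = (indicator {-r..r} y :: ennreal)" for y
    by (auto simp: indicator_def)
  show ?thesis
    unfolding semicircle_potential_def
    by (subst nn_integral_reflect, measurable) (simp only: 1 2 power2_minus)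
qed

text \<open>
  Moving the observation point away from the interval decreases the potential, and at the endpoint the
  potential still has its interior value, because the Beta integral there has the same parameters.
\<close>

lemma arcsine_potential_outside:
  assumes s: "0 < s" "s < 1" and r: "0 < r" "r \<le> \<bar>x\<bar>"
  shows "arcsine_potential s r x \<le> ennreal (pi / cos (s * pi / 2))"
proof -
  have main: "arcsine_potential s r z \<le> ennreal (pi / cos (s * pi / 2))" if z: "r \<le> z" for z
  proof -
    have "arcsine_potential s r z \<le> (\<integral>\<^sup>+y. ennreal (\<bar>r - y\<bar> powr (- s) * (r\<^sup>2 - y\<^sup>2) powr ((s - 1) / 2)) * indicator {-r..r} y \<partial>lborel)"
      unfolding arcsine_potential_def
    proof (rule nn_integral_mono)
      fix y
      show "ennreal (\<bar>z - y\<bar> powr (- s) * (r\<^sup>2 - y\<^sup>2) powr ((s - 1) / 2)) * indicator {-r..r} y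
        \<le> ennreal (\<bar>r - y\<bar> powr (- s) * (r\<^sup>2 - y\<^sup>2) powr ((s - 1) / 2)) * indicator {-r..r} y"
      proof (cases "y \<in> {-r..r} \<and> y \<noteq> r")
        case True
        then have "\<bar>z - y\<bar> powr (- s) \<le> \<bar>r - y\<bar> powr (- s)"
          using s z by (intro powr_mono2') auto
        then have "\<bar>z - y\<bar> powr (- s) * (r\<^sup>2 - y\<^sup>2) powr ((s - 1) / 2) \<le> \<bar>r - y\<bar> powr (- s) * (r\<^sup>2 - y\<^sup>2) powr ((s - 1) / 2)"
          by (rule mult_right_mono) simp
        then show ?thesis
          by (intro mult_right_mono[OF ennreal_leI]) auto
      next
        case False
        then show ?thesis by (auto simp: indicator_def)
      qed
    qed
    also have "\<dots> = ennreal ((2 * r) powr (2 * ((s - 1) / 2) - s + 1) * Beta ((s - 1) / 2 - s + 1) ((s - 1) / 2 + 1))"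
      using s r by (intro nn_integral_riesz_endpoint) (auto simp: field_simps)
    also have "2 * ((s - 1) / 2) - s + 1 = 0" by (simp add: field_simps)
    also have "(s - 1) / 2 - s + 1 = (1 - s) / 2" by (simp add: field_simps)
    also have "(s - 1) / 2 + 1 = (1 + s) / 2" by (simp add: field_simps)
    finally show ?thesis using r by (simp add: Beta_reflection)
  qed
  show ?thesis
    using main[of x] main[of "- x"] r arcsine_potential_minus[of s r x] by (cases "0 \<le> x") auto
qed

text \<open>
  This exhibits the semicircle-type density as a mixture of the equilibrium densities of the smaller
  intervals \<open>[-r, r]\<close>, so that its potential can be computed from theirs.
\<close>

lemma nn_integral_arcsine_superposition:
  assumes s: "0 < s" "s < 1" and y: "\<bar>y\<bar> \<le> R"
  shows "(\<integral>\<^sup>+r. ennreal (r * (r\<^sup>2 - y\<^sup>2) powr ((s - 1) / 2)) * indicator {\<bar>y\<bar>..R} r \<partial>lborel)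
    = ennreal ((R\<^sup>2 - y\<^sup>2) powr ((1 + s) / 2) / (1 + s))"
proof -
  define F where "F r = (r\<^sup>2 - y\<^sup>2) powr ((1 + s) / 2) / (1 + s)" for r
  have "((\<lambda>r. r * (r\<^sup>2 - y\<^sup>2) powr ((s - 1) / 2)) has_integral (F R - F \<bar>y\<bar>)) {\<bar>y\<bar>..R}"
  proof (rule fundamental_theorem_of_calculus_interior[OF y])
    show "continuous_on {\<bar>y\<bar>..R} F"
      unfolding F_def using s
      by (intro continuous_intros continuous_on_powr') (auto simp flip: abs_le_square_iff)
    fix r assume r: "r \<in> {\<bar>y\<bar><..<R}"
    then have pos: "0 < r\<^sup>2 - y\<^sup>2"
      using power2_strict_mono[of y r] by auto
    have "((\<lambda>r. (r\<^sup>2 - y\<^sup>2) powr ((1 + s) / 2)) has_real_derivative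
       ((1 + s) / 2) * (r\<^sup>2 - y\<^sup>2) powr ((1 + s) / 2 - 1) * (2 * r)) (at r)"
      using pos by (auto intro!: derivative_eq_intros)
    then have "(F has_real_derivative ((1 + s) / 2) * (r\<^sup>2 - y\<^sup>2) powr ((1 + s) / 2 - 1) * (2 * r) / (1 + s)) (at r)"
      unfolding F_def by (rule DERIV_cdivide)
    moreover have "(r\<^sup>2 - y\<^sup>2) powr ((1 + s) / 2 - 1) = (r\<^sup>2 - y\<^sup>2) powr ((s - 1) / 2)"
      by (rule arg_cong2[where f = "(powr)"]) (auto simp: field_simps)
    ultimately have "(F has_real_derivative r * (r\<^sup>2 - y\<^sup>2) powr ((s - 1) / 2)) (at r)"
      using s by (simp add: mult.commute)
    then show "(F has_vector_derivative r * (r\<^sup>2 - y\<^sup>2) powr ((s - 1) / 2)) (at r)"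
      by (simp add: has_real_derivative_iff_has_vector_derivative)
  qed
  then have "(\<integral>\<^sup>+r. ennreal (r * (r\<^sup>2 - y\<^sup>2) powr ((s - 1) / 2)) * indicator {\<bar>y\<bar>..R} r \<partial>lborel) = ennreal (F R - F \<bar>y\<bar>)"
    by (intro nn_integral_has_integral_lebesgue') auto
  then show ?thesis
    unfolding F_def by simp
qed

lemma semicircle_potential_eq_superposition:
  assumes s: "0 < s" "s < 1"
  shows "semicircle_potential s R x
    = ennreal (1 + s) * (\<integral>\<^sup>+r. ennreal r * arcsine_potential s r x * indicator {0..R} r \<partial>lborel)"
proof -
  define F where "F y r = (if \<bar>y\<bar> \<le> r \<and> r \<le> R
      then ennreal (\<bar>x - y\<bar> powr (- s)) * ennreal (r * (r\<^sup>2 - y\<^sup>2) powr ((s - 1) / 2)) else 0)" for y r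
  have [measurable]: "case_prod F \<in> borel_measurable (lborel \<Otimes>\<^sub>M lborel)"
    unfolding F_def by measurable
  have inner1: "ennreal (\<bar>x - y\<bar> powr (- s) * (R\<^sup>2 - y\<^sup>2) powr ((1 + s) / 2)) * indicator {-R..R} y
      = ennreal (1 + s) * (\<integral>\<^sup>+r. F y r \<partial>lborel)" for y
  proof (cases "\<bar>y\<bar> \<le> R")
    case True
    have "(\<integral>\<^sup>+r. F y r \<partial>lborel)
      = (\<integral>\<^sup>+r. ennreal (\<bar>x - y\<bar> powr (- s)) * (ennreal (r * (r\<^sup>2 - y\<^sup>2) powr ((s - 1) / 2)) * indicator {\<bar>y\<bar>..R} r) \<partial>lborel)"
      unfolding F_def by (intro nn_integral_cong) (auto simp: indicator_def)
    also have "\<dots> = ennreal (\<bar>x - y\<bar> powr (- s)) * ennreal ((R\<^sup>2 - y\<^sup>2) powr ((1 + s) / 2) / (1 + s))"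
      using nn_integral_arcsine_superposition[OF s True] by (simp add: nn_integral_cmult)
    finally have "ennreal (1 + s) * (\<integral>\<^sup>+r. F y r \<partial>lborel)
        = ennreal ((1 + s) * (\<bar>x - y\<bar> powr (- s) * ((R\<^sup>2 - y\<^sup>2) powr ((1 + s) / 2) / (1 + s))))"
      using s by (subst ennreal_mult', simp, subst ennreal_mult', simp, simp)
    also have "(1 + s) * (\<bar>x - y\<bar> powr (- s) * ((R\<^sup>2 - y\<^sup>2) powr ((1 + s) / 2) / (1 + s)))
      = \<bar>x - y\<bar> powr (- s) * (R\<^sup>2 - y\<^sup>2) powr ((1 + s) / 2)"
      using s by simp
    finally show ?thesis using True by (simp add: indicator_def abs_le_iff)
  next
    case False
    then have "F y = (\<lambda>r. 0)" by (auto simp: F_def fun_eq_iff)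
    then show ?thesis using False by (auto simp: indicator_def)
  qed
  have inner2: "(\<integral>\<^sup>+y. F y r \<partial>lborel) = ennreal r * arcsine_potential s r x * indicator {0..R} r" for r
  proof (cases "0 \<le> r \<and> r \<le> R")
    case True
    then have "(\<integral>\<^sup>+y. F y r \<partial>lborel) = (\<integral>\<^sup>+y. ennreal r * (ennreal (\<bar>x - y\<bar> powr (- s) * (r\<^sup>2 - y\<^sup>2) powr ((s - 1) / 2)) * indicator {-r..r} y) \<partial>lborel)"
      by (intro nn_integral_cong) (auto simp: F_def indicator_def ennreal_mult' mult_ac abs_le_iff)
    then show ?thesis
      using True unfolding arcsine_potential_def by (simp add: nn_integral_cmult)
  next
    case False
    then have "(\<lambda>y. F y r) = (\<lambda>y. 0)" by (auto simp: F_def fun_eq_iff)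
    then show ?thesis using False by auto
  qed
  have "semicircle_potential s R x = (\<integral>\<^sup>+y. ennreal (1 + s) * (\<integral>\<^sup>+r. F y r \<partial>lborel) \<partial>lborel)"
    unfolding semicircle_potential_def inner1 ..
  also have "\<dots> = ennreal (1 + s) * (\<integral>\<^sup>+y. (\<integral>\<^sup>+r. F y r \<partial>lborel) \<partial>lborel)"
    by (rule nn_integral_cmult) measurable
  also have "(\<integral>\<^sup>+y. (\<integral>\<^sup>+r. F y r \<partial>lborel) \<partial>lborel) = (\<integral>\<^sup>+r. (\<integral>\<^sup>+y. F y r \<partial>lborel) \<partial>lborel)"
    by (rule lborel_pair.Fubini'[symmetric]) measurable
  finally show ?thesis unfolding inner2 .
qed

lemma measurable_arcsine_potential [measurable]:
  "(\<lambda>r. arcsine_potential s r x) \<in> borel_measurable borel"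
proof -
  have "(\<lambda>r. \<integral>\<^sup>+y. (if \<bar>y\<bar> \<le> r then ennreal (\<bar>x - y\<bar> powr (- s) * (r\<^sup>2 - y\<^sup>2) powr ((s - 1) / 2)) else 0) \<partial>lborel)
      \<in> borel_measurable borel"
    by measurable
  also have "(\<lambda>r. \<integral>\<^sup>+y. (if \<bar>y\<bar> \<le> r then ennreal (\<bar>x - y\<bar> powr (- s) * (r\<^sup>2 - y\<^sup>2) powr ((s - 1) / 2)) else 0) \<partial>lborel)
      = (\<lambda>r. arcsine_potential s r x)"
    unfolding arcsine_potential_def
    by (intro ext nn_integral_cong) (auto simp: indicator_def abs_le_iff)
  finally show ?thesis .
qed

lemma nn_integral_const_times_id:
  assumes "0 \<le> k" "0 \<le> a" "a \<le> b"
  shows "(\<integral>\<^sup>+r. ennreal r * ennreal k * indicator {a..b} r \<partial>lborel) = ennreal (k * (b\<^sup>2 - a\<^sup>2) / 2)"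
proof -
  have "(\<integral>\<^sup>+r. ennreal (k * r) * indicator {a..b} r \<partial>lborel) = ennreal (k * b\<^sup>2 / 2 - k * a\<^sup>2 / 2)"
    using assms by (intro nn_integral_FTC_Icc) (auto intro!: derivative_eq_intros)
  moreover have "(\<integral>\<^sup>+r. ennreal r * ennreal k * indicator {a..b} r \<partial>lborel) = (\<integral>\<^sup>+r. ennreal (k * r) * indicator {a..b} r \<partial>lborel)"
    using assms by (intro nn_integral_cong) (auto simp: indicator_def ennreal_mult' mult.commute)
  ultimately show ?thesis by (simp add: diff_divide_distrib right_diff_distrib)
qed

lemma semicircle_potential_endpoint:
  assumes s: "0 < s" "s < 1" and x: "0 \<le> x"
  shows "semicircle_potential s x x = ennreal ((1 - s) * (1 + s) * (pi / cos (s * pi / 2)) / 2 * x\<^sup>2)"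
proof (cases "x = 0")
  case True
  have "semicircle_potential s 0 0 = 0"
    unfolding semicircle_potential_def by (subst nn_integral_0_iff_AE) (auto simp: indicator_def)
  then show ?thesis using True by simp
next
  case False
  then have x: "0 < x" using x by simp
  define a b where "a = (1 - s) / 2" and "b = (1 + s) / 2"
  have ab: "0 < a" "0 < b" "a + b = 1" unfolding a_def b_def using s by (auto simp: field_simps)
  have "semicircle_potential s x x = ennreal ((2 * x) powr (2 * ((1 + s) / 2) - s + 1) * Beta ((1 + s) / 2 - s + 1) ((1 + s) / 2 + 1))"
    unfolding semicircle_potential_def using s x by (intro nn_integral_riesz_endpoint) auto
  also have "2 * ((1 + s) / 2) - s + 1 = 2" by (simp add: field_simps)
  also have "(1 + s) / 2 - s + 1 = a + 1" unfolding a_def by (simp add: field_simps)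
  also have "(1 + s) / 2 + 1 = b + 1" unfolding b_def by (simp add: field_simps)
  also have "(2 * x) powr 2 = 4 * x\<^sup>2" using x by (simp add: power_mult_distrib)
  also have "Beta (a + 1) (b + 1) = a * b * Beta a b / 2"
  proof -
    have notint: "a \<notin> \<int>\<^sub>\<le>\<^sub>0" "b \<notin> \<int>\<^sub>\<le>\<^sub>0"
      using ab by (auto elim!: nonpos_Ints_cases)
    have "Gamma (a + 1 + (b + 1)) = 2"
    proof -
      have "a + 1 + (b + 1) = 3" using ab by simp
      then show ?thesis using Gamma_fact[of 2, where 'a = real] by (simp add: numeral_3_eq_3)
    qed
    moreover have "Gamma (a + b) = 1" using ab by simp
    ultimately show ?thesis
      unfolding Beta_def using notint by (simp add: Gamma_plus1)
  qed
  also have "Beta a b = pi / cos (s * pi / 2)"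
    unfolding a_def b_def by (rule Beta_reflection)
  also have "4 * x\<^sup>2 * (a * b * (pi / cos (s * pi / 2)) / 2) = (1 - s) * (1 + s) * (pi / cos (s * pi / 2)) / 2 * x\<^sup>2"
    unfolding a_def b_def by (simp add: mult_ac)
  finally show ?thesis .
qed

lemma cos_pos_of_unit: "0 < s \<Longrightarrow> s < 1 \<Longrightarrow> 0 < cos (s * pi / 2)"
  using pi_gt_zero by (intro cos_gt_zero_pi) (auto simp: field_simps intro: less_le_trans[of _ 0])

lemma semicircle_potential_split:
  assumes s: "0 < s" "s < 1" and "0 \<le> a" "a \<le> b"
  shows "semicircle_potential s b x = semicircle_potential s a x
    + ennreal (1 + s) * (\<integral>\<^sup>+r. ennreal r * arcsine_potential s r x * indicator {a..b} r \<partial>lborel)"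
  unfolding semicircle_potential_eq_superposition[OF s]
  by (subst nn_integral_Icc_split[of _ 0 a b]) (use assms in \<open>auto simp: distrib_left\<close>)

text \<open>
  In the mixture over \<open>r\<close>, the radii above \<open>|x|\<close> contribute the same constant each, and the radii below \<open>|x|\<close>
  add up to the potential of the density on \<open>[-|x|, |x|]\<close> at its own endpoint, which is a Beta integral.
  Both contributions are quadratic in \<open>x\<close>.
\<close>

lemma semicircle_potential_inside:
  assumes s: "0 < s" "s < 1" and x: "\<bar>x\<bar> \<le> R"
  shows "semicircle_potential s R x = ennreal ((1 + s) * (pi / cos (s * pi / 2)) / 2 * (R\<^sup>2 - s * x\<^sup>2))"
proof -
  define \<kappa> where "\<kappa> = pi / cos (s * pi / 2)"
  have \<kappa>: "0 < \<kappa>" unfolding \<kappa>_def using cos_pos_of_unit[OF s] by simp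
  have main: "semicircle_potential s R z = ennreal ((1 + s) * \<kappa> / 2 * (R\<^sup>2 - s * z\<^sup>2))" if z: "0 \<le> z" "z \<le> R" for z
  proof -
    have zR: "z\<^sup>2 \<le> R\<^sup>2" using z by (intro power_mono) auto
    have "AE r in lborel. r \<noteq> z" by (rule AE_lborel_singleton)
    then have "AE r in lborel. ennreal r * arcsine_potential s r z * indicator {z..R} r = ennreal r * ennreal \<kappa> * indicator {z..R} r"
    proof eventually_elim
      case (elim r)
      then show ?case
        using arcsine_potential_inside[OF s, of z r] z unfolding \<kappa>_def by (auto simp: indicator_def)
    qed
    then have "(\<integral>\<^sup>+r. ennreal r * arcsine_potential s r z * indicator {z..R} r \<partial>lborel) = (\<integral>\<^sup>+r. ennreal r * ennreal \<kappa> * indicator {z..R} r \<partial>lborel)"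
      by (rule nn_integral_cong_AE)
    also have "\<dots> = ennreal (\<kappa> * (R\<^sup>2 - z\<^sup>2) / 2)"
      using z \<kappa> by (intro nn_integral_const_times_id) auto
    finally have "semicircle_potential s R z = ennreal ((1 - s) * (1 + s) * \<kappa> / 2 * z\<^sup>2) + ennreal (1 + s) * ennreal (\<kappa> * (R\<^sup>2 - z\<^sup>2) / 2)"
      using semicircle_potential_split[OF s z] semicircle_potential_endpoint[OF s z(1)] by (simp only: \<kappa>_def)
    also have "\<dots> = ennreal ((1 - s) * (1 + s) * \<kappa> / 2 * z\<^sup>2 + (1 + s) * (\<kappa> * (R\<^sup>2 - z\<^sup>2) / 2))"
      using s \<kappa> zR by (subst ennreal_mult'[symmetric], simp, subst ennreal_plus[symmetric]) auto
    also have "(1 - s) * (1 + s) * \<kappa> / 2 * z\<^sup>2 + (1 + s) * (\<kappa> * (R\<^sup>2 - z\<^sup>2) / 2) = (1 + s) * \<kappa> / 2 * (R\<^sup>2 - s * z\<^sup>2)"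
      by (simp add: field_simps)
    finally show ?thesis .
  qed
  show ?thesis
    using main[of x] main[of "- x"] x semicircle_potential_minus[of s R x]
    unfolding \<kappa>_def by (cases "0 \<le> x") auto
qed

text \<open>
  For \<open>|x| > R\<close> the endpoint formula evaluates the potential of the density on \<open>[-|x|, |x|]\<close>; passing to
  \<open>[-R, R]\<close> removes the radii between \<open>R\<close> and \<open>|x|\<close>, each of which contributes at most the interior constant.
  The statement avoids subtraction so that it makes sense in \<^typ>\<open>ennreal\<close>.
\<close>

lemma semicircle_potential_outside:
  assumes s: "0 < s" "s < 1" and R: "0 < R" "R \<le> \<bar>x\<bar>"
  shows "ennreal ((1 - s) * (1 + s) * (pi / cos (s * pi / 2)) / 2 * x\<^sup>2)
    \<le> semicircle_potential s R x + ennreal ((1 + s) * (pi / cos (s * pi / 2)) / 2 * (x\<^sup>2 - R\<^sup>2))"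
proof -
  define \<kappa> where "\<kappa> = pi / cos (s * pi / 2)"
  have \<kappa>: "0 < \<kappa>" unfolding \<kappa>_def using cos_pos_of_unit[OF s] by simp
  have main: "ennreal ((1 - s) * (1 + s) * \<kappa> / 2 * z\<^sup>2) \<le> semicircle_potential s R z + ennreal ((1 + s) * \<kappa> / 2 * (z\<^sup>2 - R\<^sup>2))"
    if z: "R \<le> z" for z
  proof -
    have zR: "R\<^sup>2 \<le> z\<^sup>2" using z R by (intro power_mono) auto
    have "(\<integral>\<^sup>+r. ennreal r * arcsine_potential s r z * indicator {R..z} r \<partial>lborel) \<le> (\<integral>\<^sup>+r. ennreal r * ennreal \<kappa> * indicator {R..z} r \<partial>lborel)"
    proof (rule nn_integral_mono)
      fix r
      show "ennreal r * arcsine_potential s r z * indicator {R..z} r \<le> ennreal r * ennreal \<kappa> * indicator {R..z} r"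
        using arcsine_potential_outside[OF s, of r z] R unfolding \<kappa>_def
        by (auto simp: indicator_def intro!: mult_left_mono)
    qed
    also have "\<dots> = ennreal (\<kappa> * (z\<^sup>2 - R\<^sup>2) / 2)"
      using z \<kappa> R by (intro nn_integral_const_times_id) auto
    finally have le: "(\<integral>\<^sup>+r. ennreal r * arcsine_potential s r z * indicator {R..z} r \<partial>lborel) \<le> ennreal (\<kappa> * (z\<^sup>2 - R\<^sup>2) / 2)" .
    have "ennreal ((1 - s) * (1 + s) * \<kappa> / 2 * z\<^sup>2) = semicircle_potential s z z"
      unfolding \<kappa>_def using R z by (intro semicircle_potential_endpoint[symmetric] s) auto
    also have "\<dots> = semicircle_potential s R z + ennreal (1 + s) * (\<integral>\<^sup>+r. ennreal r * arcsine_potential s r z * indicator {R..z} r \<partial>lborel)"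
      using R z by (intro semicircle_potential_split s) auto
    also have "\<dots> \<le> semicircle_potential s R z + ennreal (1 + s) * ennreal (\<kappa> * (z\<^sup>2 - R\<^sup>2) / 2)"
      using le by (intro add_left_mono mult_left_mono) auto
    also have "ennreal (1 + s) * ennreal (\<kappa> * (z\<^sup>2 - R\<^sup>2) / 2) = ennreal ((1 + s) * \<kappa> / 2 * (z\<^sup>2 - R\<^sup>2))"
      using s by (subst ennreal_mult'[symmetric]) (auto simp: mult.assoc)
    finally show ?thesis .
  qed
  show ?thesis
    using main[of x] main[of "- x"] R semicircle_potential_minus[of s R x]
    unfolding \<kappa>_def by (cases "0 \<le> x") auto
qed

section \<open>Positive definiteness of the Riesz kernel on the line\<close>

text \<open>
  The value \<open>\<infinity>\<close> at the origin is part of the kernel: it makes the energy of a measure with atoms infinite.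
\<close>

definition riesz :: "real \<Rightarrow> real \<Rightarrow> ennreal" where
  "riesz s t = (if t = 0 then \<infinity> else ennreal (\<bar>t\<bar> powr (- s)))"

lemma measurable_riesz [measurable]: "riesz s \<in> borel_measurable borel"
  unfolding riesz_def by measurable

lemma riesz_minus: "riesz s (- t) = riesz s t"
  by (simp add: riesz_def)

lemma nn_integral_powr_tail:
  fixes p a M :: real
  assumes p: "0 < p" and M: "a < M"
  shows "(\<integral>\<^sup>+b. ennreal ((b - a) powr (- p - 1)) * indicator {M..} b \<partial>lborel) = ennreal ((M - a) powr (- p) / p)"
proof -
  have "(\<integral>\<^sup>+b. ennreal ((b - a) powr (- p - 1)) * indicator {M..} b \<partial>lborel) = ennreal (0 - (- ((M - a) powr (- p) / p)))"
  proof (rule nn_integral_FTC_atLeast)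
    show "(\<lambda>b. (b - a) powr (- p - 1)) \<in> borel_measurable borel" by measurable
    show "DERIV (\<lambda>b. - ((b - a) powr (- p) / p)) b :> (b - a) powr (- p - 1)" if "M \<le> b" for b
      using that M p by (auto intro!: derivative_eq_intros)
    have "filterlim (\<lambda>b. b - a) at_top at_top"
      unfolding filterlim_at_top eventually_at_top_linorder
      by (metis add.commute add_le_cancel_left diff_add_cancel)
    then have "((\<lambda>b. (b - a) powr (- p)) \<longlongrightarrow> 0) at_top"
      using p by (intro tendsto_neg_powr) auto
    from tendsto_minus[OF tendsto_divide[OF this tendsto_const[of p]]]
    show "((\<lambda>b. - ((b - a) powr (- p) / p)) \<longlongrightarrow> 0) at_top"
      using p by simp
  qed simp
  then show ?thesis by simp
qed

text \<open>
  The divergence is what produces the value \<open>\<infinity>\<close> of the kernel on the diagonal.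
\<close>

lemma nn_integral_powr_tail_singular:
  fixes p a :: real
  assumes p: "0 < p"
  shows "(\<integral>\<^sup>+b. ennreal ((b - a) powr (- p - 1)) * indicator {a..} b \<partial>lborel) = \<infinity>" (is "?I = _")
proof -
  have "ennreal (real n) \<le> (\<integral>\<^sup>+b. ennreal ((b - a) powr (- p - 1)) * indicator {a..} b \<partial>lborel)" for n
  proof -
    \<comment> \<open>The point at which the tail integral has the value \<open>n + 1\<close>.\<close>
    define M where "M = a + (p * (real n + 1)) powr (- 1 / p)"
    have M: "a < M" unfolding M_def using p by simp
    have "(M - a) powr (- p) = p * (real n + 1)"
      unfolding M_def using p by (simp add: powr_powr)
    then have "ennreal (real n + 1) = (\<integral>\<^sup>+b. ennreal ((b - a) powr (- p - 1)) * indicator {M..} b \<partial>lborel)"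
      using nn_integral_powr_tail[OF p M] p by simp
    also have "\<dots> \<le> (\<integral>\<^sup>+b. ennreal ((b - a) powr (- p - 1)) * indicator {a..} b \<partial>lborel)"
      using M by (intro nn_integral_mono) (auto simp: indicator_def)
    finally show ?thesis
      by (rule order_trans[rotated]) (rule ennreal_leI, simp)
  qed
  then have le: "ennreal (real n) \<le> ?I" for n .
  show ?thesis
  proof (cases ?I rule: ennreal_cases)
    case (real r)
    obtain n where "r < real n" using reals_Archimedean2 by blast
    with le[of n] real show ?thesis by (simp add: ennreal_le_iff)
  qed simp
qed

text \<open>
  A pair \<open>(a, b)\<close> with \<open>a < b\<close> stands for the interval \<open>[a, b]\<close>. The weight is \<open>\<partial>\<^sup>2/\<partial>a\<partial>b\<close> of \<open>-(b - a)\<^sup>-\<^sup>s\<close>, which is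
  what makes the total weight of the intervals that contain two given points equal to the kernel.
\<close>

definition layer_density :: "real \<Rightarrow> real \<times> real \<Rightarrow> ennreal" where
  "layer_density s = (\<lambda>(a, b). if a < b then ennreal (s * (s + 1) * (b - a) powr (- s - 2)) else 0)"

definition layers :: "real \<Rightarrow> (real \<times> real) measure" where
  "layers s = density (lborel \<Otimes>\<^sub>M lborel) (layer_density s)"

lemma measurable_layer_density [measurable]:
  "layer_density s \<in> borel_measurable (lborel \<Otimes>\<^sub>M lborel)"
  unfolding layer_density_def by measurable

definition covers :: "real \<times> real \<Rightarrow> real \<Rightarrow> bool" where
  "covers I t \<longleftrightarrow> fst I \<le> t \<and> t \<le> snd I"

text \<open>
  The intervals that contain both points are those with \<open>a \<le> min t u\<close> and \<open>b \<ge> max t u\<close>; integrating the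
  weight first in \<open>b\<close> and then in \<open>a\<close> removes one power each time. The writing as an integral of products
  \<open>1(t) 1(u)\<close> shows that the kernel is positive definite.
\<close>

lemma riesz_layer_cake:
  assumes s: "0 < s"
  shows "(\<integral>\<^sup>+I. (if covers I t \<and> covers I u then 1 else 0) \<partial>layers s) = riesz s (t - u)"
proof -
  define m M where "m = min t u" and "M = max t u"
  have mM: "m \<le> M" "\<bar>t - u\<bar> = M - m" "t = u \<longleftrightarrow> m = M" unfolding m_def M_def by auto
  define k where "k = s * (s + 1)"
  have k: "0 < k" unfolding k_def using s by simp
  have "(\<integral>\<^sup>+I. (if covers I t \<and> covers I u then 1 else 0) \<partial>layers s)
    = (\<integral>\<^sup>+I. layer_density s I * (if covers I t \<and> covers I u then 1 else 0) \<partial>(lborel \<Otimes>\<^sub>M lborel))"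
    unfolding layers_def covers_def by (rule nn_integral_density) measurable
  also have "\<dots> = (\<integral>\<^sup>+a. \<integral>\<^sup>+b. layer_density s (a, b) * (if covers (a, b) t \<and> covers (a, b) u then 1 else 0) \<partial>lborel \<partial>lborel)"
    by (rule lborel.nn_integral_fst[symmetric]) (unfold covers_def, measurable)
  also have "\<dots> = (\<integral>\<^sup>+a. ennreal s * (ennreal ((M - a) powr (- s - 1)) * indicator {..m} a) \<partial>lborel)"
  proof -
    have "AE a in lborel. a \<noteq> m" by (rule AE_lborel_singleton)
    then have "AE a in lborel. (\<integral>\<^sup>+b. layer_density s (a, b) * (if covers (a, b) t \<and> covers (a, b) u then 1 else 0) \<partial>lborel)
        = ennreal s * (ennreal ((M - a) powr (- s - 1)) * indicator {..m} a)"
    proof eventually_elim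
      case (elim a)
      show ?case
      proof (cases "a < m")
        case True
        then have aM: "a < M" using mM by simp
        have expo': "- (s + 1) = - s - 1" by simp
        have expo: "- (s + 1) - 1 = - s - 2" by simp
        have "(\<integral>\<^sup>+b. layer_density s (a, b) * (if covers (a, b) t \<and> covers (a, b) u then 1 else 0) \<partial>lborel)
          = (\<integral>\<^sup>+b. ennreal k * (ennreal ((b - a) powr (- (s + 1) - 1)) * indicator {M..} b) \<partial>lborel)"
          using True aM k unfolding layer_density_def covers_def k_def[symmetric] expo
          by (intro nn_integral_cong) (auto simp: indicator_def m_def M_def ennreal_mult')
        also have "\<dots> = ennreal k * ennreal ((M - a) powr (- (s + 1)) / (s + 1))"
          using nn_integral_powr_tail[of "s + 1" a M] s aM by (subst nn_integral_cmult) auto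
        also have "\<dots> = ennreal (s * (M - a) powr (- s - 1))"
        proof -
          have "k * ((M - a) powr (- (s + 1)) / (s + 1)) = s * (M - a) powr (- s - 1)"
            unfolding k_def expo' using s by simp
          then show ?thesis using k by (simp flip: ennreal_mult')
        qed
        finally show ?thesis using True s by (simp add: ennreal_mult')
      next
        case False
        then have "m < a" using elim by simp
        then have "(\<lambda>b. layer_density s (a, b) * (if covers (a, b) t \<and> covers (a, b) u then 1 else 0)) = (\<lambda>b. 0)"
          unfolding covers_def m_def by (intro ext) auto
        then show ?thesis using \<open>m < a\<close> by (simp only:) (simp add: indicator_def)
      qed
    qed
    then show ?thesis by (rule nn_integral_cong_AE)
  qed
  also have "\<dots> = ennreal s * (\<integral>\<^sup>+a. ennreal ((M - a) powr (- s - 1)) * indicator {..m} a \<partial>lborel)"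
    by (rule nn_integral_cmult) measurable
  also have "(\<integral>\<^sup>+a. ennreal ((M - a) powr (- s - 1)) * indicator {..m} a \<partial>lborel)
     = (\<integral>\<^sup>+b. ennreal ((b - m) powr (- s - 1)) * indicator {M..} b \<partial>lborel)"
    by (subst nn_integral_real_affine[where c = "-1" and t = "m + M"]) 
       (auto intro!: nn_integral_cong simp: indicator_def algebra_simps)
  also have "ennreal s * \<dots> = riesz s (t - u)"
  proof (cases "t = u")
    case True
    then have "m = M" using mM by simp
    then show ?thesis
      using nn_integral_powr_tail_singular[OF s, of M] s True by (simp add: riesz_def ennreal_mult_top)
  next
    case False
    then have "m < M" using mM by simp
    then show ?thesis
      using nn_integral_powr_tail[OF s, of m M] s False mM(2) by (simp add: riesz_def flip: ennreal_mult')
  qed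
  finally show ?thesis .
qed

definition mutual_energy :: "real \<Rightarrow> real measure \<Rightarrow> real measure \<Rightarrow> ennreal" where
  "mutual_energy s \<mu> \<nu> = (\<integral>\<^sup>+t. \<integral>\<^sup>+u. riesz s (t - u) \<partial>\<nu> \<partial>\<mu>)"

definition mass_on :: "real measure \<Rightarrow> real \<times> real \<Rightarrow> real" where
  "mass_on \<mu> I = measure \<mu> {fst I..snd I}"

definition layer_distance :: "real \<Rightarrow> real measure \<Rightarrow> real measure \<Rightarrow> ennreal" where
  "layer_distance s \<mu> \<nu> = (\<integral>\<^sup>+I. ennreal ((mass_on \<mu> I - mass_on \<nu> I)\<^sup>2) \<partial>layers s)"

lemma sigma_finite_layers: "sigma_finite_measure (layers s)"
proof -
  have "AE I in lborel \<Otimes>\<^sub>M lborel. layer_density s I \<noteq> \<infinity>"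
    by (rule AE_I2) (auto simp: layer_density_def split: if_splits)
  then show ?thesis
    unfolding layers_def
    by (simp add: sigma_finite_measure.sigma_finite_iff_density_finite[OF lborel_pair.sigma_finite_measure_axioms])
qed

lemma measurable_covers [measurable]:
  "covers I \<in> measurable borel (count_space UNIV)"
  unfolding covers_def by measurable

lemma sets_layers [measurable_cong]: "sets (layers s) = sets (lborel \<Otimes>\<^sub>M lborel)"
  unfolding layers_def by simp

context real_distribution
begin

lemma nn_integral_covers:
  "(\<integral>\<^sup>+t. (if covers I t then 1 else 0) \<partial>M) = ennreal (mass_on M I)"
proof -
  have "(\<integral>\<^sup>+t. (if covers I t then 1 else 0) \<partial>M) = (\<integral>\<^sup>+t. indicator {fst I..snd I} t \<partial>M)"
    by (intro nn_integral_cong) (auto simp: covers_def indicator_def)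
  then show ?thesis
    by (simp add: mass_on_def emeasure_eq_measure)
qed

lemma measurable_mass_on [measurable]: "mass_on M \<in> borel_measurable (lborel \<Otimes>\<^sub>M lborel)"
proof -
  have "(\<lambda>I. enn2real (\<integral>\<^sup>+t. (if covers I t then 1 else 0) \<partial>M)) \<in> borel_measurable (lborel \<Otimes>\<^sub>M lborel)"
    unfolding covers_def by measurable
  then show ?thesis
    unfolding nn_integral_covers by (simp add: mass_on_def[abs_def])
qed

end

lemma mutual_energy_layers:
  assumes s: "0 < s" and \<mu>: "real_distribution \<mu>" and \<nu>: "real_distribution \<nu>"
  shows "mutual_energy s \<mu> \<nu> = (\<integral>\<^sup>+I. ennreal (mass_on \<mu> I * mass_on \<nu> I) \<partial>layers s)"
proof -
  interpret \<mu>: real_distribution \<mu> by fact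
  interpret \<nu>: real_distribution \<nu> by fact
  interpret L: sigma_finite_measure "layers s" by (rule sigma_finite_layers)
  interpret L\<mu>: pair_sigma_finite "layers s" \<mu> ..
  interpret L\<nu>: pair_sigma_finite "layers s" \<nu> ..
  let ?c = "\<lambda>I t. (if covers I t then 1 else 0 :: ennreal)"
  have split: "(if covers I t \<and> covers I u then 1 else 0) = ?c I t * ?c I u" for I t u by simp
  have "mutual_energy s \<mu> \<nu> = (\<integral>\<^sup>+t. \<integral>\<^sup>+u. \<integral>\<^sup>+I. ?c I t * ?c I u \<partial>layers s \<partial>\<nu> \<partial>\<mu>)"
    unfolding mutual_energy_def riesz_layer_cake[OF s, symmetric] split ..
  also have "\<dots> = (\<integral>\<^sup>+t. \<integral>\<^sup>+I. \<integral>\<^sup>+u. ?c I t * ?c I u \<partial>\<nu> \<partial>layers s \<partial>\<mu>)"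
  proof (rule nn_integral_cong)
    fix t
    show "(\<integral>\<^sup>+u. \<integral>\<^sup>+I. ?c I t * ?c I u \<partial>layers s \<partial>\<nu>) = (\<integral>\<^sup>+I. \<integral>\<^sup>+u. ?c I t * ?c I u \<partial>\<nu> \<partial>layers s)"
      by (rule L\<nu>.Fubini') (unfold covers_def, measurable)
  qed
  also have "\<dots> = (\<integral>\<^sup>+t. \<integral>\<^sup>+I. ?c I t * ennreal (mass_on \<nu> I) \<partial>layers s \<partial>\<mu>)"
    by (intro nn_integral_cong) (simp add: nn_integral_cmult \<nu>.nn_integral_covers del: mult_if_delta if_distrib)
  also have "\<dots> = (\<integral>\<^sup>+I. \<integral>\<^sup>+t. ?c I t * ennreal (mass_on \<nu> I) \<partial>\<mu> \<partial>layers s)"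
    by (rule L\<mu>.Fubini') (unfold covers_def, measurable)
  also have "\<dots> = (\<integral>\<^sup>+I. ennreal (mass_on \<mu> I) * ennreal (mass_on \<nu> I) \<partial>layers s)"
    by (intro nn_integral_cong, subst nn_integral_multc) (measurable, simp only: \<mu>.nn_integral_covers)
  finally show ?thesis
    by (simp add: ennreal_mult' mass_on_def)
qed

text \<open>
  This is the expansion of the square \<open>(\<mu> - \<nu>)\<^sup>2\<close> for the bilinear form of the kernel. Both sides may be infinite:
  the identity is taken interval by interval, where all masses are finite, and so needs no difference of
  energies.
\<close>

lemma mutual_energy_square:
  assumes s: "0 < s" and \<mu>: "real_distribution \<mu>" and \<nu>: "real_distribution \<nu>"
  shows "mutual_energy s \<mu> \<mu> + mutual_energy s \<nu> \<nu> = 2 * mutual_energy s \<mu> \<nu> + layer_distance s \<mu> \<nu>"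
proof -
  interpret \<mu>: real_distribution \<mu> by fact
  interpret \<nu>: real_distribution \<nu> by fact
  have [simp]: "0 \<le> mass_on \<mu> I" "0 \<le> mass_on \<nu> I" for I by (simp_all add: mass_on_def)
  have "mutual_energy s \<mu> \<mu> + mutual_energy s \<nu> \<nu>
    = (\<integral>\<^sup>+I. ennreal (mass_on \<mu> I * mass_on \<mu> I) + ennreal (mass_on \<nu> I * mass_on \<nu> I) \<partial>layers s)"
    unfolding mutual_energy_layers[OF s \<mu> \<mu>] mutual_energy_layers[OF s \<nu> \<nu>]
    by (rule nn_integral_add[symmetric]) measurable
  also have "\<dots> = (\<integral>\<^sup>+I. 2 * ennreal (mass_on \<mu> I * mass_on \<nu> I) + ennreal ((mass_on \<mu> I - mass_on \<nu> I)\<^sup>2) \<partial>layers s)"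
  proof (rule nn_integral_cong)
    fix I
    have "ennreal (mass_on \<mu> I * mass_on \<mu> I) + ennreal (mass_on \<nu> I * mass_on \<nu> I)
      = ennreal (mass_on \<mu> I * mass_on \<mu> I + mass_on \<nu> I * mass_on \<nu> I)"
      by (simp flip: ennreal_plus)
    also have "\<dots> = ennreal (2 * (mass_on \<mu> I * mass_on \<nu> I) + (mass_on \<mu> I - mass_on \<nu> I)\<^sup>2)"
      by (simp add: power2_eq_square algebra_simps)
    also have "\<dots> = ennreal (2 * (mass_on \<mu> I * mass_on \<nu> I)) + ennreal ((mass_on \<mu> I - mass_on \<nu> I)\<^sup>2)"
      by (intro ennreal_plus) auto
    finally show "ennreal (mass_on \<mu> I * mass_on \<mu> I) + ennreal (mass_on \<nu> I * mass_on \<nu> I)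
      = 2 * ennreal (mass_on \<mu> I * mass_on \<nu> I) + ennreal ((mass_on \<mu> I - mass_on \<nu> I)\<^sup>2)"
      by (simp add: ennreal_mult')
  qed
  also have "\<dots> = 2 * mutual_energy s \<mu> \<nu> + layer_distance s \<mu> \<nu>"
    unfolding mutual_energy_layers[OF s \<mu> \<nu>] layer_distance_def
    by (subst nn_integral_add, measurable, subst nn_integral_cmult, measurable)
  finally show ?thesis .
qed

lemma AE_lborel_imp_ex:
  fixes a b :: real
  assumes "AE x in lborel. P x" and "a < b"
  shows "\<exists>x. a < x \<and> x < b \<and> P x"
proof (rule ccontr)
  assume neg: "\<not> ?thesis"
  obtain N where N: "{x \<in> space lborel. \<not> P x} \<subseteq> N" "N \<in> sets lborel" "emeasure lborel N = 0"
    using assms(1) by (auto elim!: AE_E)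
  have "emeasure lborel {a<..<b} \<le> emeasure lborel N"
    using neg N by (intro emeasure_mono) auto
  then show False using N(3) \<open>a < b\<close> by simp
qed

text \<open>
  The two measures agree on almost all intervals \<open>[a, b]\<close>. For a fixed good \<open>a\<close> the difference \<open>G\<close> of the
  distribution functions is then constant for almost all \<open>b > a\<close>; right continuity removes the exceptional set,
  and the limit at \<open>\<infinity>\<close> shows that the constant is \<open>0\<close>.
\<close>

lemma layer_distance_eq_0D:
  assumes s: "0 < s" and \<mu>: "real_distribution \<mu>" and \<nu>: "real_distribution \<nu>"
    and zero: "layer_distance s \<mu> \<nu> = 0"
  shows "\<mu> = \<nu>"
proof -
  interpret \<mu>: real_distribution \<mu> by fact
  interpret \<nu>: real_distribution \<nu> by fact
  have "AE I in layers s. mass_on \<mu> I = mass_on \<nu> I"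
    using zero unfolding layer_distance_def by (subst (asm) nn_integral_0_iff_AE) (auto simp: ennreal_eq_0_iff)
  then have "AE I in lborel \<Otimes>\<^sub>M lborel. fst I < snd I \<longrightarrow> mass_on \<mu> I = mass_on \<nu> I"
    unfolding layers_def AE_density[OF measurable_layer_density]
    by eventually_elim (use s in \<open>auto simp: layer_density_def\<close>)
  then have good: "AE a in lborel. AE b in lborel. a < b \<longrightarrow> mass_on \<mu> (a, b) = mass_on \<nu> (a, b)"
    using lborel_pair.AE_pair by fastforce
  define G where "G b = cdf \<mu> b - cdf \<nu> b" for b
  have G_right: "(G \<longlongrightarrow> G b) (at_right b)" for b
    using \<mu>.cdf_is_right_cont[of b] \<nu>.cdf_is_right_cont[of b] unfolding G_def continuous_within
    by (intro tendsto_diff)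
  have G_top: "(G \<longlongrightarrow> 0) at_top"
    unfolding G_def using tendsto_diff[OF \<mu>.cdf_lim_at_top_prob \<nu>.cdf_lim_at_top_prob] by simp
  have G0: "G b = 0" for b
  proof -
    obtain a where a: "a < b" and AEb: "AE b in lborel. a < b \<longrightarrow> mass_on \<mu> (a, b) = mass_on \<nu> (a, b)"
      using AE_lborel_imp_ex[OF good, of "b - 1" b] by auto
    define k where "k = measure \<mu> {..<a} - measure \<nu> {..<a}"
    have Gk: "G c = k" if "a < c" "mass_on \<mu> (a, c) = mass_on \<nu> (a, c)" for c
    proof -
      have un: "{..c} = {..<a} \<union> {a..c}" using that by auto
      have "cdf \<mu> c = measure \<mu> {..<a} + mass_on \<mu> (a, c)"
        unfolding cdf_def mass_on_def un by (subst \<mu>.finite_measure_Union) auto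
      moreover have "cdf \<nu> c = measure \<nu> {..<a} + mass_on \<nu> (a, c)"
        unfolding cdf_def mass_on_def un by (subst \<nu>.finite_measure_Union) auto
      ultimately show ?thesis using that unfolding G_def k_def by simp
    qed
    have "k = 0"
    proof (rule ccontr)
      assume "k \<noteq> 0"
      then have "eventually (\<lambda>c. G c \<noteq> k) at_top"
        using tendsto_imp_eventually_ne[OF G_top] by auto
      then obtain d where d: "\<And>c. d \<le> c \<Longrightarrow> G c \<noteq> k" by (auto simp: eventually_at_top_linorder)
      obtain c where "max a d < c" "a < c \<longrightarrow> mass_on \<mu> (a, c) = mass_on \<nu> (a, c)"
        using AE_lborel_imp_ex[OF AEb, of "max a d" "max a d + 1"] by auto
      then show False using d[of c] Gk[of c] by auto
    qed
    moreover have "G b = k"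
    proof (rule ccontr)
      assume "G b \<noteq> k"
      then have "eventually (\<lambda>c. G c \<noteq> k) (at_right b)"
        by (intro tendsto_imp_eventually_ne[OF G_right])
      then obtain d where d: "b < d" "\<And>c. b < c \<Longrightarrow> c < d \<Longrightarrow> G c \<noteq> k"
        by (auto simp: eventually_at_right_field)
      obtain c where "b < c" "c < d" "a < c \<longrightarrow> mass_on \<mu> (a, c) = mass_on \<nu> (a, c)"
        using AE_lborel_imp_ex[OF AEb d(1)] by auto
      then show False using d(2)[of c] Gk[of c] a by auto
    qed
    ultimately show ?thesis by simp
  qed
  show ?thesis
    using G0 by (intro cdf_unique \<mu> \<nu>) (auto simp: G_def fun_eq_iff)
qed

section \<open>The minimizer on the line\<close>

definition rho_line :: "real \<Rightarrow> real measure" where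
  "rho_line s = density lborel (\<lambda>t. ennreal (rho1 s t))"

definition line_energy :: "real \<Rightarrow> real measure \<Rightarrow> ennreal" where
  "line_energy s \<mu> = (\<integral>\<^sup>+t. \<integral>\<^sup>+u. riesz s (t - u) + ennreal ((t - u)\<^sup>2) \<partial>\<mu> \<partial>\<mu>)"

lemma nn_integral_semicircle_unit:
  fixes p :: real
  assumes p: "- 1 < p"
  shows "(\<integral>\<^sup>+u. ennreal ((1 - u\<^sup>2) powr p) * indicator {-1..1} u \<partial>lborel) = ennreal (Beta (1 / 2) (p + 1))"
proof -
  let ?f = "\<lambda>w :: real. w powr (1 / 2 - 1) * (1 - w) powr ((p + 1) - 1)"
  have "(\<integral>\<^sup>+u. ennreal ((1 - u\<^sup>2) powr p) * indicator {-1..1} u \<partial>lborel)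
      = (\<integral>\<^sup>+u. (ennreal ((1 - u\<^sup>2) powr p) + ennreal ((1 - (- u)\<^sup>2) powr p)) * indicator {0..1} u \<partial>lborel)"
    by (rule nn_integral_symmetric_interval) measurable
  also have "\<dots> = (\<integral>\<^sup>+u. ennreal (?f (u\<^sup>2) * (2 * u) * indicator {0..1} u) \<partial>lborel)"
  proof (rule nn_integral_cong_AE)
    have "AE u in lborel. u \<noteq> (0 :: real)" by (rule AE_lborel_singleton)
    then show "AE u in lborel. (ennreal ((1 - u\<^sup>2) powr p) + ennreal ((1 - (- u)\<^sup>2) powr p)) * indicator {0..1} u
      = ennreal (?f (u\<^sup>2) * (2 * u) * indicator {0..1} u)"
    proof eventually_elim
      case (elim u)
      show ?case
      proof (cases "u \<in> {0..1}")
        case True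
        then have u: "0 < u" using elim by simp
        have "(u\<^sup>2) powr (1 / 2 - 1) = u powr (- 1)"
          using u powr_powr[of u 2 "- 1 / 2"] by simp
        then have "?f (u\<^sup>2) * (2 * u) = (1 - u\<^sup>2) powr p + (1 - (- u)\<^sup>2) powr p"
          using u by simp
        then show ?thesis using True by (simp only: ennreal_plus[symmetric] powr_ge_zero) simp
      qed simp
    qed
  qed
  also have "\<dots> = (\<integral>\<^sup>+w. ennreal (?f w * indicator {0\<^sup>2..1\<^sup>2} w) \<partial>lborel)"
    by (rule nn_integral_substitution[symmetric])
      (auto intro!: derivative_eq_intros continuous_intros simp: set_borel_measurable_def)
  also have "\<dots> = (\<integral>\<^sup>+w. ennreal (?f w) * indicator {0..1} w \<partial>lborel)"
    by (intro nn_integral_cong) (auto simp: indicator_def)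
  also have "\<dots> = ennreal (Beta (1 / 2) (p + 1))"
    using p by (intro nn_integral_Beta) auto
  finally show ?thesis .
qed

lemma nn_integral_semicircle:
  fixes p R :: real
  assumes p: "- 1 < p" and R: "0 < R"
  shows "(\<integral>\<^sup>+y. ennreal ((R\<^sup>2 - y\<^sup>2) powr p) * indicator {-R..R} y \<partial>lborel) = ennreal (R powr (2 * p + 1) * Beta (1 / 2) (p + 1))"
proof -
  have pt: "ennreal ((R\<^sup>2 - (0 + R * w)\<^sup>2) powr p) * indicator {-R..R} (0 + R * w)
     = ennreal (R powr (2 * p)) * (ennreal ((1 - w\<^sup>2) powr p) * indicator {-1..1} w)" for w
  proof -
    have 2: "R\<^sup>2 - (0 + R * w)\<^sup>2 = R * R * (1 - w\<^sup>2)"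
      by (simp add: power2_eq_square algebra_simps)
    have ind: "indicator {-R..R} (0 + R * w) = (indicator {-1..1} w :: ennreal)"
    proof -
      have "R * w \<le> R \<longleftrightarrow> w \<le> 1" "- R \<le> R * w \<longleftrightarrow> - 1 \<le> w"
        using R mult_le_cancel_left_pos[of R w 1] mult_le_cancel_left_pos[of R "- 1" w] by simp_all
      then show ?thesis by (simp add: indicator_def)
    qed
    have "R powr p * R powr p = R powr (2 * p)"
      unfolding powr_add[symmetric] by (simp only: mult_2)
    then have "(R * R * (1 - w\<^sup>2)) powr p = R powr (2 * p) * (1 - w\<^sup>2) powr p"
      by (simp only: powr_mult)
    then show ?thesis
      unfolding 2 ind by (simp only: ennreal_mult' powr_ge_zero mult.assoc)
  qed
  have "(\<integral>\<^sup>+y. ennreal ((R\<^sup>2 - y\<^sup>2) powr p) * indicator {-R..R} y \<partial>lborel) = ennreal \<bar>R\<bar> * (ennreal (R powr (2 * p)) * ennreal (Beta (1 / 2) (p + 1)))"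
    apply (subst nn_integral_real_affine[where c = R and t = 0])
    subgoal by measurable
    subgoal using R by simp
    subgoal
      apply (subst pt)
      apply (subst nn_integral_cmult)
      subgoal by measurable
      apply (subst nn_integral_semicircle_unit)
      using p by auto
    done
  also have "\<dots> = ennreal (\<bar>R\<bar> * (R powr (2 * p) * Beta (1 / 2) (p + 1)))"
    by (subst ennreal_mult', simp, subst ennreal_mult', simp, simp)
  also have "\<bar>R\<bar> * (R powr (2 * p) * Beta (1 / 2) (p + 1)) = R powr (2 * p + 1) * Beta (1 / 2) (p + 1)"
    using R by (simp add: powr_add)
  finally show ?thesis .
qed

lemma C1_pos: "0 < s \<Longrightarrow> s < 1 \<Longrightarrow> 0 < C1 s"
  unfolding C1_def using cos_pos_of_unit[of s] by (auto intro!: divide_pos_pos mult_pos_pos)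

lemma Beta_pos: "0 < a \<Longrightarrow> 0 < b \<Longrightarrow> 0 < Beta a (b :: real)"
  unfolding Beta_def by (auto intro!: divide_pos_pos mult_pos_pos Gamma_real_pos)

lemma R1_eq: "R1 s = (C1 s * Beta (1 / 2) ((3 + s) / 2)) powr (- (1 / (s + 2)))"
  unfolding R1_def C1_def ..

lemma R1_pos: "0 < s \<Longrightarrow> s < 1 \<Longrightarrow> 0 < R1 s"
  unfolding R1_eq using C1_pos[of s] Beta_pos[of "1 / 2" "(3 + s) / 2"] by auto

lemma rho1_eq: 
  assumes "0 < s" "s < 1"
  shows "rho1 s t = C1 s * ((R1 s)\<^sup>2 - t\<^sup>2) powr ((1 + s) / 2) * indicator {- R1 s..R1 s} t"
proof (cases "\<bar>t\<bar> \<le> R1 s")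
  case True
  then have "t\<^sup>2 \<le> (R1 s)\<^sup>2"
    using R1_pos[OF assms] by (simp flip: abs_le_square_iff)
  then show ?thesis using True by (auto simp: rho1_def indicator_def abs_le_iff max_def)
next
  case False
  then have "(R1 s)\<^sup>2 \<le> t\<^sup>2"
    using R1_pos[OF assms] by (simp flip: abs_le_square_iff)
  then show ?thesis using False by (auto simp: rho1_def indicator_def abs_le_iff max_def)
qed

lemma measurable_rho1 [measurable]: "rho1 s \<in> borel_measurable borel"
  unfolding rho1_def[abs_def] by measurable

lemma rho1_nonneg: "0 < s \<Longrightarrow> s < 1 \<Longrightarrow> 0 \<le> rho1 s t"
  unfolding rho1_def using C1_pos[of s] by simp

lemma nn_integral_rho_line:
  assumes "0 < s" "s < 1" and [measurable]: "f \<in> borel_measurable borel"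
  shows "(\<integral>\<^sup>+t. f t \<partial>rho_line s)
    = ennreal (C1 s) * (\<integral>\<^sup>+t. f t * (ennreal (((R1 s)\<^sup>2 - t\<^sup>2) powr ((1 + s) / 2)) * indicator {- R1 s..R1 s} t) \<partial>lborel)"
proof -
  have "(\<integral>\<^sup>+t. f t \<partial>rho_line s) = (\<integral>\<^sup>+t. ennreal (rho1 s t) * f t \<partial>lborel)"
    unfolding rho_line_def by (rule nn_integral_density) measurable
  also have "\<dots> = (\<integral>\<^sup>+t. ennreal (C1 s) * (f t * (ennreal (((R1 s)\<^sup>2 - t\<^sup>2) powr ((1 + s) / 2)) * indicator {- R1 s..R1 s} t)) \<partial>lborel)"
    unfolding rho1_eq[OF assms(1,2)] using C1_pos[OF assms(1,2)]
    by (intro nn_integral_cong) (auto simp: indicator_def ennreal_mult' mult_ac)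
  also have "\<dots> = ennreal (C1 s) * (\<integral>\<^sup>+t. f t * (ennreal (((R1 s)\<^sup>2 - t\<^sup>2) powr ((1 + s) / 2)) * indicator {- R1 s..R1 s} t) \<partial>lborel)"
    by (rule nn_integral_cmult) measurable
  finally show ?thesis .
qed

lemma real_distribution_rho_line:
  assumes s: "0 < s" "s < 1"
  shows "real_distribution (rho_line s)"
proof -
  have "emeasure (rho_line s) (space (rho_line s)) = (\<integral>\<^sup>+t. 1 \<partial>rho_line s)" by simp
  also have "\<dots> = ennreal (C1 s) * ennreal (R1 s powr (2 * ((1 + s) / 2) + 1) * Beta (1 / 2) ((1 + s) / 2 + 1))"
    using nn_integral_semicircle[of "(1 + s) / 2" "R1 s"] s R1_pos[OF s] by (subst nn_integral_rho_line[OF s]) auto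
  also have "\<dots> = ennreal (C1 s * (R1 s powr (2 * ((1 + s) / 2) + 1) * Beta (1 / 2) ((1 + s) / 2 + 1)))"
    using C1_pos[OF s] by (simp add: ennreal_mult')
  also have "C1 s * (R1 s powr (2 * ((1 + s) / 2) + 1) * Beta (1 / 2) ((1 + s) / 2 + 1)) = 1"
  proof -
    have e: "2 * ((1 + s) / 2) + 1 = s + 2" "(1 + s) / 2 + 1 = (3 + s) / 2" by (simp_all add: field_simps)
    define K where "K = C1 s * Beta (1 / 2) ((3 + s) / 2)"
    have K: "0 < K" unfolding K_def using C1_pos[OF s] Beta_pos[of "1 / 2" "(3 + s) / 2"] s by auto
    have "R1 s powr (s + 2) = K powr (- (1 / (s + 2)) * (s + 2))"
      unfolding R1_eq K_def[symmetric] by (rule powr_powr)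
    also have "- (1 / (s + 2)) * (s + 2) = - 1" using s by simp
    finally have "R1 s powr (s + 2) = 1 / K" using K by simp
    moreover have "C1 s \<noteq> 0" "Beta (1 / 2) ((3 + s) / 2) \<noteq> 0" using K by (auto simp: K_def)
    ultimately show ?thesis unfolding e by (simp add: K_def)
  qed
  finally have "prob_space (rho_line s)" by (intro prob_spaceI) simp
  moreover have "sets (rho_line s) = sets borel" by (simp add: rho_line_def)
  ultimately show ?thesis
    by (intro real_distribution.intro real_distribution_axioms.intro) auto
qed

lemma C1_riesz: 
  assumes s: "0 < s" "s < 1"
  shows "C1 s * ((1 + s) * (pi / cos (s * pi / 2)) / 2) = 1 / s"
proof -
  have "0 < s + 1" "0 < cos (s * pi / 2)" using s cos_pos_of_unit[OF s] by auto
  then show ?thesis unfolding C1_def add.commute[of 1 s] using s by simp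
qed

lemma riesz_potential_rho_line:
  assumes s: "0 < s" "s < 1"
  shows "(\<integral>\<^sup>+u. riesz s (t - u) \<partial>rho_line s) = ennreal (C1 s) * semicircle_potential s (R1 s) t"
proof -
  have "AE u in lborel. u \<noteq> t" by (rule AE_lborel_singleton)
  then have "AE u in lborel. riesz s (t - u) * (ennreal (((R1 s)\<^sup>2 - u\<^sup>2) powr ((1 + s) / 2)) * indicator {- R1 s..R1 s} u)
    = ennreal (\<bar>t - u\<bar> powr (- s) * ((R1 s)\<^sup>2 - u\<^sup>2) powr ((1 + s) / 2)) * indicator {- R1 s..R1 s} u"
    by eventually_elim (simp add: riesz_def ennreal_mult' mult.assoc)
  then show ?thesis
    unfolding semicircle_potential_def
    by (subst nn_integral_rho_line[OF s], measurable) (simp add: nn_integral_cong_AE)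
qed

text \<open>
  On its support, the potential of \<open>\<rho>\<^sub>1\<close> balances the confinement. The constants \<open>C1\<close> and \<open>R1\<close> are exactly those for
  which the coefficient of \<open>t\<^sup>2\<close> is \<open>-1\<close> and the total mass is \<open>1\<close>.
\<close>

lemma euler_lagrange_equality:
  assumes s: "0 < s" "s < 1" and t: "\<bar>t\<bar> \<le> R1 s"
  shows "(\<integral>\<^sup>+u. riesz s (t - u) \<partial>rho_line s) + ennreal (t\<^sup>2) = ennreal ((R1 s)\<^sup>2 / s)"
proof -
  have tR: "s * t\<^sup>2 \<le> (R1 s)\<^sup>2"
  proof -
    have "t\<^sup>2 \<le> (R1 s)\<^sup>2" using t R1_pos[OF s] by (simp flip: abs_le_square_iff)
    moreover have "s * t\<^sup>2 \<le> 1 * t\<^sup>2" using s by (intro mult_right_mono) auto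
    ultimately show ?thesis by simp
  qed
  have "(\<integral>\<^sup>+u. riesz s (t - u) \<partial>rho_line s)
    = ennreal (C1 s * ((1 + s) * (pi / cos (s * pi / 2)) / 2 * ((R1 s)\<^sup>2 - s * t\<^sup>2)))"
    unfolding riesz_potential_rho_line[OF s] semicircle_potential_inside[OF s t]
    using C1_pos[OF s] by (simp only: ennreal_mult' less_imp_le)
  also have "C1 s * ((1 + s) * (pi / cos (s * pi / 2)) / 2 * ((R1 s)\<^sup>2 - s * t\<^sup>2)) = 1 / s * ((R1 s)\<^sup>2 - s * t\<^sup>2)"
    unfolding C1_riesz[OF s, symmetric] by (simp only: mult.assoc)
  also have "\<dots> = (R1 s)\<^sup>2 / s - t\<^sup>2" using s by (simp add: field_simps)
  finally have eq: "(\<integral>\<^sup>+u. riesz s (t - u) \<partial>rho_line s) = ennreal ((R1 s)\<^sup>2 / s - t\<^sup>2)" .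
  have "0 \<le> (R1 s)\<^sup>2 / s - t\<^sup>2" using tR s by (simp add: field_simps)
  then show ?thesis unfolding eq by (simp flip: ennreal_plus)
qed

lemma euler_lagrange_inequality:
  assumes s: "0 < s" "s < 1"
  shows "ennreal ((R1 s)\<^sup>2 / s) \<le> (\<integral>\<^sup>+u. riesz s (t - u) \<partial>rho_line s) + ennreal (t\<^sup>2)"
proof (cases "\<bar>t\<bar> \<le> R1 s")
  case True
  then show ?thesis using euler_lagrange_equality[OF s True] by simp
next
  case False
  then have t: "R1 s \<le> \<bar>t\<bar>" by simp
  have tR: "(R1 s)\<^sup>2 \<le> t\<^sup>2" using t R1_pos[OF s] by (simp flip: abs_le_square_iff)
  define k where "k = (1 + s) * (pi / cos (s * pi / 2)) / 2"
  have k: "C1 s * k = 1 / s" unfolding k_def by (rule C1_riesz[OF s])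
  let ?P = "\<integral>\<^sup>+u. riesz s (t - u) \<partial>rho_line s"
  have "ennreal (C1 s) * ennreal ((1 - s) * k * t\<^sup>2) \<le> ennreal (C1 s) * (semicircle_potential s (R1 s) t + ennreal (k * (t\<^sup>2 - (R1 s)\<^sup>2)))"
    using semicircle_potential_outside[OF s R1_pos[OF s] t] unfolding k_def
    by (intro mult_left_mono) (simp_all add: mult_ac)
  also have "\<dots> = ?P + ennreal (C1 s * (k * (t\<^sup>2 - (R1 s)\<^sup>2)))"
    unfolding riesz_potential_rho_line[OF s] using C1_pos[OF s] by (simp add: distrib_left ennreal_mult')
  also have "C1 s * (k * (t\<^sup>2 - (R1 s)\<^sup>2)) = (t\<^sup>2 - (R1 s)\<^sup>2) / s"
    unfolding mult.assoc[symmetric] k by simp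
  also have "ennreal (C1 s) * ennreal ((1 - s) * k * t\<^sup>2) = ennreal ((1 - s) / s * t\<^sup>2)"
  proof -
    have "C1 s * ((1 - s) * k * t\<^sup>2) = (C1 s * k) * (1 - s) * t\<^sup>2" by (simp only: mult_ac)
    then show ?thesis unfolding k using C1_pos[OF s] by (simp flip: ennreal_mult')
  qed
  finally have f1: "ennreal ((1 - s) / s * t\<^sup>2) + ennreal (t\<^sup>2) \<le> ?P + ennreal ((t\<^sup>2 - (R1 s)\<^sup>2) / s) + ennreal (t\<^sup>2)"
    by (rule add_right_mono)
  have f2: "ennreal ((1 - s) / s * t\<^sup>2) + ennreal (t\<^sup>2) = ennreal ((R1 s)\<^sup>2 / s) + ennreal ((t\<^sup>2 - (R1 s)\<^sup>2) / s)"
  proof -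
    have "(1 - s) / s * t\<^sup>2 + t\<^sup>2 = (R1 s)\<^sup>2 / s + (t\<^sup>2 - (R1 s)\<^sup>2) / s" using s by (simp add: field_simps)
    moreover have "0 \<le> (1 - s) / s * t\<^sup>2" "0 \<le> (R1 s)\<^sup>2 / s" "0 \<le> (t\<^sup>2 - (R1 s)\<^sup>2) / s" using s tR by auto
    ultimately show ?thesis by (simp only: ennreal_plus[symmetric] zero_le_power2)
  qed
  have "ennreal ((t\<^sup>2 - (R1 s)\<^sup>2) / s) + ennreal ((R1 s)\<^sup>2 / s) \<le> ennreal ((t\<^sup>2 - (R1 s)\<^sup>2) / s) + (?P + ennreal (t\<^sup>2))"
    using f1 unfolding f2 by (simp only: add_ac)
  then show ?thesis by (simp add: ennreal_add_left_cancel_le)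
qed

definition second_moment :: "real measure \<Rightarrow> ennreal" where
  "second_moment \<mu> = (\<integral>\<^sup>+t. ennreal (t\<^sup>2) \<partial>\<mu>)"

context real_distribution
begin

lemmas [measurable_cong] = events_eq_borel

lemma nn_integral_const_prob: "(\<integral>\<^sup>+t. c \<partial>M) = c"
  using emeasure_space_1 by simp

lemma integrable_id_of_square:
  assumes "integrable M (\<lambda>t. t\<^sup>2)"
  shows "integrable M (\<lambda>t. t)"
  using square_integrable_imp_integrable[of "\<lambda>t. t"] assms by simp

lemma line_energy_split:
  "line_energy s M = mutual_energy s M M + (\<integral>\<^sup>+t. \<integral>\<^sup>+u. ennreal ((t - u)\<^sup>2) \<partial>M \<partial>M)"
proof -
  have "line_energy s M = (\<integral>\<^sup>+t. (\<integral>\<^sup>+u. riesz s (t - u) \<partial>M) + (\<integral>\<^sup>+u. ennreal ((t - u)\<^sup>2) \<partial>M) \<partial>M)"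
    unfolding line_energy_def by (intro nn_integral_cong nn_integral_add) measurable
  also have "\<dots> = mutual_energy s M M + (\<integral>\<^sup>+t. \<integral>\<^sup>+u. ennreal ((t - u)\<^sup>2) \<partial>M \<partial>M)"
    unfolding mutual_energy_def by (intro nn_integral_add) measurable
  finally show ?thesis .
qed

text \<open>
  For centred measures the quadratic part \<open>(t - u)\<^sup>2\<close> decouples into two second moments, so that only the
  Riesz part remains bilinear.
\<close>

lemma line_energy_centered:
  assumes int: "integrable M (\<lambda>t. t\<^sup>2)" and mean: "expectation (\<lambda>t. t) = 0"
  shows "line_energy s M = mutual_energy s M M + 2 * second_moment M"
proof -
  note int1 = integrable_id_of_square[OF int]
  define v where "v = expectation (\<lambda>t. t\<^sup>2)"
  have v: "second_moment M = ennreal v"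
    unfolding second_moment_def v_def by (rule nn_integral_eq_integral) (use int in auto)
  have v0: "0 \<le> v" unfolding v_def by simp
  have inner: "(\<integral>\<^sup>+u. ennreal ((t - u)\<^sup>2) \<partial>M) = ennreal (t\<^sup>2) + ennreal v" for t
  proof -
    have eq: "(t - u)\<^sup>2 = t\<^sup>2 - 2 * t * u + u\<^sup>2" for u
      by (simp add: power2_eq_square algebra_simps)
    have "(\<integral>\<^sup>+u. ennreal ((t - u)\<^sup>2) \<partial>M) = ennreal (expectation (\<lambda>u. (t - u)\<^sup>2))"
    proof (rule nn_integral_eq_integral)
      show "integrable M (\<lambda>u. (t - u)\<^sup>2)" unfolding eq using int int1 by simp
    qed simp
    also have "expectation (\<lambda>u. (t - u)\<^sup>2) = t\<^sup>2 + v"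
      unfolding eq using int int1 mean prob_space by (simp add: v_def)
    finally show ?thesis using v0 by simp
  qed
  have "(\<integral>\<^sup>+t. \<integral>\<^sup>+u. ennreal ((t - u)\<^sup>2) \<partial>M \<partial>M) = second_moment M + ennreal v"
    unfolding inner second_moment_def using emeasure_space_1 by (subst nn_integral_add) auto
  then show ?thesis unfolding line_energy_split v by (simp add: mult_2)
qed

text \<open>
  Some \<open>t\<close> has a finite mean square distance to the measure, which bounds the second moment.
\<close>

lemma finite_line_energy_imp_square_integrable:
  assumes fin: "line_energy s M < \<infinity>"
  shows "integrable M (\<lambda>t. t\<^sup>2)"
proof -
  have "(\<integral>\<^sup>+t. \<integral>\<^sup>+u. ennreal ((t - u)\<^sup>2) \<partial>M \<partial>M) < \<infinity>"
    using fin unfolding line_energy_split by simp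
  then have "AE t in M. (\<integral>\<^sup>+u. ennreal ((t - u)\<^sup>2) \<partial>M) \<noteq> \<infinity>"
    by (intro nn_integral_PInf_AE) auto
  then obtain t where "(\<integral>\<^sup>+u. ennreal ((t - u)\<^sup>2) \<partial>M) \<noteq> \<infinity>"
    using eventually_happens'[OF ae_filter_bot] by blast
  then have "integrable M (\<lambda>u. (t - u)\<^sup>2)"
    by (intro integrableI_nonneg) (auto simp: top.not_eq_extremum)
  then have "integrable M (\<lambda>u. 2 * (t - u)\<^sup>2 + 2 * t\<^sup>2)" by simp
  then show ?thesis
  proof (rule Bochner_Integration.integrable_bound)
    show "AE u in M. norm (u\<^sup>2) \<le> norm (2 * (t - u)\<^sup>2 + 2 * t\<^sup>2)"
    proof (rule AE_I2)
      fix u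
      have "0 \<le> (2 * t - u)\<^sup>2" by simp
      then show "norm (u\<^sup>2) \<le> norm (2 * (t - u)\<^sup>2 + 2 * t\<^sup>2)"
        by (simp add: power2_eq_square algebra_simps)
    qed
  qed simp
qed

lemma real_distribution_translate: "real_distribution (distr M borel (\<lambda>t. t + a))"
  by (rule real_distribution_distr) simp

lemma line_energy_translate: "line_energy s (distr M borel (\<lambda>t. t + a)) = line_energy s M"
proof -
  have "line_energy s (distr M borel (\<lambda>t. t + a))
    = (\<integral>\<^sup>+t. \<integral>\<^sup>+u. riesz s (t - (u + a)) + ennreal ((t - (u + a))\<^sup>2) \<partial>M \<partial>distr M borel (\<lambda>t. t + a))"
    unfolding line_energy_def by (intro nn_integral_cong nn_integral_distr) measurable
  also have "\<dots> = (\<integral>\<^sup>+t. \<integral>\<^sup>+u. riesz s ((t + a) - (u + a)) + ennreal (((t + a) - (u + a))\<^sup>2) \<partial>M \<partial>M)"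
    by (rule nn_integral_distr) measurable
  finally show ?thesis unfolding line_energy_def by simp
qed

end

lemma AE_rho_line_bounded:
  assumes s: "0 < s" "s < 1"
  shows "AE t in rho_line s. \<bar>t\<bar> \<le> R1 s"
  unfolding rho_line_def
  by (subst AE_density) (auto simp: rho1_eq[OF s] indicator_def abs_le_iff split: if_splits)

lemma rho1_minus: "rho1 s (- t) = rho1 s t"
  by (simp add: rho1_def)

lemma rho_line_centered:
  assumes s: "0 < s" "s < 1"
  shows "integrable (rho_line s) (\<lambda>t. t\<^sup>2)" "integral\<^sup>L (rho_line s) (\<lambda>t. t) = 0"
proof -
  interpret real_distribution "rho_line s" by (rule real_distribution_rho_line[OF s])
  have "AE t in rho_line s. norm (t\<^sup>2) \<le> (R1 s)\<^sup>2"
    using AE_rho_line_bounded[OF s]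
    by eventually_elim (use R1_pos[OF s] in \<open>simp flip: abs_le_square_iff\<close>)
  then show "integrable (rho_line s) (\<lambda>t. t\<^sup>2)"
    by (intro integrable_const_bound) auto
  have "integral\<^sup>L (rho_line s) (\<lambda>t. t) = (\<integral>t. rho1 s t * t \<partial>lborel)"
    unfolding rho_line_def using rho1_nonneg[OF s] by (subst integral_density) auto
  also have "\<dots> = (\<integral>t. rho1 s (- t) * (- t) \<partial>lborel)"
    using lborel_integral_real_affine[of "- 1" "\<lambda>t. rho1 s t * t" 0] by simp
  also have "\<dots> = - (\<integral>t. rho1 s t * t \<partial>lborel)"
    unfolding rho1_minus by simp
  finally show "integral\<^sup>L (rho_line s) (\<lambda>t. t) = 0"
    unfolding rho_line_def using rho1_nonneg[OF s] by (subst integral_density) (auto simp: integral_density)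
qed

lemma mutual_energy_rho_line:
  assumes s: "0 < s" "s < 1"
  shows "mutual_energy s (rho_line s) (rho_line s) + second_moment (rho_line s) = ennreal ((R1 s)\<^sup>2 / s)"
proof -
  interpret real_distribution "rho_line s" by (rule real_distribution_rho_line[OF s])
  have "mutual_energy s (rho_line s) (rho_line s) + second_moment (rho_line s)
    = (\<integral>\<^sup>+t. (\<integral>\<^sup>+u. riesz s (t - u) \<partial>rho_line s) + ennreal (t\<^sup>2) \<partial>rho_line s)"
    unfolding mutual_energy_def second_moment_def by (rule nn_integral_add[symmetric]) measurable
  also have "\<dots> = (\<integral>\<^sup>+t. ennreal ((R1 s)\<^sup>2 / s) \<partial>rho_line s)"
    using AE_rho_line_bounded[OF s]
    by (intro nn_integral_cong_AE, eventually_elim) (rule euler_lagrange_equality[OF s])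
  also have "\<dots> = ennreal ((R1 s)\<^sup>2 / s)" by (rule nn_integral_const_prob)
  finally show ?thesis .
qed

lemma mutual_energy_with_rho_line:
  assumes s: "0 < s" "s < 1" and \<mu>: "real_distribution \<mu>"
  shows "ennreal ((R1 s)\<^sup>2 / s) \<le> mutual_energy s \<mu> (rho_line s) + second_moment \<mu>"
proof -
  interpret \<mu>: real_distribution \<mu> by fact
  interpret real_distribution "rho_line s" by (rule real_distribution_rho_line[OF s])
  have "ennreal ((R1 s)\<^sup>2 / s) = (\<integral>\<^sup>+t. ennreal ((R1 s)\<^sup>2 / s) \<partial>\<mu>)" by (simp only: \<mu>.nn_integral_const_prob)
  also have "\<dots> \<le> (\<integral>\<^sup>+t. (\<integral>\<^sup>+u. riesz s (t - u) \<partial>rho_line s) + ennreal (t\<^sup>2) \<partial>\<mu>)"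
    by (intro nn_integral_mono euler_lagrange_inequality[OF s])
  also have "\<dots> = mutual_energy s \<mu> (rho_line s) + second_moment \<mu>"
    unfolding mutual_energy_def second_moment_def by (rule nn_integral_add) measurable
  finally show ?thesis .
qed

lemma line_energy_rho_line_finite:
  assumes s: "0 < s" "s < 1"
  shows "line_energy s (rho_line s) < \<infinity>"
proof -
  interpret real_distribution "rho_line s" by (rule real_distribution_rho_line[OF s])
  have "mutual_energy s (rho_line s) (rho_line s) < \<infinity>" "second_moment (rho_line s) < \<infinity>"
    using mutual_energy_rho_line[OF s] by (metis ennreal_add_eq_top ennreal_neq_top infinity_ennreal_def less_top)+
  then show ?thesis
    unfolding line_energy_centered[OF rho_line_centered[OF s]]
    by (simp add: ennreal_mult_less_top)
qed

text \<open>
  Expanding the square \<open>(\<mu> - \<rho>)\<^sup>2\<close> bounds the Riesz energy of \<open>\<mu>\<close> from below by its interaction with \<open>\<rho>\<close>, and the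
  Euler-Lagrange inequality bounds that interaction plus the second moment of \<open>\<mu>\<close> by the constant that \<open>\<rho>\<close> itself
  attains. The slack of the expansion is the squared distance, which later gives uniqueness. The self-energy \<open>K\<close>
  of \<open>\<rho>\<close> is added on both sides and cancelled at the end, since it is finite.
\<close>

lemma line_energy_lower_bound:
  assumes s: "0 < s" "s < 1" and \<mu>: "real_distribution \<mu>"
    and int: "integrable \<mu> (\<lambda>t. t\<^sup>2)" and mean: "integral\<^sup>L \<mu> (\<lambda>t. t) = 0"
  shows "line_energy s (rho_line s) + layer_distance s \<mu> (rho_line s) \<le> line_energy s \<mu>"
proof -
  interpret \<mu>: real_distribution \<mu> by fact
  interpret \<rho>: real_distribution "rho_line s" by (rule real_distribution_rho_line[OF s])
  let ?\<rho> = "rho_line s"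
  define A where "A = ennreal ((R1 s)\<^sup>2 / s)"
  define K where "K = mutual_energy s ?\<rho> ?\<rho>"
  have K: "K \<noteq> \<infinity>" and KV: "K + second_moment ?\<rho> = A"
    using mutual_energy_rho_line[OF s] unfolding K_def A_def
    by (metis ennreal_add_eq_top ennreal_neq_top infinity_ennreal_def, simp)
  have "K + (line_energy s ?\<rho> + layer_distance s \<mu> ?\<rho>) = 2 * (K + second_moment ?\<rho>) + layer_distance s \<mu> ?\<rho>"
    unfolding \<rho>.line_energy_centered[OF rho_line_centered[OF s]] K_def by (simp add: mult_2 add_ac)
  also have "\<dots> \<le> 2 * (mutual_energy s \<mu> ?\<rho> + second_moment \<mu>) + layer_distance s \<mu> ?\<rho>"
    unfolding KV A_def using mutual_energy_with_rho_line[OF s \<mu>] by (intro add_right_mono mult_left_mono) auto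
  also have "\<dots> = (2 * mutual_energy s \<mu> ?\<rho> + layer_distance s \<mu> ?\<rho>) + 2 * second_moment \<mu>"
    by (simp add: distrib_left add_ac)
  also have "\<dots> = K + line_energy s \<mu>"
    unfolding mutual_energy_square[OF s(1) \<mu> \<rho>.real_distribution_axioms, symmetric] \<mu>.line_energy_centered[OF int mean] K_def
    by (simp add: add_ac)
  finally show ?thesis using K by (simp add: ennreal_add_left_cancel_le)
qed

theorem line_energy_minimal:
  assumes s: "0 < s" "s < 1" and \<mu>: "real_distribution \<mu>"
  shows "line_energy s (rho_line s) \<le> line_energy s \<mu>"
    and "line_energy s \<mu> \<le> line_energy s (rho_line s) \<Longrightarrow> \<exists>a. \<mu> = distr (rho_line s) borel (\<lambda>t. t + a)"
proof -
  interpret \<mu>: real_distribution \<mu> by fact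
  have both: "line_energy s (rho_line s) \<le> line_energy s \<mu> \<and>
    (line_energy s \<mu> \<le> line_energy s (rho_line s) \<longrightarrow> (\<exists>a. \<mu> = distr (rho_line s) borel (\<lambda>t. t + a)))"
  proof (cases "line_energy s \<mu> < \<infinity>")
    case False
    then have "line_energy s \<mu> = \<infinity>" by (simp flip: less_top)
    then show ?thesis using line_energy_rho_line_finite[OF s] by auto
  next
    case True
    note int = \<mu>.finite_line_energy_imp_square_integrable[OF True]
    note int1 = \<mu>.integrable_id_of_square[OF int]
    define m where "m = \<mu>.expectation (\<lambda>t. t)"
    define \<nu> where "\<nu> = distr \<mu> borel (\<lambda>t. t + (- m))"
    have \<nu>: "real_distribution \<nu>" unfolding \<nu>_def by (rule \<mu>.real_distribution_translate)
    have eq: "(t + (- m))\<^sup>2 = t\<^sup>2 - 2 * m * t + m\<^sup>2" for t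
      by (simp add: power2_eq_square algebra_simps)
    have "integrable \<mu> (\<lambda>t. (t + (- m))\<^sup>2)"
      unfolding eq using int int1 by (intro Bochner_Integration.integrable_add Bochner_Integration.integrable_diff
          integrable_mult_right) simp_all
    then have "integrable \<nu> (\<lambda>t. t\<^sup>2)"
      unfolding \<nu>_def by (subst integrable_distr_eq) measurable
    moreover have "integral\<^sup>L \<nu> (\<lambda>t. t) = 0"
    proof -
      have "integral\<^sup>L \<nu> (\<lambda>t. t) = \<mu>.expectation (\<lambda>t. t + (- m))"
        unfolding \<nu>_def by (rule integral_distr) measurable
      also have "\<dots> = \<mu>.expectation (\<lambda>t. t) + \<mu>.expectation (\<lambda>t. - m)"
        using int1 by (rule Bochner_Integration.integral_add) (rule \<mu>.integrable_const)
      also have "\<mu>.expectation (\<lambda>t. - m) = - m"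
        using \<mu>.prob_space by (simp only: lebesgue_integral_const scaleR_one)
      finally show ?thesis by (simp add: m_def)
    qed
    ultimately have le: "line_energy s (rho_line s) + layer_distance s \<nu> (rho_line s) \<le> line_energy s \<mu>"
      using line_energy_lower_bound[OF s \<nu>] \<mu>.line_energy_translate[of s "- m"] unfolding \<nu>_def by simp
    have "line_energy s (rho_line s) \<le> line_energy s \<mu>"
      using le order_trans[OF _ le] by simp
    moreover have "\<exists>a. \<mu> = distr (rho_line s) borel (\<lambda>t. t + a)" if "line_energy s \<mu> \<le> line_energy s (rho_line s)"
    proof -
      have "line_energy s (rho_line s) + layer_distance s \<nu> (rho_line s) \<le> line_energy s (rho_line s) + 0"
        using order_trans[OF le that] by simp
      then have "layer_distance s \<nu> (rho_line s) = 0"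
        using line_energy_rho_line_finite[OF s] unfolding ennreal_add_left_cancel_le by auto
      then have "\<nu> = rho_line s"
        by (intro layer_distance_eq_0D[OF s(1) \<nu> real_distribution_rho_line[OF s]])
      then have "distr (rho_line s) borel (\<lambda>t. t + m) = distr (distr \<mu> borel (\<lambda>t. t + (- m))) borel (\<lambda>t. t + m)"
        unfolding \<nu>_def by simp
      also have "\<dots> = distr \<mu> borel (\<lambda>t. t)"
        by (subst distr_distr) (auto simp: comp_def)
      also have "\<dots> = \<mu>"
        by (rule distr_id2) simp
      finally show ?thesis by metis
    qed
    ultimately show ?thesis by blast
  qed
  show "line_energy s (rho_line s) \<le> line_energy s \<mu>" using both by blast
  show "line_energy s \<mu> \<le> line_energy s (rho_line s) \<Longrightarrow> \<exists>a. \<mu> = distr (rho_line s) borel (\<lambda>t. t + a)"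
    using both by blast
qed

section \<open>Averages of the one-dimensional kernel over projections\<close>

text \<open>
  Slopes \<open>m\<close> of the projections \<open>(x\<^sub>1, x\<^sub>2) \<mapsto> x\<^sub>2 + m x\<^sub>1\<close>. Any law on a bounded
  interval with bounded density, mean \<open>0\<close> and second moment
  below \<open>1\<close> would serve; for the uniform law on \<open>[-1, 1]\<close> the second moment is \<open>1/3\<close>.
\<close>

definition slopes :: "real measure" where
  "slopes = density lborel (\<lambda>m. ennreal (1 / 2) * indicator {-1..1} m)"

definition projected_riesz :: "real \<Rightarrow> real \<times> real \<Rightarrow> ennreal" where
  "projected_riesz s z = (\<integral>\<^sup>+m. riesz s (snd z + m * fst z) \<partial>slopes)"

lemma nn_integral_slopes:
  assumes [measurable]: "f \<in> borel_measurable borel"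
  shows "(\<integral>\<^sup>+m. f m \<partial>slopes) = ennreal (1 / 2) * (\<integral>\<^sup>+m. f m * indicator {-1..1} m \<partial>lborel)"
  unfolding slopes_def
  by (subst nn_integral_density) (auto simp: mult_ac nn_integral_cmult[symmetric])

lemma sets_slopes [measurable_cong, simp]: "sets slopes = sets borel"
  by (simp add: slopes_def)

lemma AE_slopes: "AE m in slopes. m \<in> {-1..1}"
  unfolding slopes_def by (subst AE_density) (auto simp: indicator_def)

lemma prob_space_slopes: "prob_space slopes"
proof (rule prob_spaceI)
  have "emeasure slopes (space slopes) = (\<integral>\<^sup>+m. 1 \<partial>slopes)" by simp
  also have "\<dots> = ennreal (1 / 2) * emeasure lborel {- 1..1 :: real}"
    by (subst nn_integral_slopes) auto
  also have "\<dots> = ennreal (1 / 2 * 2)" by (subst ennreal_mult') auto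
  finally show "emeasure slopes (space slopes) = 1" by simp
qed

lemma nn_integral_slopes_quadratic:
  fixes a b c :: real
  assumes "\<And>m. m \<in> {-1..1} \<Longrightarrow> 0 \<le> a + b * m + c * m\<^sup>2"
  shows "(\<integral>\<^sup>+m. ennreal (a + b * m + c * m\<^sup>2) \<partial>slopes) = ennreal (a + c / 3)"
proof -
  let ?F = "\<lambda>m. a * m + b * m\<^sup>2 / 2 + c * m ^ 3 / 3"
  have "(\<integral>\<^sup>+m. ennreal (a + b * m + c * m\<^sup>2) * indicator {-1..1} m \<partial>lborel) = ennreal (?F 1 - ?F (- 1))"
  proof (rule nn_integral_FTC_Icc)
    show "DERIV ?F m :> a + b * m + c * m\<^sup>2" for m
      by (auto intro!: derivative_eq_intros simp: power2_eq_square)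
  qed (use assms in auto)
  also have "?F 1 - ?F (- 1) = 2 * (a + c / 3)" by (simp add: field_simps)
  finally have "(\<integral>\<^sup>+m. ennreal (a + b * m + c * m\<^sup>2) \<partial>slopes) = ennreal (1 / 2) * ennreal (2 * (a + c / 3))"
    by (subst nn_integral_slopes) simp_all
  also have "\<dots> = ennreal (1 / 2 * (2 * (a + c / 3)))"
    by (rule ennreal_mult'[symmetric]) simp
  also have "1 / 2 * (2 * (a + c / 3)) = a + c / 3" by simp
  finally show ?thesis .
qed

text \<open>
  The averaged quadratic part exceeds \<open>x\<^sub>2\<^sup>2\<close> by only a third of \<open>x\<^sub>1\<^sup>2\<close>; the missing \<open>2/3\<close> of \<open>x\<^sub>1\<^sup>2\<close> are the reserve
  that forces minimizers onto a vertical line.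
\<close>

lemma nn_integral_slopes_square:
  "(\<integral>\<^sup>+m. ennreal ((v + m * u)\<^sup>2) \<partial>slopes) = ennreal (v\<^sup>2 + u\<^sup>2 / 3)"
proof -
  have eq: "(v + m * u)\<^sup>2 = v\<^sup>2 + (2 * u * v) * m + u\<^sup>2 * m\<^sup>2" for m
    by (simp add: power2_eq_square algebra_simps)
  have "0 \<le> v\<^sup>2 + (2 * u * v) * m + u\<^sup>2 * m\<^sup>2" for m
    unfolding eq[symmetric] by simp
  then show ?thesis
    unfolding eq by (intro nn_integral_slopes_quadratic)
qed

text \<open>
  Bernoulli's inequality for the concave power \<open>(1 / t) powr s\<close> gives a second-order upper bound without
  differentiating. Its linear term is that of the Taylor expansion, which is what matters: the part of it
  linear in the slope averages out, and the rest is of second order.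
\<close>

lemma powr_neg_le_quadratic:
  fixes s t :: real
  assumes s: "0 < s" "s < 1" and t: "1 / 2 \<le> t"
  shows "t powr (- s) \<le> 1 - s * (t - 1) + 2 * s * (t - 1)\<^sup>2"
proof -
  have t0: "0 < t" using t by simp
  have "t powr (- s) = (1 / t) powr s * 1 powr (1 - s)"
    using t0 by (simp add: powr_minus_divide powr_divide)
  also have "\<dots> \<le> s * (1 / t) + (1 - s) * 1"
    using s t0 by (intro Youngs_inequality_0) auto
  also have "\<dots> = 1 - s * (t - 1) + s * ((t - 1)\<^sup>2 / t)"
    using t0 by (simp add: field_simps power2_eq_square)
  also have "(t - 1)\<^sup>2 / t \<le> 2 * (t - 1)\<^sup>2"
    using t0 t mult_right_mono[of 1 "2 * t" "(t - 1)\<^sup>2"] by (simp add: field_simps)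
  then have "s * ((t - 1)\<^sup>2 / t) \<le> 2 * s * (t - 1)\<^sup>2"
    using s mult_left_mono[of "(t - 1)\<^sup>2 / t" "2 * (t - 1)\<^sup>2" s] by simp
  finally show ?thesis by simp
qed

text \<open>
  Here all projections \<open>c + m \<sigma>\<close> of the unit vector stay above \<open>1/2\<close>, so the quadratic bound may be averaged
  over \<open>m\<close>. The term linear in \<open>m\<close> vanishes, and \<open>1 - c\<close> is of order \<open>\<sigma>\<^sup>2\<close>.
\<close>

lemma projected_riesz_near_vertical:
  assumes s: "0 < s" "s < 1" and c: "0 \<le> c" "c\<^sup>2 + \<sigma>\<^sup>2 = 1" and near: "1 / 2 \<le> c - \<bar>\<sigma>\<bar>"
  shows "projected_riesz s (\<sigma>, c) \<le> ennreal (1 + 4 * \<sigma>\<^sup>2)"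
proof -
  let ?a = "1 - s * (c - 1) + 2 * s * (c - 1)\<^sup>2"
  let ?b = "4 * s * (c - 1) * \<sigma> - s * \<sigma>"
  let ?k = "2 * s * \<sigma>\<^sup>2"
  have low: "1 / 2 \<le> c + m * \<sigma>" if "m \<in> {-1..1}" for m
  proof -
    have "\<bar>m * \<sigma>\<bar> \<le> \<bar>\<sigma>\<bar>" unfolding abs_mult using that by (intro mult_left_le_one_le) auto
    then show ?thesis using near by linarith
  qed
  have expand: "1 - s * (c + m * \<sigma> - 1) + 2 * s * (c + m * \<sigma> - 1)\<^sup>2 = ?a + ?b * m + ?k * m\<^sup>2" for m
    by (simp add: power2_eq_square algebra_simps)
  have le: "(c + m * \<sigma>) powr (- s) \<le> ?a + ?b * m + ?k * m\<^sup>2" if "m \<in> {-1..1}" for m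
    using powr_neg_le_quadratic[OF s low[OF that]] unfolding expand .
  have "projected_riesz s (\<sigma>, c) \<le> (\<integral>\<^sup>+m. ennreal (?a + ?b * m + ?k * m\<^sup>2) \<partial>slopes)"
    unfolding projected_riesz_def
  proof (rule nn_integral_mono_AE)
    show "AE m in slopes. riesz s (snd (\<sigma>, c) + m * fst (\<sigma>, c)) \<le> ennreal (?a + ?b * m + ?k * m\<^sup>2)"
      using AE_slopes
    proof eventually_elim
      case (elim m)
      have "0 < c + m * \<sigma>" using low[OF elim] by linarith
      then show ?case using le[OF elim] by (simp add: riesz_def ennreal_leI)
    qed
  qed
  also have "\<dots> = ennreal (?a + ?k / 3)"
  proof (rule nn_integral_slopes_quadratic)
    show "0 \<le> ?a + ?b * m + ?k * m\<^sup>2" if "m \<in> {-1..1}" for m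
      using le[OF that] by (rule order_trans[rotated]) simp
  qed
  also have "\<dots> \<le> ennreal (1 + 4 * \<sigma>\<^sup>2)"
  proof (rule ennreal_leI)
    have c1: "c \<le> 1" using c by (metis le_add_same_cancel1 one_power2 power2_le_imp_le zero_le_one zero_le_power2)
    have "c * c \<le> c" using c c1 mult_left_le by blast
    then have d: "1 - c \<le> \<sigma>\<^sup>2" using c(2) by (simp add: power2_eq_square)
    have "(1 - c) * (1 - c) \<le> (1 - c) * 1" using c c1 by (intro mult_left_mono) auto
    then have d2: "(c - 1)\<^sup>2 \<le> \<sigma>\<^sup>2" using d by (simp add: power2_eq_square algebra_simps)
    have "s * (1 - c) \<le> 1 * \<sigma>\<^sup>2" using s d c1 by (intro mult_mono) auto
    moreover have "s * (c - 1)\<^sup>2 \<le> 1 * \<sigma>\<^sup>2" using s d2 by (intro mult_mono) auto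
    moreover have "s * \<sigma>\<^sup>2 \<le> 1 * \<sigma>\<^sup>2" using s by (intro mult_right_mono) auto
    moreover have "?a + ?k / 3 = 1 + s * (1 - c) + 2 * (s * (c - 1)\<^sup>2) + 2 / 3 * (s * \<sigma>\<^sup>2)"
      by (simp add: algebra_simps)
    ultimately show "?a + ?k / 3 \<le> 1 + 4 * \<sigma>\<^sup>2"
      using zero_le_power2[of \<sigma>] by linarith
  qed
  finally show ?thesis .
qed

lemma riesz_mult:
  assumes "a \<noteq> 0"
  shows "riesz s (a * t) = ennreal (\<bar>a\<bar> powr (- s)) * riesz s t"
  using assms by (auto simp: riesz_def abs_mult powr_mult ennreal_mult' ennreal_mult_top)

text \<open>
  Within distance \<open>1\<close> of the singularity the integral is explicit, and elsewhere the kernel is at most \<open>1\<close>;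
  hence the bound is uniform in \<open>p\<close>.
\<close>

lemma nn_integral_slopes_riesz:
  assumes s: "0 < s" "s < 1"
  shows "(\<integral>\<^sup>+m. riesz s (p + m) \<partial>slopes) \<le> ennreal (1 / (1 - s) + 1)"
proof -
  have Beta1: "(\<integral>\<^sup>+v. ennreal (v powr (- s)) * indicator {0..1} v \<partial>lborel) = ennreal (1 / (1 - s))"
    using nn_integral_has_integral_lebesgue'[OF _ has_integral_powr_from_0[of "- s" 1]] s by simp
  have sing: "(\<integral>\<^sup>+v. ennreal (\<bar>v\<bar> powr (- s)) * indicator {-1..1} v \<partial>lborel) = 2 * ennreal (1 / (1 - s))"
  proof -
    have "(\<integral>\<^sup>+v. ennreal (\<bar>v\<bar> powr (- s)) * indicator {-1..1} v \<partial>lborel)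
      = (\<integral>\<^sup>+v. (ennreal (\<bar>v\<bar> powr (- s)) + ennreal (\<bar>- v\<bar> powr (- s))) * indicator {0..1} v \<partial>lborel)"
      by (rule nn_integral_symmetric_interval) measurable
    also have "\<dots> = (\<integral>\<^sup>+v. 2 * (ennreal (v powr (- s)) * indicator {0..1} v) \<partial>lborel)"
      by (intro nn_integral_cong) (auto simp: indicator_def mult_2)
    also have "\<dots> = 2 * ennreal (1 / (1 - s))"
      by (subst nn_integral_cmult) (auto simp: Beta1)
    finally show ?thesis .
  qed
  have "(\<integral>\<^sup>+m. riesz s (p + m) * indicator {-1..1} m \<partial>lborel)
    \<le> (\<integral>\<^sup>+m. ennreal (\<bar>p + m\<bar> powr (- s)) * indicator {-1..1} (p + m) + indicator {-1..1} m \<partial>lborel)"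
  proof (rule nn_integral_mono_AE)
    have "AE m in lborel. m \<noteq> - p" by (rule AE_lborel_singleton)
    then show "AE m in lborel. riesz s (p + m) * indicator {-1..1} m
        \<le> ennreal (\<bar>p + m\<bar> powr (- s)) * indicator {-1..1} (p + m) + indicator {-1..1} m"
    proof eventually_elim
      case (elim m)
      then have ne: "p + m \<noteq> 0" by auto
      show ?case
      proof (cases "\<bar>p + m\<bar> \<le> 1")
        case True
        then show ?thesis using ne by (auto simp: riesz_def indicator_def abs_le_iff)
      next
        case False
        then have "\<bar>p + m\<bar> powr (- s) \<le> 1" using s powr_mono2'[of "- s" 1 "\<bar>p + m\<bar>"] by simp
        then show ?thesis using ne False by (auto simp: riesz_def indicator_def ennreal_le_1)
      qed
    qed
  qed
  also have "\<dots> = (\<integral>\<^sup>+m. ennreal (\<bar>p + m\<bar> powr (- s)) * indicator {-1..1} (p + m) \<partial>lborel) + emeasure lborel {- 1..1 :: real}"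
    by (subst nn_integral_add) auto
  also have "(\<integral>\<^sup>+m. ennreal (\<bar>p + m\<bar> powr (- s)) * indicator {-1..1} (p + m) \<partial>lborel) = 2 * ennreal (1 / (1 - s))"
    using nn_integral_real_affine[of "\<lambda>v. ennreal (\<bar>v\<bar> powr (- s)) * indicator {-1..1} v" 1 p] unfolding sing by simp
  also have "2 * ennreal (1 / (1 - s)) + emeasure lborel {- 1..1 :: real} = ennreal (2 * (1 / (1 - s)) + 2)"
  proof -
    have "2 * ennreal (1 / (1 - s)) = ennreal (2 * (1 / (1 - s)))" by (subst ennreal_mult') auto
    then show ?thesis using s by (subst ennreal_plus) auto
  qed
  finally have "(\<integral>\<^sup>+m. riesz s (p + m) \<partial>slopes) \<le> ennreal (1 / 2) * ennreal (2 * (1 / (1 - s)) + 2)"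
    by (subst nn_integral_slopes) (auto intro: mult_left_mono)
  also have "\<dots> = ennreal (1 / (1 - s) + 1)"
    using s by (subst ennreal_mult'[symmetric]) (auto simp: distrib_left)
  finally show ?thesis .
qed

text \<open>
  The constant of the first assertion. It is four times sixteen times the bound on the averaged kernel:
  the number four bounds \<open>|\<sigma>| powr (-s)\<close> for \<open>|\<sigma>| \<ge> 1/4\<close>, and \<open>1 \<le> 16 \<sigma>\<^sup>2\<close> for those \<open>\<sigma>\<close>.
\<close>

definition comparison_const :: "real \<Rightarrow> real" where
  "comparison_const s = 64 * (1 / (1 - s) + 1)"

lemma projected_riesz_far_from_vertical:
  assumes s: "0 < s" "s < 1" and \<sigma>: "1 / 4 \<le> \<bar>\<sigma>\<bar>"
  shows "projected_riesz s (\<sigma>, c) \<le> ennreal (comparison_const s * \<sigma>\<^sup>2)"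
proof -
  let ?M = "1 / (1 - s) + 1"
  have M: "0 < ?M" using s by (auto intro: add_pos_pos)
  have \<sigma>0: "\<sigma> \<noteq> 0" using \<sigma> by auto
  have eq: "snd (\<sigma>, c) + m * fst (\<sigma>, c) = \<sigma> * (c / \<sigma> + m)" for m
    using \<sigma>0 by (simp add: field_simps)
  have "projected_riesz s (\<sigma>, c) = ennreal (\<bar>\<sigma>\<bar> powr (- s)) * (\<integral>\<^sup>+m. riesz s (c / \<sigma> + m) \<partial>slopes)"
    unfolding projected_riesz_def eq riesz_mult[OF \<sigma>0] by (rule nn_integral_cmult) measurable
  also have "\<dots> \<le> ennreal 4 * ennreal ?M"
  proof (rule mult_mono)
    have "\<bar>\<sigma>\<bar> powr (- s) \<le> (1 / 4) powr (- s)" using s \<sigma> by (intro powr_mono2') auto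
    also have "\<dots> = 4 powr s" by (simp add: powr_minus_divide powr_divide)
    also have "\<dots> \<le> 4 powr 1" using s by (intro powr_mono) auto
    finally show "ennreal (\<bar>\<sigma>\<bar> powr (- s)) \<le> ennreal 4" by (intro ennreal_leI) simp
  qed (use nn_integral_slopes_riesz[OF s] in auto)
  also have "\<dots> = ennreal (4 * ?M)" using M by (simp only: ennreal_mult' zero_le_numeral)
  also have "\<dots> \<le> ennreal (comparison_const s * \<sigma>\<^sup>2)"
  proof (rule ennreal_leI)
    have "(1 / 4)\<^sup>2 \<le> \<bar>\<sigma>\<bar>\<^sup>2" using \<sigma> by (intro power_mono) auto
    then have "1 \<le> 16 * \<sigma>\<^sup>2" by (simp add: power2_eq_square)
    then have "4 * ?M * 1 \<le> 4 * ?M * (16 * \<sigma>\<^sup>2)" using M by (intro mult_left_mono) auto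
    also have "4 * ?M * (16 * \<sigma>\<^sup>2) = comparison_const s * \<sigma>\<^sup>2" unfolding comparison_const_def by (simp only: mult_ac) simp
    finally show "4 * ?M \<le> comparison_const s * \<sigma>\<^sup>2" by simp
  qed
  finally show ?thesis .
qed

lemma comparison_const_ge: "0 < s \<Longrightarrow> s < 1 \<Longrightarrow> 64 \<le> comparison_const s"
  unfolding comparison_const_def by simp

lemma projected_riesz_unit:
  assumes s: "0 < s" "s < 1" and c: "0 \<le> c" "c\<^sup>2 + \<sigma>\<^sup>2 = 1"
  shows "projected_riesz s (\<sigma>, c) \<le> ennreal (1 + comparison_const s * \<sigma>\<^sup>2)"
proof (cases "1 / 4 \<le> \<bar>\<sigma>\<bar>")
  case True
  then show ?thesis
    by (intro order_trans[OF projected_riesz_far_from_vertical[OF s]] ennreal_leI) auto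
next
  case False
  then have "\<sigma>\<^sup>2 \<le> (1 / 4)\<^sup>2" using power_mono[of "\<bar>\<sigma>\<bar>" "1 / 4" 2] by simp
  then have "(3 / 4)\<^sup>2 \<le> c\<^sup>2" using c(2) by (simp add: power2_eq_square)
  then have "3 / 4 \<le> c" using c(1) by (rule power2_le_imp_le)
  then have "projected_riesz s (\<sigma>, c) \<le> ennreal (1 + 4 * \<sigma>\<^sup>2)"
    using False by (intro projected_riesz_near_vertical s c) auto
  also have "\<dots> \<le> ennreal (1 + comparison_const s * \<sigma>\<^sup>2)"
    using comparison_const_ge[OF s] by (intro ennreal_leI add_left_mono mult_right_mono) auto
  finally show ?thesis .
qed

lemma projected_riesz_minus: "projected_riesz s (- z) = projected_riesz s z"
proof -
  have "snd (- z) + m * fst (- z) = - (snd z + m * fst z)" for m by simp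
  then show ?thesis unfolding projected_riesz_def by (simp only: riesz_minus)
qed

lemma projected_riesz_scale:
  assumes "0 < r"
  shows "projected_riesz s (r * a, r * b) = ennreal (r powr (- s)) * projected_riesz s (a, b)"
proof -
  have eq: "r * b + m * (r * a) = r * (b + m * a)" for m
    by (simp add: algebra_simps)
  have r: "r \<noteq> 0" "\<bar>r\<bar> = r" using assms by auto
  show ?thesis
    unfolding projected_riesz_def fst_conv snd_conv eq riesz_mult[OF r(1)] r(2)
    by (rule nn_integral_cmult) measurable
qed

text \<open>
  By homogeneity and evenness it suffices to treat unit vectors in the upper half plane.
\<close>

lemma projected_riesz_le:
  assumes s: "0 < s" "s < 1" and z: "z \<noteq> 0"
  shows "projected_riesz s z \<le> ennreal (norm z powr (- s) * (1 + comparison_const s * (fst z / norm z)\<^sup>2))"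
proof -
  have main: "projected_riesz s w \<le> ennreal (norm w powr (- s) * (1 + comparison_const s * (fst w / norm w)\<^sup>2))"
    if w: "w \<noteq> 0" "0 \<le> snd w" for w
  proof -
    have n: "0 < norm w" using w by simp
    have n2: "(norm w)\<^sup>2 = (fst w)\<^sup>2 + (snd w)\<^sup>2" by (simp add: norm_prod_def)
    have "(snd w / norm w)\<^sup>2 + (fst w / norm w)\<^sup>2 = ((snd w)\<^sup>2 + (fst w)\<^sup>2) / (norm w)\<^sup>2"
      by (simp add: power_divide add_divide_distrib)
    then have one: "(snd w / norm w)\<^sup>2 + (fst w / norm w)\<^sup>2 = 1"
      using n unfolding n2[symmetric] add.commute[of "(snd w)\<^sup>2"] by simp
    have "projected_riesz s w = projected_riesz s (norm w * (fst w / norm w), norm w * (snd w / norm w))"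
      using n by simp
    also have "\<dots> = ennreal (norm w powr (- s)) * projected_riesz s (fst w / norm w, snd w / norm w)"
      by (rule projected_riesz_scale[OF n])
    also have "\<dots> \<le> ennreal (norm w powr (- s)) * ennreal (1 + comparison_const s * (fst w / norm w)\<^sup>2)"
      using w n one by (intro mult_left_mono projected_riesz_unit s) auto
    also have "\<dots> = ennreal (norm w powr (- s) * (1 + comparison_const s * (fst w / norm w)\<^sup>2))"
      by (simp only: ennreal_mult' powr_ge_zero)
    finally show ?thesis .
  qed
  show ?thesis
    using main[of z] main[of "- z"] z by (cases "0 \<le> snd z") (auto simp: projected_riesz_minus)
qed

section \<open>Minimality and uniqueness in the plane\<close>

lemma measurable_fst_borel [measurable]: "fst \<in> borel_measurable (borel :: (real \<times> real) measure)"
  by (intro borel_measurable_continuous_onI continuous_intros)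

lemma measurable_snd_borel [measurable]: "snd \<in> borel_measurable (borel :: (real \<times> real) measure)"
  by (intro borel_measurable_continuous_onI continuous_intros)

definition interaction :: "(real \<times> real \<Rightarrow> ennreal) \<Rightarrow> (real \<times> real) measure \<Rightarrow> ennreal" where
  "interaction W \<mu> = (\<integral>\<^sup>+x. \<integral>\<^sup>+y. W (x - y) \<partial>\<mu> \<partial>\<mu>)"

lemma energy_le_iff: "energy W \<mu> \<le> energy W \<nu> \<longleftrightarrow> interaction W \<mu> \<le> interaction W \<nu>"
  unfolding energy_def interaction_def[symmetric]
  by (rule ennreal_mult_le_mult_iff) (auto simp: divide_ennreal_def ennreal_inverse_eq_0_iff)

definition vertical :: "real measure \<Rightarrow> real \<Rightarrow> (real \<times> real) measure" where
  "vertical \<nu> a = distr \<nu> borel (\<lambda>t. (a, t))"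

lemma rho1D_eq: "rho1D s = vertical (rho_line s) 0"
  unfolding rho1D_def vertical_def rho_line_def ..

lemma borel_prob_rho1D:
  assumes s: "0 < s" "s < 1"
  shows "borel_prob (rho1D s)"
proof -
  interpret real_distribution "rho_line s" by (rule real_distribution_rho_line[OF s])
  show ?thesis
    unfolding borel_prob_def rho1D_eq vertical_def by (simp add: prob_space_distr)
qed

lemma interaction_rho1D:
  assumes s: "0 < s" "s < 1" and [measurable]: "W \<in> borel_measurable borel"
    and W: "\<And>u. W (0, u) = riesz s u + ennreal (u\<^sup>2)"
  shows "interaction W (rho1D s) = line_energy s (rho_line s)"
proof -
  interpret real_distribution "rho_line s" by (rule real_distribution_rho_line[OF s])
  have "interaction W (rho1D s) = (\<integral>\<^sup>+x. \<integral>\<^sup>+u. W (x - (0, u)) \<partial>rho_line s \<partial>vertical (rho_line s) 0)"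
    unfolding interaction_def rho1D_eq vertical_def by (intro nn_integral_cong nn_integral_distr) measurable
  also have "\<dots> = (\<integral>\<^sup>+t. \<integral>\<^sup>+u. W ((0, t) - (0, u)) \<partial>rho_line s \<partial>rho_line s)"
    unfolding vertical_def by (rule nn_integral_distr) measurable
  finally show ?thesis
    unfolding line_energy_def by (simp add: W)
qed

text \<open>
  A measure carried by a vertical line sees only the one-dimensional energy, whose minimizers are the
  translates of \<open>\<rho>\<^sub>1\<close>. Both uniqueness arguments below end here.
\<close>

lemma vertical_minimizer:
  assumes s: "0 < s" "s < 1" 
    and W: "\<And>u. W (0, u) = riesz s u + ennreal (u\<^sup>2)"
    and \<mu>: "borel_prob \<mu>" and AE: "AE x in \<mu>. AE y in \<mu>. fst x = fst y"
    and le: "interaction W \<mu> \<le> line_energy s (rho_line s)"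
  shows "\<exists>a. \<mu> = distr (rho1D s) borel (\<lambda>x. x + a)"
proof -
  interpret prob_space \<mu> using \<mu> by (simp add: borel_prob_def)
  have sets [measurable_cong, simp]: "sets \<mu> = sets borel" using \<mu> by (simp add: borel_prob_def)
  interpret \<rho>: real_distribution "rho_line s" by (rule real_distribution_rho_line[OF s])
  define \<nu> where "\<nu> = distr \<mu> borel snd"
  have \<nu>: "real_distribution \<nu>"
    unfolding \<nu>_def by (intro real_distribution_distr) measurable
  obtain x0 :: "real \<times> real" where x0: "AE y in \<mu>. fst x0 = fst y"
    using eventually_happens'[OF ae_filter_bot AE] by (rule exE)
  have "line_energy s \<nu> = (\<integral>\<^sup>+t. \<integral>\<^sup>+y. riesz s (t - snd y) + ennreal ((t - snd y)\<^sup>2) \<partial>\<mu> \<partial>\<nu>)"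
    unfolding line_energy_def \<nu>_def by (intro nn_integral_cong nn_integral_distr) measurable
  also have "\<dots> = (\<integral>\<^sup>+x. \<integral>\<^sup>+y. riesz s (snd x - snd y) + ennreal ((snd x - snd y)\<^sup>2) \<partial>\<mu> \<partial>\<mu>)"
    unfolding \<nu>_def by (rule nn_integral_distr) measurable
  also have "\<dots> = interaction W \<mu>"
    unfolding interaction_def
  proof (rule nn_integral_cong_AE)
    show "AE x in \<mu>. (\<integral>\<^sup>+y. riesz s (snd x - snd y) + ennreal ((snd x - snd y)\<^sup>2) \<partial>\<mu>) = (\<integral>\<^sup>+y. W (x - y) \<partial>\<mu>)"
      using AE
    proof eventually_elim
      case (elim x)
      then have "AE y in \<mu>. riesz s (snd x - snd y) + ennreal ((snd x - snd y)\<^sup>2) = W (x - y)"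
      proof eventually_elim
        case (elim y)
        then have "x - y = (0, snd x - snd y)" by (simp add: prod_eq_iff)
        then show ?case using W by simp
      qed
      then show ?case by (rule nn_integral_cong_AE)
    qed
  qed
  finally have "line_energy s \<nu> \<le> line_energy s (rho_line s)" using le by simp
  then obtain a where a: "\<nu> = distr (rho_line s) borel (\<lambda>t. t + a)"
    using line_energy_minimal(2)[OF s \<nu>] by blast
  have "\<mu> = distr \<mu> borel (\<lambda>x. x)" by (rule distr_id2[symmetric]) simp
  also have "\<dots> = distr \<mu> borel (\<lambda>x. (fst x0, snd x))"
  proof (rule distr_cong_AE)
    show "AE x in \<mu>. x = (fst x0, snd x)"
      using x0 by eventually_elim (simp add: prod_eq_iff)
  qed (auto intro: measurable_ident_sets)
  also have "\<dots> = distr \<nu> borel (\<lambda>t. (fst x0, t))"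
    unfolding \<nu>_def by (subst distr_distr) (auto simp: comp_def)
  also have "\<dots> = distr (rho_line s) borel (\<lambda>t. (fst x0, t + a))"
    unfolding a by (subst distr_distr) (auto simp: comp_def)
  also have "\<dots> = distr (rho1D s) borel (\<lambda>x. x + (fst x0, a))"
    unfolding rho1D_eq vertical_def by (subst distr_distr) (auto simp: comp_def)
  finally show ?thesis by blast
qed

text \<open>
  The averaged kernel plus \<open>|z|\<^sup>2\<close> is the average over \<open>m\<close> of the one-dimensional interaction \<open>w\<close> of the projections,
  plus the reserve \<open>2/3 z\<^sub>1\<^sup>2\<close>. By Tonelli the energy is at least the average of the one-dimensional energies
  of the projected measures, each of which is at least that of \<open>\<rho>\<^sub>1\<close>.
\<close>

lemma interaction_projection_bound:
  assumes s: "0 < s" "s < 1" 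
    and W: "\<And>z. projected_riesz s z + ennreal ((norm z)\<^sup>2) \<le> W z"
    and \<mu>: "borel_prob \<mu>"
  shows "line_energy s (rho_line s) + (\<integral>\<^sup>+x. \<integral>\<^sup>+y. ennreal (2 / 3 * (fst x - fst y)\<^sup>2) \<partial>\<mu> \<partial>\<mu>) \<le> interaction W \<mu>"
proof -
  interpret prob_space \<mu> using \<mu> by (simp add: borel_prob_def)
  have sets [measurable_cong, simp]: "sets \<mu> = sets borel" using \<mu> by (simp add: borel_prob_def)
  interpret S: prob_space slopes by (rule prob_space_slopes)
  interpret P: pair_sigma_finite slopes \<mu> ..
  define w where "w t = riesz s t + ennreal (t\<^sup>2)" for t
  have [measurable]: "w \<in> borel_measurable borel" unfolding w_def by measurable
  have avg: "projected_riesz s z + ennreal ((norm z)\<^sup>2) = (\<integral>\<^sup>+m. w (snd z + m * fst z) \<partial>slopes) + ennreal (2 / 3 * (fst z)\<^sup>2)" for z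
  proof -
    have "(\<integral>\<^sup>+m. w (snd z + m * fst z) \<partial>slopes) = projected_riesz s z + ennreal ((snd z)\<^sup>2 + (fst z)\<^sup>2 / 3)"
      unfolding w_def projected_riesz_def nn_integral_slopes_square[symmetric] by (rule nn_integral_add) measurable
    moreover have "ennreal ((snd z)\<^sup>2 + (fst z)\<^sup>2 / 3) + ennreal (2 / 3 * (fst z)\<^sup>2)
      = ennreal ((snd z)\<^sup>2 + (fst z)\<^sup>2 / 3 + 2 / 3 * (fst z)\<^sup>2)"
      by (rule ennreal_plus[symmetric]) auto
    ultimately have "(\<integral>\<^sup>+m. w (snd z + m * fst z) \<partial>slopes) + ennreal (2 / 3 * (fst z)\<^sup>2)
      = projected_riesz s z + ennreal ((snd z)\<^sup>2 + (fst z)\<^sup>2 / 3 + 2 / 3 * (fst z)\<^sup>2)"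
      by (simp only: add.assoc)
    also have "(snd z)\<^sup>2 + (fst z)\<^sup>2 / 3 + 2 / 3 * (fst z)\<^sup>2 = (norm z)\<^sup>2"
      by (simp add: norm_prod_def)
    finally show ?thesis ..
  qed
  have "line_energy s (rho_line s) = (\<integral>\<^sup>+m. line_energy s (rho_line s) \<partial>slopes)"
    using S.emeasure_space_1 by simp
  also have "\<dots> \<le> (\<integral>\<^sup>+m. \<integral>\<^sup>+x. \<integral>\<^sup>+y. w (snd (x - y) + m * fst (x - y)) \<partial>\<mu> \<partial>\<mu> \<partial>slopes)"
  proof (rule nn_integral_mono)
    fix m
    define \<nu> where "\<nu> = distr \<mu> borel (\<lambda>x. snd x + m * fst x)"
    have \<nu>: "real_distribution \<nu>"
      unfolding \<nu>_def by (intro real_distribution_distr) measurable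
    have "line_energy s \<nu> = (\<integral>\<^sup>+t. \<integral>\<^sup>+y. w (t - (snd y + m * fst y)) \<partial>\<mu> \<partial>\<nu>)"
      unfolding line_energy_def w_def[symmetric] \<nu>_def by (intro nn_integral_cong nn_integral_distr) measurable
    also have "\<dots> = (\<integral>\<^sup>+x. \<integral>\<^sup>+y. w ((snd x + m * fst x) - (snd y + m * fst y)) \<partial>\<mu> \<partial>\<mu>)"
      unfolding \<nu>_def by (rule nn_integral_distr) measurable
    also have "\<dots> = (\<integral>\<^sup>+x. \<integral>\<^sup>+y. w (snd (x - y) + m * fst (x - y)) \<partial>\<mu> \<partial>\<mu>)"
      by (simp add: algebra_simps)
    finally show "line_energy s (rho_line s) \<le> (\<integral>\<^sup>+x. \<integral>\<^sup>+y. w (snd (x - y) + m * fst (x - y)) \<partial>\<mu> \<partial>\<mu>)"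
      using line_energy_minimal(1)[OF s \<nu>] by simp
  qed
  also have "\<dots> = (\<integral>\<^sup>+x. \<integral>\<^sup>+m. \<integral>\<^sup>+y. w (snd (x - y) + m * fst (x - y)) \<partial>\<mu> \<partial>slopes \<partial>\<mu>)"
    by (rule P.Fubini'[symmetric]) measurable
  also have "\<dots> = (\<integral>\<^sup>+x. \<integral>\<^sup>+y. \<integral>\<^sup>+m. w (snd (x - y) + m * fst (x - y)) \<partial>slopes \<partial>\<mu> \<partial>\<mu>)"
    by (intro nn_integral_cong P.Fubini'[symmetric]) measurable
  finally have "line_energy s (rho_line s) + (\<integral>\<^sup>+x. \<integral>\<^sup>+y. ennreal (2 / 3 * (fst x - fst y)\<^sup>2) \<partial>\<mu> \<partial>\<mu>)
      \<le> (\<integral>\<^sup>+x. \<integral>\<^sup>+y. \<integral>\<^sup>+m. w (snd (x - y) + m * fst (x - y)) \<partial>slopes \<partial>\<mu> \<partial>\<mu>)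
        + (\<integral>\<^sup>+x. \<integral>\<^sup>+y. ennreal (2 / 3 * (fst (x - y))\<^sup>2) \<partial>\<mu> \<partial>\<mu>)"
    by (simp add: add_right_mono)
  also have "\<dots> = (\<integral>\<^sup>+x. (\<integral>\<^sup>+y. \<integral>\<^sup>+m. w (snd (x - y) + m * fst (x - y)) \<partial>slopes \<partial>\<mu>)
        + (\<integral>\<^sup>+y. ennreal (2 / 3 * (fst (x - y))\<^sup>2) \<partial>\<mu>) \<partial>\<mu>)"
    by (rule nn_integral_add[symmetric]) measurable
  also have "\<dots> = (\<integral>\<^sup>+x. \<integral>\<^sup>+y. (\<integral>\<^sup>+m. w (snd (x - y) + m * fst (x - y)) \<partial>slopes) + ennreal (2 / 3 * (fst (x - y))\<^sup>2) \<partial>\<mu> \<partial>\<mu>)"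
    by (intro nn_integral_cong nn_integral_add[symmetric]) measurable
  also have "\<dots> \<le> interaction W \<mu>"
    unfolding interaction_def avg[symmetric] by (intro nn_integral_mono W)
  finally show ?thesis .
qed

lemma nn_integral_double_eq_0D:
  fixes f :: "real \<times> real \<Rightarrow> ennreal"
  assumes \<mu>: "borel_prob \<mu>" and [measurable]: "f \<in> borel_measurable borel"
    and 0: "(\<integral>\<^sup>+x. \<integral>\<^sup>+y. f (x - y) \<partial>\<mu> \<partial>\<mu>) = 0"
  shows "AE x in \<mu>. AE y in \<mu>. f (x - y) = 0"
proof -
  interpret prob_space \<mu> using \<mu> by (simp add: borel_prob_def)
  have sets [measurable_cong, simp]: "sets \<mu> = sets borel" using \<mu> by (simp add: borel_prob_def)
  have "AE x in \<mu>. (\<integral>\<^sup>+y. f (x - y) \<partial>\<mu>) = 0"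
    using 0 by (subst (asm) nn_integral_0_iff_AE) measurable
  then show ?thesis
  proof eventually_elim
    case (elim x)
    then show ?case by (subst (asm) nn_integral_0_iff_AE) measurable
  qed
qed

text \<open>
  The lower bound is attained by \<open>\<rho>\<^sub>1\<^sub>D\<close>, since on a vertical line \<open>W\<close> is the one-dimensional interaction. For another
  minimizer the reserve term must vanish, so it is carried by a vertical line.
\<close>

theorem unique_minimizer_of_projection_bound:
  assumes s: "0 < s" "s < 1" and meas: "W \<in> borel_measurable borel"
    and W: "\<And>z. projected_riesz s z + ennreal ((norm z)\<^sup>2) \<le> W z"
    and W0: "\<And>u. W (0, u) = riesz s u + ennreal (u\<^sup>2)"
  shows "unique_minimizer_upto_translation W (rho1D s)"
proof -
  have I: "interaction W (rho1D s) = line_energy s (rho_line s)"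
    by (rule interaction_rho1D[OF s meas W0])
  have min: "minimizer W (rho1D s)"
    unfolding minimizer_def energy_le_iff I
  proof (intro conjI allI impI borel_prob_rho1D[OF s])
    fix \<mu> assume "borel_prob \<mu>"
    from interaction_projection_bound[OF s W this]
    show "line_energy s (rho_line s) \<le> interaction W \<mu>"
      by (rule order_trans[rotated]) simp
  qed
  moreover have "\<exists>a. \<mu> = distr (rho1D s) borel (\<lambda>x. x + a)" if "minimizer W \<mu>" for \<mu>
  proof -
    have \<mu>: "borel_prob \<mu>" and le: "interaction W \<mu> \<le> line_energy s (rho_line s)"
      using that borel_prob_rho1D[OF s] unfolding minimizer_def energy_le_iff I[symmetric] by auto
    have "line_energy s (rho_line s) + (\<integral>\<^sup>+x. \<integral>\<^sup>+y. ennreal (2 / 3 * (fst x - fst y)\<^sup>2) \<partial>\<mu> \<partial>\<mu>) \<le> line_energy s (rho_line s) + 0"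
      using order_trans[OF interaction_projection_bound[OF s W \<mu>] le] by simp
    then have "(\<integral>\<^sup>+x. \<integral>\<^sup>+y. ennreal (2 / 3 * (fst (x - y))\<^sup>2) \<partial>\<mu> \<partial>\<mu>) = 0"
      using line_energy_rho_line_finite[OF s] unfolding ennreal_add_left_cancel_le by auto
    then have "AE x in \<mu>. AE y in \<mu>. ennreal (2 / 3 * (fst (x - y))\<^sup>2) = 0"
      by (intro nn_integral_double_eq_0D \<mu>) measurable
    then have "AE x in \<mu>. AE y in \<mu>. fst x = fst y"
      by (simp add: ennreal_eq_0_iff)
    then show ?thesis by (intro vertical_minimizer[OF s W0 \<mu> _ le])
  qed
  ultimately show ?thesis unfolding unique_minimizer_upto_translation_def by blast
qed

section \<open>The angular variable\<close>

lemma angle_spec: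
  assumes "x \<noteq> 0"
  shows "- pi \<le> angle x \<and> angle x < pi \<and> x /\<^sub>R norm x = (cos (angle x), sin (angle x))"
  unfolding angle_def
proof (rule theI')
  have n: "norm x \<noteq> 0" using assms by simp
  have "(fst x / norm x)\<^sup>2 + (snd x / norm x)\<^sup>2 = ((fst x)\<^sup>2 + (snd x)\<^sup>2) / (norm x)\<^sup>2"
    by (simp add: power_divide add_divide_distrib)
  also have "(fst x)\<^sup>2 + (snd x)\<^sup>2 = (norm x)\<^sup>2" by (simp add: norm_prod_def)
  finally have "(fst x / norm x)\<^sup>2 + (snd x / norm x)\<^sup>2 = 1" using n by simp
  then obtain t where t: "0 \<le> t" "t < 2 * pi" "fst x / norm x = cos t" "snd x / norm x = sin t"
    by (rule sincos_total_2pi)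
  have eq: "x /\<^sub>R norm x = (cos t, sin t)"
    using t by (simp add: prod_eq_iff divide_inverse mult.commute)
  show "\<exists>!\<theta>. - pi \<le> \<theta> \<and> \<theta> < pi \<and> x /\<^sub>R norm x = (cos \<theta>, sin \<theta>)"
  proof (rule ex_ex1I)
    show "\<exists>\<theta>. - pi \<le> \<theta> \<and> \<theta> < pi \<and> x /\<^sub>R norm x = (cos \<theta>, sin \<theta>)"
    proof (cases "t < pi")
      case True
      then show ?thesis using t eq pi_gt_zero by (intro exI[of _ t]) linarith
    next
      case False
      have "cos (t - 2 * pi) = cos t" "sin (t - 2 * pi) = sin t" by (simp_all add: cos_diff sin_diff)
      then show ?thesis using t eq False by (intro exI[of _ "t - 2 * pi"]) auto
    qed
  next
    fix a b
    assume a: "- pi \<le> a \<and> a < pi \<and> x /\<^sub>R norm x = (cos a, sin a)"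
      and b: "- pi \<le> b \<and> b < pi \<and> x /\<^sub>R norm x = (cos b, sin b)"
    then have "sin b = sin a \<and> cos b = cos a" by auto
    then obtain n :: int where n: "b = a + 2 * pi * n" unfolding sin_cos_eq_iff by blast
    have "\<bar>2 * pi * n\<bar> < 2 * pi" using n a b by linarith
    then have "\<bar>real_of_int n\<bar> < 1" by (simp add: abs_mult)
    then have "n = 0" by linarith
    then show "a = b" using n by simp
  qed
qed

text \<open>
  Rotating by \<open>\<pi>\<close> if necessary brings the direction of \<open>z\<close> into the closed upper half plane, where the angle is an
  arccosine. For \<open>\<pi>\<close>-periodic functions this replaces \<^const>\<open>angle\<close> by a function that is visibly measurable and
  takes its values in the interval \<open>[0, \<pi>]\<close> on which the hypotheses are stated.
\<close>

definition half_cos :: "real \<times> real \<Rightarrow> real" where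
  "half_cos z = (if snd z < 0 then - fst z / norm z else fst z / norm z)"

definition half_angle :: "real \<times> real \<Rightarrow> real" where
  "half_angle z = arccos (half_cos z)"

lemma abs_half_cos: "\<bar>half_cos z\<bar> = \<bar>fst z / norm z\<bar>"
  by (simp add: half_cos_def)

lemma half_cos_range: "- 1 \<le> half_cos z" "half_cos z \<le> 1"
proof -
  have "\<bar>fst z\<bar> \<le> norm z" using norm_fst_le[of "fst z" "snd z"] by simp
  then have "\<bar>half_cos z\<bar> \<le> 1" unfolding abs_half_cos by (simp add: divide_le_eq_1)
  then show "- 1 \<le> half_cos z" "half_cos z \<le> 1" by linarith+
qed

lemma half_angle_range: "half_angle z \<in> {0..pi}"
  unfolding half_angle_def using half_cos_range[of z] by (simp add: arccos_lbound arccos_ubound)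

lemma half_angle_distance:
  "\<bar>fst z / norm z\<bar> \<le> \<bar>half_angle z - pi / 2\<bar>"
proof -
  have "\<bar>fst z / norm z\<bar> = \<bar>cos (half_angle z)\<bar>"
    unfolding half_angle_def abs_half_cos[symmetric] by (simp only: cos_arccos half_cos_range)
  also have "\<dots> = \<bar>sin (half_angle z - pi / 2)\<bar>" by (simp add: sin_diff)
  also have "\<dots> \<le> \<bar>half_angle z - pi / 2\<bar>" by (rule abs_sin_x_le_abs_x)
  finally show ?thesis .
qed

lemma measurable_half_angle [measurable]: "half_angle \<in> borel_measurable borel"
proof -
  have "continuous_on UNIV (\<lambda>v. arccos (max (- 1) (min 1 v)))"
    by (intro continuous_on_compose2[OF continuous_on_arccos'] continuous_intros) auto
  then have [measurable]: "(\<lambda>v. arccos (max (- 1) (min 1 v))) \<in> borel_measurable borel"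
    by (rule borel_measurable_continuous_onI)
  have "half_angle z = arccos (max (- 1) (min 1 (half_cos z)))" for z
    unfolding half_angle_def using half_cos_range[of z] by simp
  moreover have [measurable]: "half_cos \<in> borel_measurable borel"
    unfolding half_cos_def[abs_def] by measurable
  ultimately show ?thesis
    by (subst measurable_cong[where g = "\<lambda>z. arccos (max (- 1) (min 1 (half_cos z)))"]) auto
qed

lemma periodic_angle:
  assumes per: "\<And>\<theta>. f (\<theta> + pi) = f \<theta>" and z: "z \<noteq> 0"
  shows "f (angle z) = f (half_angle z)"
proof -
  define \<theta> where "\<theta> = angle z"
  have \<theta>: "- pi \<le> \<theta>" "\<theta> < pi" "z /\<^sub>R norm z = (cos \<theta>, sin \<theta>)"
    unfolding \<theta>_def using angle_spec[OF z] by auto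
  have n: "0 < norm z" using z by simp
  have c: "fst z / norm z = cos \<theta>" and sn: "snd z / norm z = sin \<theta>"
    using \<theta>(3) by (auto simp: prod_eq_iff divide_inverse mult.commute)
  have neg: "snd z < 0 \<longleftrightarrow> sin \<theta> < 0" using n by (simp flip: sn add: divide_less_0_iff)
  show ?thesis unfolding \<theta>_def[symmetric]
  proof (cases "sin \<theta> < 0")
    case True
    then have "\<theta> < 0" using sin_ge_zero[of \<theta>] \<theta> by force
    have "half_angle z = arccos (- cos \<theta>)"
      unfolding half_angle_def half_cos_def neg using True c by simp
    also have "- cos \<theta> = cos (\<theta> + pi)" by simp
    also have "arccos \<dots> = \<theta> + pi" using \<theta> \<open>\<theta> < 0\<close> by (intro arccos_cos) auto
    finally show "f \<theta> = f (half_angle z)" using per by simp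
  next
    case False
    then have h: "half_angle z = arccos (cos \<theta>)"
      unfolding half_angle_def half_cos_def neg using False c by simp
    show "f \<theta> = f (half_angle z)"
    proof (cases "0 \<le> \<theta>")
      case True
      then show ?thesis using h \<theta> arccos_cos[of \<theta>] by simp
    next
      case neg': False
      have "\<theta> = - pi"
      proof (rule ccontr)
        assume "\<theta> \<noteq> - pi"
        then have "sin \<theta> < 0" using \<theta> neg' sin_gt_zero[of "- \<theta>"] by auto
        then show False using False by simp
      qed
      then have "half_angle z = \<theta> + pi + pi" using h by (simp add: arccos_minus_1)
      then show ?thesis by (simp only: per)
    qed
  qed
qed

lemma potential_eq:
  assumes "\<And>\<theta>. \<Omega> (\<theta> + pi) = \<Omega> \<theta>"
  shows "potential s \<Omega> z = (if z = 0 then \<infinity> else ennreal (norm z powr (- s) * \<Omega> (half_angle z) + (norm z)\<^sup>2))"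
  using periodic_angle[of \<Omega> z] assms unfolding potential_def by simp

lemma measurable_potential:
  assumes "continuous_on UNIV \<Omega>" "\<And>\<theta>. \<Omega> (\<theta> + pi) = \<Omega> \<theta>"
  shows "potential s \<Omega> \<in> borel_measurable borel"
proof -
  have [measurable]: "\<Omega> \<in> borel_measurable borel" by (rule borel_measurable_continuous_onI) fact
  show ?thesis unfolding potential_eq[where \<Omega> = \<Omega>, OF assms(2), abs_def] by measurable
qed

lemma potential_vertical:
  assumes "\<And>\<theta>. \<Omega> (\<theta> + pi) = \<Omega> \<theta>" "\<Omega> (pi / 2) = 1"
  shows "potential s \<Omega> (0, u) = riesz s u + ennreal (u\<^sup>2)"
proof -
  have ha: "half_angle (0, u) = pi / 2" by (simp add: half_angle_def half_cos_def)
  show ?thesis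
    unfolding potential_eq[where \<Omega> = \<Omega>, OF assms(1)] ha assms(2) by (auto simp: riesz_def zero_prod_def norm_prod_def)
qed

lemma smooth_imp_continuous: "smooth f \<Longrightarrow> continuous_on UNIV f"
  unfolding smooth_def
  by (metis continuous_at_imp_continuous_on differentiable_imp_continuous_within funpow_0)

lemma unique_minimizer_of_quadratic_bound:
  assumes s: "0 < s" "s < 1"
    and \<Omega>: "continuous_on UNIV \<Omega>" "\<And>\<theta>. \<Omega> (\<theta> + pi) = \<Omega> \<theta>" "\<Omega> (pi / 2) = 1"
    and bound: "\<And>\<theta>. \<theta> \<in> {0..pi} \<Longrightarrow> 1 + comparison_const s * \<bar>\<theta> - pi / 2\<bar>\<^sup>2 \<le> \<Omega> \<theta>"
  shows "unique_minimizer_upto_translation (potential s \<Omega>) (rho1D s)"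
proof (rule unique_minimizer_of_projection_bound[OF s measurable_potential[OF \<Omega>(1,2)]])
  show "potential s \<Omega> (0, u) = riesz s u + ennreal (u\<^sup>2)" for u
    by (rule potential_vertical[OF \<Omega>(2,3)])
  show "projected_riesz s z + ennreal ((norm z)\<^sup>2) \<le> potential s \<Omega> z" for z
  proof (cases "z = 0")
    case True
    then show ?thesis by (simp add: potential_def)
  next
    case False
    have K: "0 \<le> comparison_const s" using comparison_const_ge[OF s] by simp
    have "(fst z / norm z)\<^sup>2 \<le> \<bar>half_angle z - pi / 2\<bar>\<^sup>2"
      using power_mono[OF half_angle_distance[of z], of 2] by (simp only: power2_abs abs_ge_zero)
    then have "1 + comparison_const s * (fst z / norm z)\<^sup>2 \<le> 1 + comparison_const s * \<bar>half_angle z - pi / 2\<bar>\<^sup>2"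
      using K by (intro add_left_mono mult_left_mono)
    also have "\<dots> \<le> \<Omega> (half_angle z)" by (rule bound[OF half_angle_range])
    finally have le: "1 + comparison_const s * (fst z / norm z)\<^sup>2 \<le> \<Omega> (half_angle z)" .
    have pos: "0 \<le> 1 + comparison_const s * (fst z / norm z)\<^sup>2" using K by simp
    have "projected_riesz s z + ennreal ((norm z)\<^sup>2) \<le> ennreal (norm z powr (- s) * \<Omega> (half_angle z)) + ennreal ((norm z)\<^sup>2)"
      using le by (intro add_right_mono order_trans[OF projected_riesz_le[OF s False]] ennreal_leI mult_left_mono) auto
    also have "\<dots> = potential s \<Omega> z"
      unfolding potential_eq[where \<Omega> = \<Omega>, OF \<Omega>(2)] using False le pos by (simp flip: ennreal_plus)
    finally show ?thesis .
  qed
qed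

section \<open>Monotonicity in the strength of the anisotropy\<close>

text \<open>
  Raising the strength from \<open>a\<close> to \<open>b\<close> adds a nonnegative energy that vanishes for \<open>\<rho>\<^sub>1\<^sub>D\<close>. It is positive for every
  measure not carried by a vertical line, because the quadratic lower bound makes \<open>\<omega>\<close> positive away from
  the vertical direction; hence minimality becomes minimality with uniqueness.
\<close>

lemma minimizer_rho1D_mono:
  assumes s: "0 < s" "s < 1"
    and \<omega>: "continuous_on UNIV \<omega>" "\<And>\<theta>. 0 \<le> \<omega> \<theta>" "\<And>\<theta>. \<omega> (\<theta> + pi) = \<omega> \<theta>" "\<omega> (pi / 2) = 0"
    and c: "0 < c" "\<And>\<theta>. \<theta> \<in> {0..pi} \<Longrightarrow> c * \<bar>\<theta> - pi / 2\<bar>\<^sup>2 \<le> \<omega> \<theta>"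
    and ab: "0 \<le> a" "a < b"
    and min: "minimizer (potential s (\<lambda>\<theta>. 1 + a * \<omega> \<theta>)) (rho1D s)"
  shows "unique_minimizer_upto_translation (potential s (\<lambda>\<theta>. 1 + b * \<omega> \<theta>)) (rho1D s)"
proof -
  define W where "W k = potential s (\<lambda>\<theta>. 1 + k * \<omega> \<theta>)" for k
  have [measurable]: "W k \<in> borel_measurable borel" for k
    unfolding W_def by (rule measurable_potential) (use \<omega> in \<open>auto intro!: continuous_intros\<close>)
  have W0: "W k (0, u) = riesz s u + ennreal (u\<^sup>2)" for k u
    unfolding W_def by (rule potential_vertical) (use \<omega> in auto)
  have I: "interaction (W k) (rho1D s) = line_energy s (rho_line s)" for k
    by (rule interaction_rho1D[OF s _ W0]) measurable
  define D where "D z = (if z = 0 then 0 else ennreal ((b - a) * norm z powr (- s) * \<omega> (half_angle z)))" for z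
  have [measurable]: "\<omega> \<in> borel_measurable borel" by (rule borel_measurable_continuous_onI) fact
  have [measurable]: "D \<in> borel_measurable borel" unfolding D_def by measurable
  have WD: "W b z = W a z + D z" for z
  proof (cases "z = 0")
    case True
    then show ?thesis by (simp add: W_def potential_def)
  next
    case False
    have eq: "norm z powr (- s) * (1 + b * \<omega> (half_angle z)) + (norm z)\<^sup>2
      = norm z powr (- s) * (1 + a * \<omega> (half_angle z)) + (norm z)\<^sup>2 + (b - a) * norm z powr (- s) * \<omega> (half_angle z)"
      by (simp add: algebra_simps)
    have "W k z = ennreal (norm z powr (- s) * (1 + k * \<omega> (half_angle z)) + (norm z)\<^sup>2)" for k
      unfolding W_def using False \<omega>(3) by (subst potential_eq) auto
    then show ?thesis
      unfolding D_def using False ab \<omega>(2) by (simp only: eq if_False) (intro ennreal_plus; simp)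
  qed
  have split: "interaction (W b) \<mu> = interaction (W a) \<mu> + interaction D \<mu>" if \<mu>: "borel_prob \<mu>" for \<mu>
  proof -
    interpret prob_space \<mu> using \<mu> by (simp add: borel_prob_def)
    have sets [measurable_cong, simp]: "sets \<mu> = sets borel" using \<mu> by (simp add: borel_prob_def)
    have "interaction (W b) \<mu> = (\<integral>\<^sup>+x. (\<integral>\<^sup>+y. W a (x - y) \<partial>\<mu>) + (\<integral>\<^sup>+y. D (x - y) \<partial>\<mu>) \<partial>\<mu>)"
      unfolding interaction_def WD by (intro nn_integral_cong nn_integral_add) measurable
    also have "\<dots> = interaction (W a) \<mu> + interaction D \<mu>"
      unfolding interaction_def by (rule nn_integral_add) measurable
    finally show ?thesis .
  qed
  have ge: "line_energy s (rho_line s) \<le> interaction (W a) \<mu>" if "borel_prob \<mu>" for \<mu>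
    using min that unfolding minimizer_def W_def[symmetric] energy_le_iff I by blast
  have "minimizer (W b) (rho1D s)"
    unfolding minimizer_def energy_le_iff I
  proof (intro conjI allI impI borel_prob_rho1D[OF s])
    fix \<mu> assume \<mu>: "borel_prob \<mu>"
    show "line_energy s (rho_line s) \<le> interaction (W b) \<mu>"
      unfolding split[OF \<mu>] using ge[OF \<mu>] by (rule order_trans) simp
  qed
  moreover have "\<exists>a. \<mu> = distr (rho1D s) borel (\<lambda>x. x + a)" if "minimizer (W b) \<mu>" for \<mu>
  proof -
    have \<mu>: "borel_prob \<mu>" and le: "interaction (W b) \<mu> \<le> line_energy s (rho_line s)"
      using that borel_prob_rho1D[OF s] unfolding minimizer_def energy_le_iff I[symmetric, of b] by auto
    have "line_energy s (rho_line s) + interaction D \<mu> \<le> interaction (W b) \<mu>"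
      unfolding split[OF \<mu>] by (intro add_right_mono ge \<mu>)
    also note le
    finally have "line_energy s (rho_line s) + interaction D \<mu> \<le> line_energy s (rho_line s) + 0" by simp
    then have "interaction D \<mu> = 0"
      using line_energy_rho_line_finite[OF s] unfolding ennreal_add_left_cancel_le by auto
    then have AE0: "AE x in \<mu>. AE y in \<mu>. D (x - y) = 0"
      unfolding interaction_def by (intro nn_integral_double_eq_0D \<mu>) measurable
    have D0: "fst z = 0" if "D z = 0" for z
    proof (rule ccontr)
      assume f: "fst z \<noteq> 0"
      then have z: "z \<noteq> 0" by auto
      then have "0 < \<bar>fst z / norm z\<bar>" using f by simp
      then have "0 < \<bar>half_angle z - pi / 2\<bar>" using half_angle_distance[of z] by linarith
      then have "0 < c * \<bar>half_angle z - pi / 2\<bar>\<^sup>2" using c(1) by simp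
      also have "\<dots> \<le> \<omega> (half_angle z)" by (rule c(2)[OF half_angle_range])
      finally have "0 < (b - a) * norm z powr (- s) * \<omega> (half_angle z)" using ab z by simp
      then show False using that z by (simp add: D_def ennreal_eq_0_iff)
    qed
    have "AE x in \<mu>. AE y in \<mu>. fst x = fst y"
      using AE0
    proof eventually_elim
      case (elim x)
      then show ?case
      proof eventually_elim
        case (elim y)
        from D0[OF elim] show ?case by simp
      qed
    qed
    then show ?thesis by (intro vertical_minimizer[OF s W0 \<mu> _ le])
  qed
  ultimately show ?thesis
    unfolding unique_minimizer_upto_translation_def W_def by blast
qed

section \<open>Instability for weak anisotropy\<close>

lemma nn_integral_rho_line_reflect:
  assumes [measurable]: "f \<in> borel_measurable borel"
  shows "(\<integral>\<^sup>+u. f (- u) \<partial>rho_line s) = (\<integral>\<^sup>+u. f u \<partial>rho_line s)"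
proof -
  have "(\<integral>\<^sup>+u. f u \<partial>rho_line s) = (\<integral>\<^sup>+u. ennreal (rho1 s u) * f u \<partial>lborel)"
    unfolding rho_line_def by (rule nn_integral_density) measurable
  also have "\<dots> = (\<integral>\<^sup>+u. ennreal (rho1 s (- u)) * f (- u) \<partial>lborel)"
    by (rule nn_integral_reflect) measurable
  also have "\<dots> = (\<integral>\<^sup>+u. f (- u) \<partial>rho_line s)"
    unfolding rho1_minus rho_line_def by (rule nn_integral_density[symmetric]) measurable
  finally show ?thesis ..
qed

lemma AE_rho_line_nonzero: "AE t in rho_line s. t \<noteq> 0"
  unfolding rho_line_def using AE_lborel_singleton[of 0]
  by (subst AE_density) (auto elim: eventually_mono)

text \<open>
  The potential for \<open>\<alpha> = 0\<close>, and the kernel obtained from the one-dimensional interaction by averaging over the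
  reflection \<open>u \<mapsto> -u\<close>, which leaves \<open>\<rho>\<^sub>1\<close> invariant.
\<close>

definition isotropic :: "real \<Rightarrow> real \<times> real \<Rightarrow> ennreal" where
  "isotropic s z = (if z = 0 then \<infinity> else ennreal (norm z powr (- s) + (norm z)\<^sup>2))"

definition symmetrized :: "real \<Rightarrow> real \<times> real \<Rightarrow> ennreal" where
  "symmetrized s z = ennreal (1 / 2) *
    ((riesz s (fst z - snd z) + ennreal ((fst z - snd z)\<^sup>2)) + (riesz s (fst z + snd z) + ennreal ((fst z + snd z)\<^sup>2)))"

lemma measurable_isotropic [measurable]: "isotropic s \<in> borel_measurable borel"
  unfolding isotropic_def[abs_def] by measurable

text \<open>
  The geometric mean of the two terms on the right is \<open>|t\<^sup>2 - u\<^sup>2| powr (-s / 2)\<close>, and \<open>|t\<^sup>2 - u\<^sup>2| \<le> t\<^sup>2 + u\<^sup>2\<close>, strictly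
  when \<open>t\<close> and \<open>u\<close> are nonzero.
\<close>

lemma powr_neg_mean:
  fixes t u s :: real
  assumes s: "0 < s" and ne: "t \<noteq> u" "t \<noteq> - u"
  shows "(t\<^sup>2 + u\<^sup>2) powr (- s / 2) \<le> (\<bar>t - u\<bar> powr (- s) + \<bar>t + u\<bar> powr (- s)) / 2"
    and "t \<noteq> 0 \<Longrightarrow> u \<noteq> 0 \<Longrightarrow> (t\<^sup>2 + u\<^sup>2) powr (- s / 2) < (\<bar>t - u\<bar> powr (- s) + \<bar>t + u\<bar> powr (- s)) / 2"
proof -
  let ?p = "\<bar>t - u\<bar> * \<bar>t + u\<bar>"
  have p: "?p = \<bar>t\<^sup>2 - u\<^sup>2\<bar>"
    by (simp add: power2_eq_square algebra_simps flip: abs_mult)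
  have p0: "0 < ?p" using ne by (auto simp: add_eq_0_iff)
  have "sqrt (\<bar>t - u\<bar> powr (- s) * \<bar>t + u\<bar> powr (- s)) \<le> (\<bar>t - u\<bar> powr (- s) + \<bar>t + u\<bar> powr (- s)) / 2"
    by (rule arith_geo_mean_sqrt) auto
  moreover have "sqrt (\<bar>t - u\<bar> powr (- s) * \<bar>t + u\<bar> powr (- s)) = ?p powr (- s / 2)"
    unfolding powr_mult[symmetric] using p0 powr_powr[of ?p "- s" "1 / 2"] by (simp add: powr_half_sqrt)
  ultimately have mean: "?p powr (- s / 2) \<le> (\<bar>t - u\<bar> powr (- s) + \<bar>t + u\<bar> powr (- s)) / 2" by simp
  have "?p \<le> t\<^sup>2 + u\<^sup>2" unfolding p by (simp add: abs_le_iff)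
  then have "(t\<^sup>2 + u\<^sup>2) powr (- s / 2) \<le> ?p powr (- s / 2)" using p0 s by (intro powr_mono2') auto
  with mean show "(t\<^sup>2 + u\<^sup>2) powr (- s / 2) \<le> (\<bar>t - u\<bar> powr (- s) + \<bar>t + u\<bar> powr (- s)) / 2" by linarith
  assume tu: "t \<noteq> 0" "u \<noteq> 0"
  have "?p < t\<^sup>2 + u\<^sup>2" unfolding p using tu by (simp add: abs_less_iff)
  then have "(t\<^sup>2 + u\<^sup>2) powr (- s / 2) < ?p powr (- s / 2)" using p0 s by (intro powr_less_mono2_neg) auto
  with mean show "(t\<^sup>2 + u\<^sup>2) powr (- s / 2) < (\<bar>t - u\<bar> powr (- s) + \<bar>t + u\<bar> powr (- s)) / 2" by linarith
qed

lemma isotropic_pair: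
  assumes "(t, u) \<noteq> 0"
  shows "isotropic s (t, u) = ennreal ((t\<^sup>2 + u\<^sup>2) powr (- s / 2) + (t\<^sup>2 + u\<^sup>2))"
proof -
  have "0 < t\<^sup>2 + u\<^sup>2" using assms by (auto simp: zero_prod_def sum_power2_gt_zero_iff)
  then have "norm (t, u) powr (- s) = (t\<^sup>2 + u\<^sup>2) powr (- s / 2)" "(norm (t, u))\<^sup>2 = t\<^sup>2 + u\<^sup>2"
    using powr_powr[of "t\<^sup>2 + u\<^sup>2" "1 / 2" "- s"] by (simp_all add: norm_prod_def powr_half_sqrt)
  then show ?thesis using assms by (simp add: isotropic_def)
qed

lemma symmetrized_regular:
  assumes "t \<noteq> u" "t \<noteq> - u"
  shows "symmetrized s (t, u) = ennreal ((\<bar>t - u\<bar> powr (- s) + \<bar>t + u\<bar> powr (- s)) / 2 + (t\<^sup>2 + u\<^sup>2))"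
proof -
  have ne: "t - u \<noteq> 0" "t + u \<noteq> 0" using assms by (auto simp: add_eq_0_iff)
  have "symmetrized s (t, u) = ennreal (1 / 2) *
    ennreal (\<bar>t - u\<bar> powr (- s) + (t - u)\<^sup>2 + (\<bar>t + u\<bar> powr (- s) + (t + u)\<^sup>2))"
    unfolding symmetrized_def using ne by (simp add: riesz_def del: ennreal_half)
  also have "\<dots> = ennreal (1 / 2 * (\<bar>t - u\<bar> powr (- s) + (t - u)\<^sup>2 + (\<bar>t + u\<bar> powr (- s) + (t + u)\<^sup>2)))"
    by (rule ennreal_mult'[symmetric]) simp
  also have "1 / 2 * (\<bar>t - u\<bar> powr (- s) + (t - u)\<^sup>2 + (\<bar>t + u\<bar> powr (- s) + (t + u)\<^sup>2))
    = (\<bar>t - u\<bar> powr (- s) + \<bar>t + u\<bar> powr (- s)) / 2 + (t\<^sup>2 + u\<^sup>2)"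
    by (simp add: power2_eq_square field_simps)
  finally show ?thesis .
qed

lemma symmetrized_singular:
  assumes "t = u \<or> t = - u"
  shows "symmetrized s (t, u) = \<infinity>"
  using assms unfolding symmetrized_def by (auto simp: riesz_def ennreal_mult_top)

lemma isotropic_le_symmetrized:
  assumes "0 < s"
  shows "isotropic s z \<le> symmetrized s z"
proof (cases z)
  case (Pair t u)
  show ?thesis
  proof (cases "t = u \<or> t = - u")
    case True
    then show ?thesis unfolding Pair using symmetrized_singular by simp
  next
    case False
    then have ne: "t \<noteq> u" "t \<noteq> - u" and nz: "(t, u) \<noteq> 0" by (auto simp: zero_prod_def)
    show ?thesis
      unfolding Pair isotropic_pair[OF nz] symmetrized_regular[OF ne]
      using powr_neg_mean(1)[OF assms ne] by (intro ennreal_leI) simp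
  qed
qed

lemma isotropic_less_symmetrized:
  assumes s: "0 < s" and ne: "t \<noteq> 0" "u \<noteq> 0"
  shows "isotropic s (t, u) < symmetrized s (t, u)"
proof (cases "t = u \<or> t = - u")
  case True
  have nz: "(t, u) \<noteq> 0" using ne by (auto simp: zero_prod_def)
  show ?thesis unfolding symmetrized_singular[OF True] isotropic_pair[OF nz] by simp
next
  case False
  then have reg: "t \<noteq> u" "t \<noteq> - u" by auto
  have nz: "(t, u) \<noteq> 0" using ne by (auto simp: zero_prod_def)
  have less: "(t\<^sup>2 + u\<^sup>2) powr (- s / 2) < (\<bar>t - u\<bar> powr (- s) + \<bar>t + u\<bar> powr (- s)) / 2"
    by (rule powr_neg_mean(2)[OF s reg ne])
  show ?thesis
    unfolding isotropic_pair[OF nz] symmetrized_regular[OF reg]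
  proof (rule ennreal_lessI)
    show "0 < (\<bar>t - u\<bar> powr (- s) + \<bar>t + u\<bar> powr (- s)) / 2 + (t\<^sup>2 + u\<^sup>2)"
      using le_less_trans[OF powr_ge_zero less] by (rule add_pos_nonneg) simp
  qed (use less in simp)
qed

lemma line_energy_symmetrized:
  assumes s: "0 < s" "s < 1"
  shows "line_energy s (rho_line s) = (\<integral>\<^sup>+t. \<integral>\<^sup>+u. symmetrized s (t, u) \<partial>rho_line s \<partial>rho_line s)"
proof -
  interpret real_distribution "rho_line s" by (rule real_distribution_rho_line[OF s])
  define w where "w t = riesz s t + ennreal (t\<^sup>2)" for t
  have [measurable]: "w \<in> borel_measurable borel" unfolding w_def by measurable
  have refl: "(\<integral>\<^sup>+u. w (t + u) \<partial>rho_line s) = (\<integral>\<^sup>+u. w (t - u) \<partial>rho_line s)" for t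
    using nn_integral_rho_line_reflect[of "\<lambda>u. w (t + u)" s] by simp
  have "(\<integral>\<^sup>+u. symmetrized s (t, u) \<partial>rho_line s) = (\<integral>\<^sup>+u. w (t - u) \<partial>rho_line s)" for t
  proof -
    have "(\<integral>\<^sup>+u. symmetrized s (t, u) \<partial>rho_line s) = ennreal (1 / 2) * (\<integral>\<^sup>+u. w (t - u) + w (t + u) \<partial>rho_line s)"
      unfolding symmetrized_def w_def fst_conv snd_conv by (rule nn_integral_cmult) measurable
    also have "(\<integral>\<^sup>+u. w (t - u) + w (t + u) \<partial>rho_line s) = 2 * (\<integral>\<^sup>+u. w (t - u) \<partial>rho_line s)"
      unfolding mult_2 by (subst nn_integral_add) (auto simp: refl)
    also have "ennreal (1 / 2) * (2 * (\<integral>\<^sup>+u. w (t - u) \<partial>rho_line s)) = ennreal (1 / 2 * 2) * (\<integral>\<^sup>+u. w (t - u) \<partial>rho_line s)"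
      by (subst ennreal_mult') (simp_all add: mult.assoc)
    finally show ?thesis by simp
  qed
  then show ?thesis unfolding line_energy_def w_def by simp
qed

text \<open>
  Two copies of \<open>\<rho>\<^sub>1\<close> on perpendicular axes through a common centre interact less than one copy with itself: after
  the symmetrization, the comparison holds pointwise, strictly off the two axes.
\<close>

lemma cross_interaction_less:
  assumes s: "0 < s" "s < 1"
  shows "(\<integral>\<^sup>+t. \<integral>\<^sup>+u. isotropic s (t, u) \<partial>rho_line s \<partial>rho_line s) < line_energy s (rho_line s)"
proof -
  interpret real_distribution "rho_line s" by (rule real_distribution_rho_line[OF s])
  interpret P: pair_sigma_finite "rho_line s" "rho_line s" ..
  let ?P = "rho_line s \<Otimes>\<^sub>M rho_line s"
  have [measurable]: "isotropic s \<in> borel_measurable ?P" "symmetrized s \<in> borel_measurable ?P"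
    unfolding symmetrized_def[abs_def] isotropic_def[abs_def] zero_prod_def prod_eq_iff norm_prod_def by measurable
  have iso: "(\<integral>\<^sup>+t. \<integral>\<^sup>+u. isotropic s (t, u) \<partial>rho_line s \<partial>rho_line s) = (\<integral>\<^sup>+z. isotropic s z \<partial>?P)"
    by (rule nn_integral_fst) measurable
  have sym: "line_energy s (rho_line s) = (\<integral>\<^sup>+z. symmetrized s z \<partial>?P)"
    unfolding line_energy_symmetrized[OF s] by (rule nn_integral_fst) measurable
  show ?thesis
    unfolding iso sym
  proof (rule nn_integral_less)
    have "(\<integral>\<^sup>+z. isotropic s z \<partial>?P) \<le> (\<integral>\<^sup>+z. symmetrized s z \<partial>?P)"
      by (intro nn_integral_mono isotropic_le_symmetrized s)
    then show "(\<integral>\<^sup>+z. isotropic s z \<partial>?P) \<noteq> \<infinity>"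
      unfolding sym[symmetric] using line_energy_rho_line_finite[OF s] by (auto simp: top_unique)
    show "AE z in ?P. isotropic s z \<le> symmetrized s z"
      by (intro AE_I2 isotropic_le_symmetrized s)
    show "\<not> (AE z in ?P. symmetrized s z \<le> isotropic s z)"
    proof
      assume "AE z in ?P. symmetrized s z \<le> isotropic s z"
      then have "AE t in rho_line s. AE u in rho_line s. symmetrized s (t, u) \<le> isotropic s (t, u)"
        by (rule P.AE_pair)
      then have "AE t in rho_line s. t \<noteq> 0 \<and> (AE u in rho_line s. symmetrized s (t, u) \<le> isotropic s (t, u))"
        using AE_rho_line_nonzero by eventually_elim simp
      then obtain t where t: "t \<noteq> 0" "AE u in rho_line s. symmetrized s (t, u) \<le> isotropic s (t, u)"
        using eventually_happens'[OF ae_filter_bot] by blast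
      have "AE u in rho_line s. u \<noteq> 0 \<and> symmetrized s (t, u) \<le> isotropic s (t, u)"
        using t(2) AE_rho_line_nonzero by eventually_elim simp
      then obtain u where u: "u \<noteq> 0" "symmetrized s (t, u) \<le> isotropic s (t, u)"
        using eventually_happens'[OF ae_filter_bot] by blast
      then show False using isotropic_less_symmetrized[OF s(1) t(1) u(1)] by simp
    qed
  qed measurable
qed

text \<open>
  The equal mixture of \<open>\<rho>\<^sub>1\<close> on the two coordinate axes. A fair coin selects the axis, so that the mixture is an image
  measure and its integrals split by Tonelli.
\<close>

definition cross :: "real \<Rightarrow> (real \<times> real) measure" where
  "cross s = distr (measure_pmf (bernoulli_pmf (1 / 2)) \<Otimes>\<^sub>M rho_line s) borel (\<lambda>(b, t). if b then (0, t) else (t, 0))"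

lemma measurable_cross_map:
  assumes "0 < s" "s < 1"
  shows "(\<lambda>(b, t). if b then (0, t) else (t, 0)) \<in> measure_pmf (bernoulli_pmf (1 / 2)) \<Otimes>\<^sub>M rho_line s \<rightarrow>\<^sub>M (borel :: (real \<times> real) measure)"
proof -
  interpret real_distribution "rho_line s" by (rule real_distribution_rho_line[OF assms])
  show ?thesis by measurable
qed

lemma borel_prob_cross:
  assumes s: "0 < s" "s < 1"
  shows "borel_prob (cross s)"
proof -
  interpret real_distribution "rho_line s" by (rule real_distribution_rho_line[OF s])
  have "prob_space (measure_pmf (bernoulli_pmf (1 / 2)) \<Otimes>\<^sub>M rho_line s)"
    by (intro prob_space_pair prob_space_measure_pmf) unfold_locales
  then show ?thesis
    unfolding borel_prob_def cross_def
    by (auto intro!: prob_space.prob_space_distr measurable_cross_map s)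
qed

lemma nn_integral_cross:
  assumes s: "0 < s" "s < 1" and [measurable]: "f \<in> borel_measurable borel"
  shows "(\<integral>\<^sup>+z. f z \<partial>cross s) = ennreal (1 / 2) * ((\<integral>\<^sup>+t. f (0, t) \<partial>rho_line s) + (\<integral>\<^sup>+t. f (t, 0) \<partial>rho_line s))"
proof -
  interpret real_distribution "rho_line s" by (rule real_distribution_rho_line[OF s])
  note [measurable] = measurable_cross_map[OF s]
  have "(\<integral>\<^sup>+z. f z \<partial>cross s) = (\<integral>\<^sup>+p. f (case p of (b, t) \<Rightarrow> if b then (0, t) else (t, 0)) \<partial>(measure_pmf (bernoulli_pmf (1 / 2)) \<Otimes>\<^sub>M rho_line s))"
    unfolding cross_def by (rule nn_integral_distr) measurable
  also have "\<dots> = (\<integral>\<^sup>+b. \<integral>\<^sup>+t. f (case (b, t) of (b, t) \<Rightarrow> if b then (0, t) else (t, 0)) \<partial>rho_line s \<partial>measure_pmf (bernoulli_pmf (1 / 2)))"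
    by (rule nn_integral_fst[symmetric]) measurable
  also have "\<dots> = ennreal (1 / 2) * ((\<integral>\<^sup>+t. f (0, t) \<partial>rho_line s) + (\<integral>\<^sup>+t. f (t, 0) \<partial>rho_line s))"
    by (subst nn_integral_bernoulli_pmf) (auto simp: distrib_left mult.commute)
  finally show ?thesis .
qed

text \<open>
  By isotropy the two self-interactions agree, and so do the two mutual interactions.
\<close>

lemma interaction_isotropic_cross:
  assumes s: "0 < s" "s < 1"
  shows "interaction (isotropic s) (cross s)
    = ennreal (1 / 2) * (line_energy s (rho_line s) + (\<integral>\<^sup>+t. \<integral>\<^sup>+u. isotropic s (t, u) \<partial>rho_line s \<partial>rho_line s))"
proof -
  interpret real_distribution "rho_line s" by (rule real_distribution_rho_line[OF s])
  interpret C: prob_space "cross s" using borel_prob_cross[OF s] by (simp add: borel_prob_def)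
  have sets [measurable_cong, simp]: "sets (cross s) = sets borel" using borel_prob_cross[OF s] by (simp add: borel_prob_def)
  let ?i = "isotropic s"
  let ?L = "line_energy s (rho_line s)"
  let ?X = "\<integral>\<^sup>+t. \<integral>\<^sup>+u. ?i (t, u) \<partial>rho_line s \<partial>rho_line s"
  have line: "?i (0, v) = riesz s v + ennreal (v\<^sup>2)" "?i (v, 0) = riesz s v + ennreal (v\<^sup>2)" for v
    by (auto simp: isotropic_def riesz_def zero_prod_def norm_prod_def)
  have swap: "?i (- u, t) = ?i (t, u)" "?i (t, - u) = ?i (t, u)" for t u
    by (auto simp: isotropic_def zero_prod_def norm_prod_def add.commute)
  have inner: "(\<integral>\<^sup>+y. ?i (x - y) \<partial>cross s)
      = ennreal (1 / 2) * ((\<integral>\<^sup>+u. ?i (x - (0, u)) \<partial>rho_line s) + (\<integral>\<^sup>+u. ?i (x - (u, 0)) \<partial>rho_line s))" for x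
    by (rule nn_integral_cross[OF s]) measurable
  have v: "(\<integral>\<^sup>+t. (\<integral>\<^sup>+y. ?i ((0, t) - y) \<partial>cross s) \<partial>rho_line s) = ennreal (1 / 2) * (?L + ?X)"
    unfolding inner line_energy_def line[symmetric] diff_Pair diff_0 diff_0_right swap
    by (subst nn_integral_cmult, measurable, subst nn_integral_add, measurable)
  have h: "(\<integral>\<^sup>+t. (\<integral>\<^sup>+y. ?i ((t, 0) - y) \<partial>cross s) \<partial>rho_line s) = ennreal (1 / 2) * (?L + ?X)"
    unfolding inner line_energy_def line(2)[symmetric] diff_Pair diff_0 diff_0_right swap
    by (subst nn_integral_cmult, measurable, subst nn_integral_add, measurable) (simp add: add.commute)
  have "interaction ?i (cross s) = ennreal (1 / 2) * (ennreal (1 / 2) * (?L + ?X) + ennreal (1 / 2) * (?L + ?X))"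
    unfolding interaction_def v[symmetric] unfolding v unfolding h[symmetric] 
    by (subst nn_integral_cross[OF s]) (measurable, simp only: v h)
  also have "ennreal (1 / 2) * (?L + ?X) + ennreal (1 / 2) * (?L + ?X) = ennreal (1 / 2 + 1 / 2) * (?L + ?X)"
    by (subst ennreal_plus) (auto simp: distrib_right)
  finally show ?thesis by simp
qed

text \<open>
  For the isotropic potential the cross has strictly smaller energy than \<open>\<rho>\<^sub>1\<^sub>D\<close>. The anisotropic term changes the
  energy of the cross by at most a factor \<open>1 + \<alpha> M\<close> with \<open>M\<close> a bound for \<open>\<omega>\<close>, and leaves that of \<open>\<rho>\<^sub>1\<^sub>D\<close> unchanged.
\<close>

lemma not_minimizer_weak_anisotropy:
  assumes s: "0 < s" "s < 1"
    and \<omega>: "continuous_on UNIV \<omega>" "\<And>\<theta>. 0 \<le> \<omega> \<theta>" "\<And>\<theta>. \<omega> (\<theta> + pi) = \<omega> \<theta>" "\<omega> (pi / 2) = 0"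
  shows "\<exists>\<alpha>>0. \<not> minimizer (potential s (\<lambda>\<theta>. 1 + \<alpha> * \<omega> \<theta>)) (rho1D s)"
proof -
  obtain M where M: "\<And>\<theta>. \<theta> \<in> {0..pi} \<Longrightarrow> \<omega> \<theta> \<le> M"
  proof -
    have "compact (\<omega> ` {0..pi})"
      by (intro compact_continuous_image continuous_on_subset[OF \<omega>(1)]) auto
    then have "bdd_above (\<omega> ` {0..pi})" by (simp add: compact_imp_bounded bounded_imp_bdd_above)
    then obtain M where "\<forall>v\<in>\<omega> ` {0..pi}. v \<le> M" by (auto simp: bdd_above_def)
    then show ?thesis using that[of M] by auto
  qed
  have M0: "0 \<le> M" using M[of 0] \<omega>(2)[of 0] by auto
  let ?X = "\<integral>\<^sup>+t. \<integral>\<^sup>+u. isotropic s (t, u) \<partial>rho_line s \<partial>rho_line s"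
  obtain l where l: "line_energy s (rho_line s) = ennreal l" "0 \<le> l"
    using line_energy_rho_line_finite[OF s] by (cases "line_energy s (rho_line s)") auto
  obtain x where x: "?X = ennreal x" "0 \<le> x"
    using cross_interaction_less[OF s] by (cases ?X) (auto simp: l)
  have xl: "x < l" using cross_interaction_less[OF s] x l by (simp add: ennreal_less_iff)
  \<comment> \<open>The bound \<open>\<alpha> M (l + x) < l - x\<close> is what is needed; adding \<open>1\<close> to each factor of the denominator makes it strict
    and keeps the quotient defined for \<open>M = 0\<close>.\<close>
  define \<alpha> where "\<alpha> = (l - x) / ((M + 1) * (l + x + 1))"
  have den: "0 < (M + 1) * (l + x + 1)" using M0 x l by (intro mult_pos_pos) auto
  have \<alpha>: "0 < \<alpha>" unfolding \<alpha>_def using xl den by simp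
  have small: "(1 + \<alpha> * M) * (1 / 2 * (l + x)) < l"
  proof -
    have "M * (l + x) < (M + 1) * (l + x + 1)" using M0 x l by (simp add: algebra_simps)
    then have "(l - x) * (M * (l + x)) < (l - x) * ((M + 1) * (l + x + 1))" using xl by (intro mult_strict_left_mono) auto
    then have "\<alpha> * (M * (l + x)) < l - x" unfolding \<alpha>_def using den by (simp add: divide_less_eq)
    then show ?thesis by (simp add: algebra_simps)
  qed
  define W where "W = potential s (\<lambda>\<theta>. 1 + \<alpha> * \<omega> \<theta>)"
  have per: "1 + \<alpha> * \<omega> (\<theta> + pi) = 1 + \<alpha> * \<omega> \<theta>" for \<theta> by (simp add: \<omega>(3))
  have meas: "W \<in> borel_measurable borel"
    unfolding W_def by (rule measurable_potential) (use \<omega> in \<open>auto intro!: continuous_intros\<close>)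
  have W0: "W (0, u) = riesz s u + ennreal (u\<^sup>2)" for u
    unfolding W_def by (rule potential_vertical) (use \<omega> in auto)
  have le: "W z \<le> ennreal (1 + \<alpha> * M) * isotropic s z" for z
  proof (cases "z = 0")
    case True
    have "0 < 1 + \<alpha> * M" using \<alpha> M0 by (intro add_pos_nonneg) auto
    then show ?thesis using True by (simp add: isotropic_def ennreal_mult_top)
  next
    case False
    have "\<alpha> * \<omega> (half_angle z) \<le> \<alpha> * M" using M[OF half_angle_range[of z]] \<alpha> by (intro mult_left_mono) auto
    then have "norm z powr (- s) * (1 + \<alpha> * \<omega> (half_angle z)) \<le> norm z powr (- s) * (1 + \<alpha> * M)"
      by (intro mult_left_mono) auto
    moreover have "1 * (norm z)\<^sup>2 \<le> (1 + \<alpha> * M) * (norm z)\<^sup>2" using \<alpha> M0 by (intro mult_right_mono) auto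
    ultimately have "norm z powr (- s) * (1 + \<alpha> * \<omega> (half_angle z)) + (norm z)\<^sup>2 \<le> (1 + \<alpha> * M) * (norm z powr (- s) + (norm z)\<^sup>2)"
      by (simp add: algebra_simps)
    then have "W z \<le> ennreal ((1 + \<alpha> * M) * (norm z powr (- s) + (norm z)\<^sup>2))"
      unfolding W_def potential_eq[where \<Omega> = "\<lambda>\<theta>. 1 + \<alpha> * \<omega> \<theta>", OF per] using False by (simp add: ennreal_leI)
    also have "\<dots> = ennreal (1 + \<alpha> * M) * isotropic s z"
      unfolding isotropic_def using False \<alpha> M0 by (simp only: if_False) (intro ennreal_mult; simp)
    finally show ?thesis .
  qed
  interpret C: prob_space "cross s" using borel_prob_cross[OF s] by (simp add: borel_prob_def)
  have sets [measurable_cong, simp]: "sets (cross s) = sets borel" using borel_prob_cross[OF s] by (simp add: borel_prob_def)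
  have "interaction W (cross s) \<le> (\<integral>\<^sup>+x. \<integral>\<^sup>+y. ennreal (1 + \<alpha> * M) * isotropic s (x - y) \<partial>cross s \<partial>cross s)"
    unfolding interaction_def by (intro nn_integral_mono le)
  also have "\<dots> = ennreal (1 + \<alpha> * M) * interaction (isotropic s) (cross s)"
    unfolding interaction_def by (subst nn_integral_cmult, measurable, subst nn_integral_cmult, measurable)
  also have "\<dots> = ennreal (1 + \<alpha> * M) * (ennreal (1 / 2) * (ennreal l + ennreal x))"
    unfolding interaction_isotropic_cross[OF s] l x ..
  also have "\<dots> = ennreal ((1 + \<alpha> * M) * (1 / 2 * (l + x)))"
    using \<alpha> M0 l x by (subst ennreal_mult', simp, subst ennreal_mult', simp, simp)
  also have "\<dots> < ennreal l"
    using small xl x by (intro ennreal_lessI) auto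
  also have "\<dots> = interaction W (rho1D s)"
    unfolding interaction_rho1D[OF s meas W0] l ..
  finally have "\<not> minimizer W (rho1D s)"
    using borel_prob_cross[OF s] unfolding minimizer_def energy_le_iff by (auto simp flip: not_less)
  then show ?thesis using \<alpha> unfolding W_def by blast
qed

theorem theorem5p1:
  fixes s :: real
  assumes "0 < s" and "s < 1"
  shows "\<exists>C :: real.
    (\<forall>\<Omega> :: real \<Rightarrow> real.
       smooth \<Omega> \<and> (\<forall>\<theta>. 0 < \<Omega> \<theta>) \<and> (\<forall>\<theta>. \<Omega> (\<theta> + pi) = \<Omega> \<theta>) \<and> \<Omega> (pi / 2) = 1 \<and>
       (\<forall>\<theta>\<in>{0..pi}. \<Omega> \<theta> \<ge> 1 + C * \<bar>\<theta> - pi / 2\<bar>\<^sup>2)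
       \<longrightarrow> unique_minimizer_upto_translation (potential s \<Omega>) (rho1D s)) \<and>
    (\<forall>(\<omega> :: real \<Rightarrow> real) c :: real.
       smooth \<omega> \<and> (\<forall>\<theta>. 0 \<le> \<omega> \<theta>) \<and> (\<exists>\<theta>. \<omega> \<theta> \<noteq> 0) \<and>
       (\<forall>\<theta>. \<omega> (\<theta> + pi) = \<omega> \<theta>) \<and> \<omega> (pi / 2) = 0 \<and>
       0 < c \<and> (\<forall>\<theta>\<in>{0..pi}. \<omega> \<theta> \<ge> c * \<bar>\<theta> - pi / 2\<bar>\<^sup>2)
       \<longrightarrow> (\<exists>!\<alpha>s :: real. 0 < \<alpha>s \<and> \<alpha>s \<le> C / c \<and>
             (\<forall>\<alpha>>\<alpha>s. unique_minimizer_upto_translation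
                (potential s (\<lambda>\<theta>. 1 + \<alpha> * \<omega> \<theta>)) (rho1D s)) \<and>
             (\<forall>\<alpha>. 0 \<le> \<alpha> \<and> \<alpha> < \<alpha>s \<longrightarrow>
                \<not> minimizer (potential s (\<lambda>\<theta>. 1 + \<alpha> * \<omega> \<theta>)) (rho1D s))))"
proof (intro exI[of _ "comparison_const s"] conjI allI impI)
  fix \<Omega> :: "real \<Rightarrow> real"
  assume "smooth \<Omega> \<and> (\<forall>\<theta>. 0 < \<Omega> \<theta>) \<and> (\<forall>\<theta>. \<Omega> (\<theta> + pi) = \<Omega> \<theta>) \<and> \<Omega> (pi / 2) = 1 \<and>
       (\<forall>\<theta>\<in>{0..pi}. \<Omega> \<theta> \<ge> 1 + comparison_const s * \<bar>\<theta> - pi / 2\<bar>\<^sup>2)"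
  then show "unique_minimizer_upto_translation (potential s \<Omega>) (rho1D s)"
    by (intro unique_minimizer_of_quadratic_bound assms smooth_imp_continuous) auto
next
  fix \<omega> :: "real \<Rightarrow> real" and c :: real
  assume H: "smooth \<omega> \<and> (\<forall>\<theta>. 0 \<le> \<omega> \<theta>) \<and> (\<exists>\<theta>. \<omega> \<theta> \<noteq> 0) \<and>
       (\<forall>\<theta>. \<omega> (\<theta> + pi) = \<omega> \<theta>) \<and> \<omega> (pi / 2) = 0 \<and>
       0 < c \<and> (\<forall>\<theta>\<in>{0..pi}. \<omega> \<theta> \<ge> c * \<bar>\<theta> - pi / 2\<bar>\<^sup>2)"
  then have \<omega>: "continuous_on UNIV \<omega>" "\<And>\<theta>. 0 \<le> \<omega> \<theta>" "\<And>\<theta>. \<omega> (\<theta> + pi) = \<omega> \<theta>" "\<omega> (pi / 2) = 0"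
    and c: "0 < c" "\<And>\<theta>. \<theta> \<in> {0..pi} \<Longrightarrow> c * \<bar>\<theta> - pi / 2\<bar>\<^sup>2 \<le> \<omega> \<theta>"
    using smooth_imp_continuous by auto
  define P where "P \<alpha> = potential s (\<lambda>\<theta>. 1 + \<alpha> * \<omega> \<theta>)" for \<alpha>
  define K where "K = comparison_const s"
  have K: "0 < K / c" using comparison_const_ge[OF assms] c(1) by (simp add: K_def)
  have mono: "unique_minimizer_upto_translation (P b) (rho1D s)" if "0 \<le> a" "a < b" "minimizer (P a) (rho1D s)" for a b
    unfolding P_def using that unfolding P_def by (intro minimizer_rho1D_mono[OF assms \<omega> c])
  have uniqueD: "minimizer W \<rho>" if "unique_minimizer_upto_translation W \<rho>" for W \<rho>
    using that by (simp add: unique_minimizer_upto_translation_def)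
  have Kmin: "unique_minimizer_upto_translation (P (K / c)) (rho1D s)"
    unfolding P_def
  proof (rule unique_minimizer_of_quadratic_bound[OF assms])
    show "continuous_on UNIV (\<lambda>\<theta>. 1 + K / c * \<omega> \<theta>)" using \<omega>(1) by (intro continuous_intros)
    fix \<theta> assume "\<theta> \<in> {0..pi}"
    from mult_left_mono[OF c(2)[OF this] less_imp_le[OF K]]
    show "1 + comparison_const s * \<bar>\<theta> - pi / 2\<bar>\<^sup>2 \<le> 1 + K / c * \<omega> \<theta>"
      using c(1) by (simp add: K_def)
  qed (use \<omega> in auto)
  obtain \<alpha>1 where \<alpha>1: "0 < \<alpha>1" "\<not> minimizer (P \<alpha>1) (rho1D s)"
    using not_minimizer_weak_anisotropy[OF assms \<omega>] unfolding P_def by blast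
  define S where "S = {\<alpha>. 0 \<le> \<alpha> \<and> minimizer (P \<alpha>) (rho1D s)}"
  \<comment> \<open>The infimum of the strengths for which \<open>\<rho>\<^sub>1\<^sub>D\<close> is a minimizer is the critical strength; by monotonicity, a strength
    at which minimality fails is a positive lower bound.\<close>
  have S_lower: "\<alpha>1 \<le> \<alpha>" if "\<alpha> \<in> S" for \<alpha>
    using mono[of \<alpha> \<alpha>1] uniqueD \<alpha>1 that unfolding S_def by force
  have KS: "K / c \<in> S" using K uniqueD[OF Kmin] by (simp add: S_def)
  have bdd: "bdd_below S" using S_lower by (auto simp: bdd_below_def)
  have Inf1: "\<alpha>1 \<le> Inf S" using KS S_lower by (intro cInf_greatest) auto
  have InfK: "Inf S \<le> K / c" using KS bdd by (rule cInf_lower)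
  have above: "unique_minimizer_upto_translation (P \<alpha>) (rho1D s)" if "Inf S < \<alpha>" for \<alpha>
  proof -
    obtain \<beta> where "\<beta> \<in> S" "\<beta> < \<alpha>" using cInf_lessD[of S \<alpha>] KS \<open>Inf S < \<alpha>\<close> by auto
    then show ?thesis using mono[of \<beta> \<alpha>] by (auto simp: S_def)
  qed
  have below: "\<not> minimizer (P \<alpha>) (rho1D s)" if "0 \<le> \<alpha>" "\<alpha> < Inf S" for \<alpha>
    using cInf_lower[OF _ bdd, of \<alpha>] that by (auto simp: S_def)
  show "\<exists>!\<alpha>s. 0 < \<alpha>s \<and> \<alpha>s \<le> comparison_const s / c \<and>
             (\<forall>\<alpha>>\<alpha>s. unique_minimizer_upto_translation (potential s (\<lambda>\<theta>. 1 + \<alpha> * \<omega> \<theta>)) (rho1D s)) \<and>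
             (\<forall>\<alpha>. 0 \<le> \<alpha> \<and> \<alpha> < \<alpha>s \<longrightarrow> \<not> minimizer (potential s (\<lambda>\<theta>. 1 + \<alpha> * \<omega> \<theta>)) (rho1D s))"
    unfolding P_def[symmetric] K_def[symmetric]
  proof (intro ex1I[of _ "Inf S"] conjI allI impI)
    show "0 < Inf S" using Inf1 \<alpha>1 by linarith
  next
    fix a
    assume a: "0 < a \<and> a \<le> K / c \<and> (\<forall>\<alpha>>a. unique_minimizer_upto_translation (P \<alpha>) (rho1D s)) \<and>
       (\<forall>\<alpha>. 0 \<le> \<alpha> \<and> \<alpha> < a \<longrightarrow> \<not> minimizer (P \<alpha>) (rho1D s))"
    show "a = Inf S"
    proof (rule ccontr)
      assume "a \<noteq> Inf S"
      then consider "a < Inf S" | "Inf S < a" by linarith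
      then show False
      proof cases
        case 1
        then obtain m where "a < m" "m < Inf S" using dense by blast
        then show False using a uniqueD below[of m] by auto
      next
        case 2
        then obtain m where "Inf S < m" "m < a" using dense by blast
        then show False using a uniqueD[OF above] Inf1 \<alpha>1 by force
      qed
    qed
  qed (use InfK above below in auto)
qed

end
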